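(* Let $n\ge 3$, $0\le p\le n$, and let $(M,h)$ be the Euclidean space $(\mathbb{R}^n,\langle\cdot,\cdot\rangle_n)$. Let $j\in\mathbb{N}$ (i.e. $j\geq 1$) and $\lambda\in\mathbb{C}$ with $\lambda\neq\tfrac n2-p-N$ for all $N\in\{1,\dots,j\}$ and $\lambda\ne n-2p$. Then the solution operators defined in the context are given by $$\mathcal{T}^{(-)}_{2j}(\lambda)=\frac{1}{4^{j-1}(j-1)!\,(\lambda-\tfrac{n-2p}{2}+1)_{j-1}(\lambda-n+2p)}\;\delta(d\delta)^{j-1},$$ $$\mathcal{T}^{(+)}_{2j}(\lambda)=\frac{1}{4^{j}j!\,(\lambda-\tfrac{n-2p}{2}+1)_{j}(\lambda-n+2p)}\Big[(\lambda-n+2p)(\delta d)^j+(\lambda-n+2p+2j)(d\delta)^j\Big],$$ with $\mathcal{T}^{(-)}_0(\lambda)=0$ and $\mathcal{T}^{(+)}_0(\lambda)=\mathrm{Id}$.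
   Context: Here $d$ is the exterior differential and $\delta$ the codifferential (formal adjoint of $d$) on $(\mathbb{R}^n,\langle\cdot,\cdot\rangle_n)$; $(a)_m=a(a+1)\cdots(a+m-1)$, $(a)_0=1$. Let $g_+=x_{n+1}^{-2}(dx_{n+1}^2+\langle\cdot,\cdot\rangle_n)$ be the hyperbolic metric on the upper half space $\mathbb{R}^{n+1}_{>0}=\{x_{n+1}>0\}$ and $\Delta^{g_+}=d\delta^{g_+}+\delta^{g_+}d$ its (nonnegative) form Laplacian. Consider the eigenequation $$\Delta^{g_+}\omega=\lambda(n-2p-\lambda)\,\omega$$ for formal $p$-forms $$\omega=x_{n+1}^\lambda\Big[\sum_{j\ge0}x_{n+1}^j\omega^{(+)}_j+\tfrac{dx_{n+1}}{x_{n+1}}\wedge\sum_{j\ge0}x_{n+1}^j\omega^{(-)}_j\Big],\qquad \omega^{(+)}_j\in\Omega^p(\mathbb{R}^n),\ \omega^{(-)}_j\in\Omega^{p-1}(\mathbb{R}^n),$$ with $\omega^{(+)}_0=\varphi\in\Omega^p(\mathbb{R}^n)$ prescribed, $\omega^{(-)}_0=0$, and $\omega^{(\pm)}_{2j-1}=0$ for $j\ge 1$ (here $\Omega^{-1}=0$). The solution operators $\mathcal{T}^{(+)}_{2j}(\lambda)$ and $\mathcal{T}^{(-)}_{2j}(\lambda)$ are the natural differential operators on $\mathbb{R}^n$, from $\Omega^p(\mathbb{R}^n)$ to $\Omega^p(\mathbb{R}^n)$ and $\Omega^{p-1}(\mathbb{R}^n)$ respectively, with coefficients rational in $\lambda$,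 such that for every $\varphi$ the forms $\omega^{(+)}_{2j}=\mathcal{T}^{(+)}_{2j}(\lambda)\varphi$ and $\omega^{(-)}_{2j}=\mathcal{T}^{(-)}_{2j}(\lambda)\varphi$ solve the eigenequation formally (order by order in $x_{n+1}$). *)

theory Defs
  imports "HOL-Analysis.Analysis"
begin

section \<open>Smooth functions and complex-valued differential forms\<close>

text \<open>The library has no notion of a \<open>C\<^sup>\<infinity>\<close> function on an open set.\<close>

fun differentiable_upto ::
  "nat \<Rightarrow> 'a::euclidean_space set \<Rightarrow> ('a \<Rightarrow> complex) \<Rightarrow> bool" where
  "differentiable_upto 0 U f \<longleftrightarrow> continuous_on U f"
| "differentiable_upto (Suc k) U f \<longleftrightarrow>
     (\<forall>x\<in>U. f differentiable (at x)) \<and>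
     (\<forall>v. differentiable_upto k U (\<lambda>x. frechet_derivative f (at x) v))"

definition smooth_on :: "'a::euclidean_space set \<Rightarrow> ('a \<Rightarrow> complex) \<Rightarrow> bool" where
  "smooth_on U f \<longleftrightarrow> (\<forall>k. differentiable_upto k U f)"

text \<open>A form assigns to a point a function of a list of tangent vectors; the length of the
  list is the degree.  Degrees are integers: since no list has negative length, the space of
  forms of degree \<open>-1\<close> is \<open>{0}\<close>.  To make equality of forms on an open set \<open>U\<close> plain equality
  of functions, forms on \<open>U\<close> are \<open>0\<close> outside \<open>U\<close> and on lists of the wrong length.\<close>

type_synonym 'a form = "'a \<Rightarrow> 'a list \<Rightarrow> complex"

definition alternating_multilinear :: "('a::euclidean_space list \<Rightarrow> complex) \<Rightarrow> bool" where
  "alternating_multilinear w \<longleftrightarrow>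
     (\<forall>vs. \<forall>i<length vs. linear (\<lambda>v. w (vs[i := v]))) \<and>
     (\<forall>vs. \<not> distinct vs \<longrightarrow> w vs = 0)"

definition Omega :: "'a::euclidean_space set \<Rightarrow> int \<Rightarrow> 'a form set" where
  "Omega U k = {w.
     (\<forall>x. alternating_multilinear (w x)) \<and>
     (\<forall>x vs. x \<notin> U \<or> int (length vs) \<noteq> k \<longrightarrow> w x vs = 0) \<and>
     (\<forall>vs. smooth_on U (\<lambda>x. w x vs))}"

definition compactly_supported :: "'a::euclidean_space set \<Rightarrow> 'a form \<Rightarrow> bool" where
  "compactly_supported U w \<longleftrightarrow>
     (\<exists>K. compact K \<and> K \<subseteq> U \<and> (\<forall>x vs. x \<notin> K \<longrightarrow> w x vs = 0))"

definition remove_nth :: "nat \<Rightarrow> 'b list \<Rightarrow> 'b list" where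
  "remove_nth i vs = take i vs @ drop (Suc i) vs"

definition ext_d :: "'a::euclidean_space set \<Rightarrow> 'a form \<Rightarrow> 'a form" where
  "ext_d U w = (\<lambda>x vs. if x \<in> U
     then \<Sum>i<length vs.
       (-1) ^ i * frechet_derivative (\<lambda>y. w y (remove_nth i vs)) (at x) (vs ! i)
     else 0)"

text \<open>Wedge product \<open>s \<and> w\<close> with a one-form \<open>s\<close> from the left.\<close>

definition wedge1 ::
  "('a::euclidean_space \<Rightarrow> 'a \<Rightarrow> complex) \<Rightarrow> 'a form \<Rightarrow> 'a form" where
  "wedge1 s w = (\<lambda>x vs. \<Sum>i<length vs. (-1) ^ i * s x (vs ! i) * w x (remove_nth i vs))"

definition pullback ::
  "('a::euclidean_space \<Rightarrow> 'b::euclidean_space) \<Rightarrow> 'b form \<Rightarrow> 'a form" where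
  "pullback f w = (\<lambda>x vs. w (f x) (map (frechet_derivative f (at x)) vs))"


section \<open>Riemannian metrics, codifferential, form Laplacian\<close>

text \<open>The coordinate vector fields are the constant orthonormal fields \<open>b \<in> Basis\<close>.\<close>

type_synonym 'a metric = "'a \<Rightarrow> 'a \<Rightarrow> 'a \<Rightarrow> real"

definition basis_lists :: "nat \<Rightarrow> 'a::euclidean_space list set" where
  "basis_lists k = {bs. set bs \<subseteq> Basis \<and> length bs = k}"

definition inverse_metric :: "'a::euclidean_space metric \<Rightarrow> 'a metric" where
  "inverse_metric g x = (THE h.
     (\<forall>a\<in>Basis. \<forall>b\<in>Basis. (\<Sum>c\<in>Basis. g x a c * h c b) = (if a = b then 1 else 0)) \<and>
     (\<forall>a b. a \<notin> Basis \<or> b \<notin> Basis \<longrightarrow> h a b = 0))"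

definition volume_density :: "'a::euclidean_space metric \<Rightarrow> 'a \<Rightarrow> real" where
  "volume_density g x =
     sqrt (\<Sum>s | s permutes Basis. of_int (sign s) * (\<Prod>b\<in>Basis. g x b (s b)))"

text \<open>The pointwise Hermitian product of \<open>k\<close>-forms: the components of \<open>v\<close> contracted with the
  conjugated components of \<open>w\<close> by \<open>k\<close> copies of the inverse metric, summed over all index
  tuples; the factor \<open>1/k!\<close> makes it the sum over increasing tuples.\<close>

definition form_inner ::
  "'a::euclidean_space metric \<Rightarrow> int \<Rightarrow> 'a form \<Rightarrow> 'a form \<Rightarrow> 'a \<Rightarrow> complex" where
  "form_inner g k v w x =
     (\<Sum>is\<in>basis_lists (nat k). \<Sum>js\<in>basis_lists (nat k).
        of_real (\<Prod>r<nat k. inverse_metric g x (is ! r) (js ! r)) * v x is * cnj (w x js))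
     / fact (nat k)"

definition L2_inner ::
  "'a::euclidean_space set \<Rightarrow> 'a metric \<Rightarrow> int \<Rightarrow> 'a form \<Rightarrow> 'a form \<Rightarrow> complex" where
  "L2_inner U g k v w =
     set_lebesgue_integral lborel U (\<lambda>x. volume_density g x *\<^sub>R form_inner g k v w x)"

text \<open>The codifferential on forms of degree \<open>k\<close> on \<open>U\<close>: the formal adjoint of the
  exterior differential.\<close>

definition codiff ::
  "'a::euclidean_space set \<Rightarrow> 'a metric \<Rightarrow> int \<Rightarrow> 'a form \<Rightarrow> 'a form" where
  "codiff U g k w = (THE u. u \<in> Omega U (k - 1) \<and>
     (\<forall>v\<in>Omega U (k - 1). compactly_supported U v \<longrightarrow>
        L2_inner U g k (ext_d U v) w = L2_inner U g (k - 1) v u))"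

definition form_laplacian ::
  "'a::euclidean_space set \<Rightarrow> 'a metric \<Rightarrow> int \<Rightarrow> 'a form \<Rightarrow> 'a form" where
  "form_laplacian U g k w = (\<lambda>x vs.
     ext_d U (codiff U g k w) x vs + codiff U g (k + 1) (ext_d U w) x vs)"

definition euclidean_metric :: "'a::euclidean_space metric" where
  "euclidean_metric x u v = u \<bullet> v"

text \<open>The upper half space in \<open>\<real>\<^sup>n \<times> \<real>\<close>; the last coordinate is \<open>snd\<close>.\<close>

definition half_space :: "('a::euclidean_space \<times> real) set" where
  "half_space = {z. snd z > 0}"

definition hyperbolic_metric :: "('a::euclidean_space \<times> real) metric" where
  "hyperbolic_metric z u v = (u \<bullet> v) / (snd z)\<^sup>2"


section \<open>Formal solutions of the eigenequation\<close>

text \<open>With \<open>t\<close> the last coordinate: the form \<open>t\<^sup>a (u + dt/t \<and> v)\<close> on the half space,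
  for forms \<open>u\<close>, \<open>v\<close> on the boundary \<open>\<real>\<^sup>n\<close>.\<close>

definition homogeneous_term ::
  "complex \<Rightarrow> 'a::euclidean_space form \<Rightarrow> 'a form \<Rightarrow> ('a \<times> real) form" where
  "homogeneous_term a u v = (\<lambda>z vs. if z \<in> half_space
     then of_real (snd z) powr a *
       (pullback fst u z vs
        + wedge1 (\<lambda>z v. of_real (snd v / snd z)) (pullback fst v) z vs)
     else 0)"

text \<open>\<open>t\<^sup>\<lambda> \<Sum>\<^sub>j t\<^sup>j (u\<^sub>j + dt/t \<and> v\<^sub>j)\<close> solves \<open>\<Delta> \<omega> = \<mu> \<omega>\<close> formally: applying \<open>\<Delta> - \<mu>\<close>
  to the \<open>j\<close>-th term gives a finite sum of terms
  \<open>t\<^bsup>\<lambda>+i\<^esup> (E\<^sub>j\<^sub>i + dt/t \<and> F\<^sub>j\<^sub>i)\<close> with \<open>i \<ge> j\<close>, and for every order \<open>i\<close> the contributions of all \<open>j\<close>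
  cancel.  (The \<open>E\<close>, \<open>F\<close> are determined by the equation, as powers of \<open>t\<close> are linearly
  independent.)\<close>

definition formal_eigenform ::
  "int \<Rightarrow> complex \<Rightarrow> complex \<Rightarrow> (nat \<Rightarrow> 'a::euclidean_space form) \<Rightarrow> (nat \<Rightarrow> 'a form) \<Rightarrow> bool"
where
  "formal_eigenform p lam mu u v \<longleftrightarrow>
     (\<exists>E F K.
        (\<forall>j i. E j i \<in> Omega UNIV p \<and> F j i \<in> Omega UNIV (p - 1)) \<and>
        (\<forall>j i. i \<notin> {j..K j} \<longrightarrow> (\<forall>y vs. E j i y vs = 0 \<and> F j i y vs = 0)) \<and>
        (\<forall>j. \<forall>z\<in>half_space. \<forall>vs.
           form_laplacian half_space hyperbolic_metric p
             (homogeneous_term (lam + of_nat j) (u j) (v j)) z vs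
           - mu * homogeneous_term (lam + of_nat j) (u j) (v j) z vs
           = (\<Sum>i\<in>{j..K j}. homogeneous_term (lam + of_nat i) (E j i) (F j i) z vs)) \<and>
        (\<forall>i y vs. (\<Sum>j\<le>i. E j i y vs) = 0 \<and> (\<Sum>j\<le>i. F j i y vs) = 0))"


section \<open>Natural differential operators and the solution operators\<close>

text \<open>Iterated directional derivative; the head of the list is applied last.\<close>

fun iter_deriv :: "'a::euclidean_space list \<Rightarrow> ('a \<Rightarrow> complex) \<Rightarrow> 'a \<Rightarrow> complex" where
  "iter_deriv [] f = f"
| "iter_deriv (b # bs) f = (\<lambda>x. frechet_derivative (iter_deriv bs f) (at x) b)"

definition differential_operator ::
  "int \<Rightarrow> int \<Rightarrow> ('a::euclidean_space form \<Rightarrow> 'a form) \<Rightarrow> bool" where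
  "differential_operator k l D \<longleftrightarrow>
     (\<forall>w\<in>Omega UNIV k. D w \<in> Omega UNIV l) \<and>
     (\<exists>r c. (\<forall>vs is bs. smooth_on UNIV (c vs is bs)) \<and>
        (\<forall>w\<in>Omega UNIV k. \<forall>y vs. D w y vs =
           (\<Sum>is\<in>basis_lists (nat k). \<Sum>m\<le>r. \<Sum>bs\<in>basis_lists m.
              c vs is bs y * iter_deriv bs (\<lambda>x. w x is) y)))"

text \<open>On the flat space \<open>\<real>\<^sup>n\<close>, natural means equivariant under all Euclidean isometries.\<close>

definition natural_operator ::
  "int \<Rightarrow> int \<Rightarrow> ('a::euclidean_space form \<Rightarrow> 'a form) \<Rightarrow> bool" where
  "natural_operator k l D \<longleftrightarrow> differential_operator k l D \<and>
     (\<forall>f. (\<forall>x y. dist (f x) (f y) = dist x y) \<longrightarrow>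
        (\<forall>w\<in>Omega UNIV k. D (pullback f w) = pullback f (D w)))"

text \<open>A family of natural operators with coefficients rational in the parameter: a fraction
  \<open>N(\<lambda>)/Q(\<lambda>)\<close> in lowest terms, whose numerator \<open>N(\<lambda>) = \<Sum>\<^sub>i \<lambda>\<^sup>i N\<^sub>i\<close> is a polynomial with natural
  operators as coefficients.  Lowest terms (\<open>N\<close> and \<open>Q\<close> have no common zero) makes the zeros
  of \<open>Q\<close> exactly the poles of the family.  Nothing is said about \<open>T lam\<close> at a pole.\<close>

definition rational_family ::
  "int \<Rightarrow> int \<Rightarrow> complex poly \<Rightarrow> (complex \<Rightarrow> 'a::euclidean_space form \<Rightarrow> 'a form) \<Rightarrow> bool"
where
  "rational_family k l Q T \<longleftrightarrow> Q \<noteq> 0 \<and>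
     (\<exists>m N. (\<forall>i\<le>m. natural_operator k l (N i)) \<and>
        (\<forall>lam. poly Q lam = 0 \<longrightarrow>
           (\<exists>w\<in>Omega UNIV k. \<exists>y vs. (\<Sum>i\<le>m. lam ^ i * N i w y vs) \<noteq> 0)) \<and>
        (\<forall>lam. poly Q lam \<noteq> 0 \<longrightarrow>
           (\<forall>w\<in>Omega UNIV k.
              T lam w = (\<lambda>y vs. (\<Sum>i\<le>m. lam ^ i * N i w y vs) / poly Q lam))))"

text \<open>\<open>Tp j\<close> and \<open>Tm j\<close> stand for the operators with lower index \<open>2j\<close>; the coefficients of odd
  order in the ansatz vanish.  The eigenequation is required wherever all the operators are
  regular, i.e. for all but countably many parameters.\<close>

definition solution_operators ::
  "nat \<Rightarrow> (nat \<Rightarrow> complex \<Rightarrow> (real^'n) form \<Rightarrow> (real^'n) form)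
       \<Rightarrow> (nat \<Rightarrow> complex \<Rightarrow> (real^'n) form \<Rightarrow> (real^'n) form) \<Rightarrow> bool" where
  "solution_operators p Tp Tm \<longleftrightarrow>
     (\<exists>Qp Qm.
        (\<forall>j. rational_family (int p) (int p) (Qp j) (Tp j)) \<and>
        (\<forall>j. rational_family (int p) (int p - 1) (Qm j) (Tm j)) \<and>
        (\<forall>lam. (\<forall>j. poly (Qp j) lam \<noteq> 0 \<and> poly (Qm j) lam \<noteq> 0) \<longrightarrow>
           (\<forall>\<phi>\<in>Omega UNIV (int p).
              Tp 0 lam \<phi> = \<phi> \<and>
              Tm 0 lam \<phi> = (\<lambda>y vs. 0) \<and>
              formal_eigenform (int p) lam (lam * (of_nat CARD('n) - 2 * of_nat p - lam))
                (\<lambda>i. if even i then Tp (i div 2) lam \<phi> else (\<lambda>y vs. 0))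
                (\<lambda>i. if even i then Tm (i div 2) lam \<phi> else (\<lambda>y vs. 0)))))"

abbreviation d_flat :: "(real^'n) form \<Rightarrow> (real^'n) form" where
  "d_flat \<equiv> ext_d UNIV"

abbreviation delta_flat :: "int \<Rightarrow> (real^'n) form \<Rightarrow> (real^'n) form" where
  "delta_flat k \<equiv> codiff UNIV euclidean_metric k"

end

theory Submission
  imports Defs
begin

text \<open>
  The statement has an analytic part, which turns the eigenequation into a recursion for forms
  on \<open>\<real>\<^sup>n\<close>, and an algebraic part, which solves the recursion and extends the solution from generic
  to all admissible parameters.

  The codifferential is given only as a formal adjoint, so it has to be computed first.  For a metric
  \<open>(u \<bullet> v) / s\<^sup>2\<close> the pointwise product of \<open>k\<close>-forms and the volume density are the flat ones times powers
  of \<open>s\<close>.  The adjoint of \<open>d\<close> is therefore the flat codifferential conjugated with such powers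
  (\<open>conformally_flat.codiff_eq\<close>): integration by parts shows that this operator is an adjoint, and
  testing with a bump function times a difference of two adjoints shows that there is no other.

  With \<open>N = n - 2p\<close> and \<open>\<Delta> = d\<delta> + \<delta>d\<close> on \<open>\<real>\<^sup>n\<close>, the hyperbolic Laplacian maps \<open>t\<^sup>a (u + dt/t \<and> v)\<close> to
  \<open>t\<^sup>a (a(N-a)u + 2dv + dt/t \<and> a(N+2-a)v)\<close> plus \<open>t\<^bsup>a+2\<^esup> (\<Delta>u + dt/t \<and> (2\<delta>u + \<Delta>v))\<close>
  (\<open>form_laplacian_homogeneous_term\<close>).  Powers of \<open>t\<close> are linearly independent, so the
  eigenequation for the even ansatz amounts to the recursion

  \<open>2j(N-2\<lambda>-2j) u\<^sub>j + \<Delta>u\<^bsub>j-1\<^esub> + 2dv\<^sub>j = 0\<close>,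

  \<open>(2j(N-2\<lambda>-2j) + 2(\<lambda>+2j)) v\<^sub>j + 2\<delta>u\<^bsub>j-1\<^esub> + \<Delta>v\<^bsub>j-1\<^esub> = 0\<close>

  (\<open>formal_eigenform_even_iff\<close>).  Since \<open>dd = 0\<close> and \<open>\<delta>\<delta> = 0\<close>, the Laplacian only raises the exponents
  of \<open>(d\<delta>)\<^sup>j\<close> and \<open>(\<delta>d)\<^sup>j\<close>.  If \<open>u\<^sub>j\<close> is a combination of \<open>(d\<delta>)\<^sup>j \<phi>\<close> and \<open>(\<delta>d)\<^sup>j \<phi>\<close>, and \<open>v\<^sub>j\<close> a multiple of
  \<open>\<delta>(d\<delta>)\<^bsup>j-1\<^esup> \<phi>\<close>, the recursion becomes a pair of scalar identities.  The closed formulas satisfy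
  them (\<open>solutions_solve_recursion\<close>), and where no leading coefficient vanishes the recursion has no other solution (\<open>recursion_unique\<close>).

  The leading coefficient of \<open>v\<^sub>j\<close> vanishes at parameters where the closed formula is still
  regular, and the families are subject to the equation only where all of them are regular.  So uniqueness is
  first obtained off a countable set.  There a family \<open>P(\<lambda>) / Q(\<lambda>)\<close> equals the closed formula
  \<open>G(\<lambda>) / q(\<lambda>)\<close>; the polynomial identity \<open>P q = G Q\<close> then holds for all \<open>\<lambda>\<close>, and a zero of \<open>Q\<close> outside the
  zeros of \<open>q\<close> would be a zero of \<open>P\<close>, against lowest terms (\<open>rational_family_regular\<close>).  For
  existence, the closed formulas are reduced to lowest terms (\<open>lowest_terms\<close>); at parameters that become regular
  by this reduction the recursion holds by continuity.
\<close>

section \<open>Calculus of smooth functions\<close>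

abbreviation pderiv_at :: "('a::euclidean_space \<Rightarrow> complex) \<Rightarrow> 'a \<Rightarrow> 'a \<Rightarrow> complex" ("\<partial>")
  where "\<partial> f x \<equiv> frechet_derivative f (at x)"

lemma pderiv_eqI: "(f has_derivative f') (at x) \<Longrightarrow> \<partial> f x = f'"
  using frechet_derivative_at by metis

lemma has_pderiv: "f differentiable (at x) \<Longrightarrow> (f has_derivative \<partial> f x) (at x)"
  using frechet_derivative_works by blast

text \<open>Formulas for derivatives on an open set hold only inside it, so regularity has to be insensitive
  to changes of a function outside the set.\<close>

lemma differentiable_upto_cong:
  assumes "open U" "\<And>x. x \<in> U \<Longrightarrow> f x = g x"
  shows "differentiable_upto k U f \<longleftrightarrow> differentiable_upto k U g"
  using assms(2)
proof (induction k arbitrary: f g)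
  case 0
  then show ?case by (auto cong: continuous_on_cong)
next
  case (Suc k)
  have d: "(f differentiable (at x)) \<longleftrightarrow> (g differentiable (at x))" if "x \<in> U" for x
    unfolding differentiable_def
    using has_derivative_transform_within_open[OF _ assms(1) that] Suc.prems by metis
  have "\<partial> f x = \<partial> g x" if "x \<in> U" "f differentiable (at x)" for x
    using frechet_derivative_transform_within_open[OF that(2) assms(1) that(1)] Suc.prems by metis
  then have "differentiable_upto k U (\<lambda>x. \<partial> f x v) \<longleftrightarrow> differentiable_upto k U (\<lambda>x. \<partial> g x v)"
    if "\<forall>x\<in>U. f differentiable (at x)" for v
    by (intro Suc.IH) (use that in auto)
  then show ?case using d by auto
qed

lemma smooth_on_cong:
  assumes "open U" "\<And>x. x \<in> U \<Longrightarrow> f x = g x"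
  shows "smooth_on U f \<longleftrightarrow> smooth_on U g"
  unfolding smooth_on_def using differentiable_upto_cong[OF assms] by auto

lemma pderiv_cong:
  assumes "open U" "x \<in> U" "\<And>x. x \<in> U \<Longrightarrow> f x = g x"
  shows "\<partial> f x = \<partial> g x"
proof (cases "f differentiable (at x)")
  case True
  then show ?thesis using frechet_derivative_transform_within_open[OF _ assms(1,2)] assms(3) by metis
next
  case False
  have "(f has_derivative D) (at x) \<longleftrightarrow> (g has_derivative D) (at x)" for D
    using has_derivative_transform_within_open[OF _ assms(1,2)] assms(3) by metis
  then show ?thesis unfolding frechet_derivative_def by simp
qed

lemma differentiable_upto_SucD: "differentiable_upto (Suc k) U f \<Longrightarrow> differentiable_upto k U f"
proof (induction k arbitrary: f)
  case 0
  then show ?case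
    by (simp add: continuous_at_imp_continuous_on differentiable_imp_continuous_within)
next
  case (Suc k)
  show ?case
    unfolding differentiable_upto.simps(2)[of k]
  proof (intro conjI allI)
    show "\<forall>x\<in>U. f differentiable at x" using Suc.prems by simp
    fix v
    have "differentiable_upto (Suc k) U (\<lambda>x. \<partial> f x v)" using Suc.prems by simp
    then show "differentiable_upto k U (\<lambda>x. \<partial> f x v)" by (rule Suc.IH)
  qed
qed

lemma smooth_onD_differentiable: "smooth_on U f \<Longrightarrow> x \<in> U \<Longrightarrow> f differentiable (at x)"
  unfolding smooth_on_def using differentiable_upto.simps(2) by blast

lemma smooth_on_imp_continuous_on: "smooth_on U f \<Longrightarrow> continuous_on U f"
  unfolding smooth_on_def using differentiable_upto.simps(1) by blast

lemma smooth_on_pderiv: "smooth_on U f \<Longrightarrow> smooth_on U (\<lambda>x. \<partial> f x v)"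
  unfolding smooth_on_def using differentiable_upto.simps(2) by blast

lemma differentiable_upto_const: "differentiable_upto k U (\<lambda>x. c)"
proof (induction k arbitrary: c)
  case (Suc k)
  then show ?case by simp
qed simp

lemma smooth_on_const [simp]: "smooth_on U (\<lambda>x. c)"
  unfolding smooth_on_def using differentiable_upto_const by blast

lemma differentiable_upto_add:
  assumes "open U" "differentiable_upto k U f" "differentiable_upto k U g"
  shows "differentiable_upto k U (\<lambda>x. f x + g x)"
  using assms(2,3)
proof (induction k arbitrary: f g)
  case 0
  then show ?case by (simp add: continuous_on_add)
next
  case (Suc k)
  have "\<partial> (\<lambda>x. f x + g x) x = (\<lambda>v. \<partial> f x v + \<partial> g x v)" if "x \<in> U" for x
    using Suc.prems that by (intro pderiv_eqI has_derivative_add has_pderiv) auto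
  then have "differentiable_upto k U (\<lambda>x. \<partial> (\<lambda>x. f x + g x) x v) \<longleftrightarrow>
      differentiable_upto k U (\<lambda>x. \<partial> f x v + \<partial> g x v)" for v
    by (intro differentiable_upto_cong[OF assms(1)]) auto
  then show ?case using Suc by auto
qed

lemma differentiable_upto_mult:
  assumes "open U" "differentiable_upto k U f" "differentiable_upto k U g"
  shows "differentiable_upto k U (\<lambda>x. f x * g x)"
  using assms(2,3)
proof (induction k arbitrary: f g)
  case 0
  then show ?case by (simp add: continuous_on_mult)
next
  case (Suc k)
  have "\<partial> (\<lambda>x. f x * g x) x = (\<lambda>v. f x * \<partial> g x v + \<partial> f x v * g x)" if "x \<in> U" for x
    using Suc.prems that by (intro pderiv_eqI has_derivative_mult has_pderiv) auto
  then have "differentiable_upto k U (\<lambda>x. \<partial> (\<lambda>x. f x * g x) x v) \<longleftrightarrow>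
      differentiable_upto k U (\<lambda>x. f x * \<partial> g x v + \<partial> f x v * g x)" for v
    by (intro differentiable_upto_cong[OF assms(1)]) auto
  moreover have "differentiable_upto k U (\<lambda>x. f x * \<partial> g x v + \<partial> f x v * g x)" for v
    using Suc.prems differentiable_upto_SucD[OF Suc.prems(1)] differentiable_upto_SucD[OF Suc.prems(2)]
    by (intro differentiable_upto_add[OF assms(1)] Suc.IH) auto
  ultimately show ?case using Suc.prems by auto
qed

lemma smooth_on_add:
  "open U \<Longrightarrow> smooth_on U f \<Longrightarrow> smooth_on U g \<Longrightarrow> smooth_on U (\<lambda>x. f x + g x)"
  unfolding smooth_on_def using differentiable_upto_add by blast

lemma smooth_on_mult:
  "open U \<Longrightarrow> smooth_on U f \<Longrightarrow> smooth_on U g \<Longrightarrow> smooth_on U (\<lambda>x. f x * g x)"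
  unfolding smooth_on_def using differentiable_upto_mult by blast

lemma smooth_on_sum:
  "open U \<Longrightarrow> (\<And>i. i \<in> I \<Longrightarrow> smooth_on U (f i)) \<Longrightarrow> smooth_on U (\<lambda>x. \<Sum>i\<in>I. f i x)"
  by (induction I rule: infinite_finite_induct) (auto intro: smooth_on_add)

lemma smooth_on_uminus: "open U \<Longrightarrow> smooth_on U f \<Longrightarrow> smooth_on U (\<lambda>x. - f x)"
  using smooth_on_mult[of U "\<lambda>x. -1" f] by simp

lemma smooth_on_diff:
  "open U \<Longrightarrow> smooth_on U f \<Longrightarrow> smooth_on U g \<Longrightarrow> smooth_on U (\<lambda>x. f x - g x)"
  using smooth_on_add[of U f "\<lambda>x. - g x"] smooth_on_uminus by auto

lemma smooth_on_bounded_linear: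
  assumes "bounded_linear L"
  shows "smooth_on U L"
proof -
  have "\<partial> L x = L" for x
    using assms by (intro pderiv_eqI bounded_linear_imp_has_derivative)
  moreover have "L differentiable (at x)" for x
    using assms bounded_linear_imp_differentiable by blast
  ultimately have "differentiable_upto (Suc k) U L" for k
    by (simp add: differentiable_upto_const)
  then show ?thesis unfolding smooth_on_def using differentiable_upto_SucD by blast
qed

lemma smooth_on_cnj:
  assumes U: "open U" and f: "smooth_on U f"
  shows "smooth_on U (\<lambda>x. cnj (f x))"
proof -
  have "differentiable_upto k U (\<lambda>x. cnj (f x))" if "differentiable_upto k U f" for k f
    using that
  proof (induction k arbitrary: f)
    case 0
    then show ?case by (simp add: continuous_on_cnj)
  next
    case (Suc k)
    have d: "((\<lambda>x. cnj (f x)) has_derivative (\<lambda>v. cnj (\<partial> f x v))) (at x)" if "x \<in> U" for x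
      using Suc.prems that by (intro bounded_linear.has_derivative[OF bounded_linear_cnj] has_pderiv) auto
    then have "differentiable_upto k U (\<lambda>x. \<partial> (\<lambda>x. cnj (f x)) x v) \<longleftrightarrow>
        differentiable_upto k U (\<lambda>x. cnj (\<partial> f x v))" for v
      by (intro differentiable_upto_cong[OF U]) (use pderiv_eqI[OF d] in auto)
    then show ?case using Suc differentiableI[OF d] by auto
  qed
  then show ?thesis using f unfolding smooth_on_def by blast
qed

text \<open>Two kinds of affine maps occur: the projection of the half space to its boundary, and
  Euclidean isometries.\<close>

lemma smooth_on_compose_affine:
  fixes A :: "'b::euclidean_space \<Rightarrow> 'a::euclidean_space"
  assumes V: "open V" and A: "linear A" and g: "smooth_on U g" and VU: "\<And>x. x \<in> V \<Longrightarrow> A x + c \<in> U"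
  shows "smooth_on V (\<lambda>x. g (A x + c))"
    and "x \<in> V \<Longrightarrow> \<partial> (\<lambda>x. g (A x + c)) x v = \<partial> g (A x + c) (A v)"
proof -
  have dA: "((\<lambda>x. A x + c) has_derivative A) (at x)" for x
    using linear_imp_has_derivative[OF A] has_derivative_add_const by blast
  have dg: "((\<lambda>x. g (A x + c)) has_derivative (\<lambda>v. \<partial> g (A x + c) (A v))) (at x)"
    if "g differentiable at (A x + c)" for g x
    using diff_chain_at[OF dA has_pderiv[OF that]] by (simp add: o_def)
  have "differentiable_upto k V (\<lambda>x. g (A x + c))" if "differentiable_upto k U g" for k g
    using that
  proof (induction k arbitrary: g)
    case 0
    have "continuous_on V (\<lambda>x. A x + c)"
      using A by (intro continuous_intros linear_continuous_on) (simp add: linear_conv_bounded_linear)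
    moreover have "(\<lambda>x. A x + c) ` V \<subseteq> U" using VU by auto
    ultimately show ?case using 0 continuous_on_compose2[of U g V "\<lambda>x. A x + c"] by simp
  next
    case (Suc k)
    have d: "((\<lambda>x. g (A x + c)) has_derivative (\<lambda>v. \<partial> g (A x + c) (A v))) (at x)" if "x \<in> V" for x
      using Suc.prems VU that by (intro dg) auto
    then have "differentiable_upto k V (\<lambda>x. \<partial> (\<lambda>x. g (A x + c)) x v) \<longleftrightarrow>
        differentiable_upto k V (\<lambda>x. \<partial> g (A x + c) (A v))" for v
      by (intro differentiable_upto_cong[OF V]) (use pderiv_eqI[OF d] in auto)
    moreover have "differentiable_upto k V (\<lambda>x. \<partial> g (A x + c) (A v))" for v
      using Suc.IH[of "\<lambda>x. \<partial> g x (A v)"] Suc.prems by simp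
    ultimately show ?case using differentiableI[OF d] by auto
  qed
  then show "smooth_on V (\<lambda>x. g (A x + c))" using g unfolding smooth_on_def by blast
  show "x \<in> V \<Longrightarrow> \<partial> (\<lambda>x. g (A x + c)) x v = \<partial> g (A x + c) (A v)"
    using pderiv_eqI[OF dg[OF smooth_onD_differentiable[OF g VU]]] by simp
qed

lemma pderiv_add:
  "f differentiable at x \<Longrightarrow> g differentiable at x \<Longrightarrow>
    \<partial> (\<lambda>x. f x + g x) x v = \<partial> f x v + \<partial> g x v"
  by (subst pderiv_eqI[OF has_derivative_add[OF has_pderiv has_pderiv]]) auto

lemma pderiv_mult:
  "f differentiable at x \<Longrightarrow> g differentiable at x \<Longrightarrow>
    \<partial> (\<lambda>x. f x * g x) x v = f x * \<partial> g x v + \<partial> f x v * g x"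
  by (subst pderiv_eqI[OF has_derivative_mult[OF has_pderiv has_pderiv]]) auto

lemma pderiv_cmult:
  "f differentiable at x \<Longrightarrow> \<partial> (\<lambda>x. c * f x) x v = c * \<partial> f x v"
  by (subst pderiv_eqI[OF has_derivative_mult_right[OF has_pderiv]]) auto

lemma pderiv_uminus:
  "f differentiable at x \<Longrightarrow> \<partial> (\<lambda>x. - f x) x v = - \<partial> f x v"
  by (subst pderiv_eqI[OF has_derivative_minus[OF has_pderiv]]) auto

lemma pderiv_sum:
  "(\<And>i. i \<in> I \<Longrightarrow> f i differentiable at x) \<Longrightarrow>
    \<partial> (\<lambda>x. \<Sum>i\<in>I. f i x) x v = (\<Sum>i\<in>I. \<partial> (f i) x v)"
  by (subst pderiv_eqI[OF has_derivative_sum[OF has_pderiv]]) auto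

lemma pderiv_linear: "f differentiable at x \<Longrightarrow> linear (\<partial> f x)"
  using linear_frechet_derivative .

lemma pderiv_basis_expansion:
  assumes "f differentiable at x"
  shows "\<partial> f x v = (\<Sum>b\<in>Basis. of_real (v \<bullet> b) * \<partial> f x b)"
proof -
  have "\<partial> f x v = \<partial> f x (\<Sum>b\<in>Basis. (v \<bullet> b) *\<^sub>R b)" by (simp add: euclidean_representation)
  then show ?thesis
    using pderiv_linear[OF assms] by (simp add: linear_sum linear_scale scaleR_conv_of_real)
qed

subsection \<open>Symmetry of second derivatives\<close>

text \<open>The mean value theorem needs real values, hence the functional \<open>L\<close>, which is later the real or
  the imaginary part.  The left-hand side is symmetric in \<open>u\<close> and \<open>v\<close>, which forces the mixed derivatives to
  agree in the limit \<open>s \<rightarrow> 0\<close>.\<close>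

lemma second_difference_mean_value:
  fixes f :: "'a::euclidean_space \<Rightarrow> complex"
  assumes f: "smooth_on UNIV f" and s: "0 < s" and L: "bounded_linear (L :: complex \<Rightarrow> real)"
  obtains \<xi> \<eta> where "0 < \<xi>" "\<xi> < s" "0 < \<eta>" "\<eta> < s"
    "L (f (x + s *\<^sub>R u + s *\<^sub>R v)) - L (f (x + s *\<^sub>R u)) - L (f (x + s *\<^sub>R v)) + L (f x)
      = s * s * L (\<partial> (\<lambda>y. \<partial> f y u) (x + \<xi> *\<^sub>R u + \<eta> *\<^sub>R v) v)"
proof -
  have line: "((\<lambda>r. L (g (a + r *\<^sub>R w))) has_real_derivative L (\<partial> g (a + r *\<^sub>R w) w)) (at r)"
    if "smooth_on UNIV g" for g :: "'a \<Rightarrow> complex" and a w r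
  proof -
    have 1: "((\<lambda>r. a + r *\<^sub>R w) has_derivative (\<lambda>h. h *\<^sub>R w)) (at r)"
      by (auto intro!: derivative_eq_intros)
    have 2: "(g has_derivative \<partial> g (a + r *\<^sub>R w)) (at (a + r *\<^sub>R w))"
      using smooth_onD_differentiable[OF that] by (intro has_pderiv) auto
    have "((\<lambda>r. L (g (a + r *\<^sub>R w))) has_derivative (\<lambda>h. L (\<partial> g (a + r *\<^sub>R w) (h *\<^sub>R w)))) (at r)"
      using bounded_linear.has_derivative[OF L diff_chain_at[OF 1 2]] by (simp add: o_def)
    moreover have "L (\<partial> g (a + r *\<^sub>R w) (h *\<^sub>R w)) = L (\<partial> g (a + r *\<^sub>R w) w) * h" for h
      using has_derivative_linear[OF 2] bounded_linear.linear[OF L] by (simp add: linear_scale)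
    ultimately show ?thesis unfolding has_field_derivative_def by simp
  qed
  \<comment> \<open>Apply the mean value theorem first to the increment in direction \<open>v\<close>, then to its derivative.\<close>
  define F where "F r = L (f ((x + s *\<^sub>R v) + r *\<^sub>R u)) - L (f (x + r *\<^sub>R u))" for r
  have dF: "(F has_real_derivative
      L (\<partial> f ((x + s *\<^sub>R v) + r *\<^sub>R u) u) - L (\<partial> f (x + r *\<^sub>R u) u)) (at r)" for r
    unfolding F_def[abs_def] by (intro DERIV_diff line f)
  obtain \<xi> where \<xi>: "0 < \<xi>" "\<xi> < s"
    "F s - F 0 = (s - 0) * (L (\<partial> f ((x + s *\<^sub>R v) + \<xi> *\<^sub>R u) u) - L (\<partial> f (x + \<xi> *\<^sub>R u) u))"
    using MVT2[OF s dF] by blast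
  define G where "G r = L (\<partial> f ((x + \<xi> *\<^sub>R u) + r *\<^sub>R v) u)" for r
  have dG: "(G has_real_derivative L (\<partial> (\<lambda>y. \<partial> f y u) ((x + \<xi> *\<^sub>R u) + r *\<^sub>R v) v)) (at r)" for r
    unfolding G_def[abs_def] by (rule line[OF smooth_on_pderiv[OF f]])
  obtain \<eta> where \<eta>: "0 < \<eta>" "\<eta> < s"
    "G s - G 0 = (s - 0) * L (\<partial> (\<lambda>y. \<partial> f y u) ((x + \<xi> *\<^sub>R u) + \<eta> *\<^sub>R v) v)"
    using MVT2[OF s dG] by blast
  have "F s - F 0 = s * (G s - G 0)"
    using \<xi>(3) by (simp add: G_def algebra_simps)
  then have "F s - F 0 = s * s * L (\<partial> (\<lambda>y. \<partial> f y u) (x + \<xi> *\<^sub>R u + \<eta> *\<^sub>R v) v)"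
    using \<eta>(3) by simp
  then show thesis
    using that[OF \<xi>(1,2) \<eta>(1,2)] by (simp add: F_def algebra_simps)
qed

lemma pderiv_commute_functional:
  fixes f :: "'a::euclidean_space \<Rightarrow> complex"
  assumes f: "smooth_on UNIV f" and L: "bounded_linear (L :: complex \<Rightarrow> real)"
  shows "L (\<partial> (\<lambda>y. \<partial> f y u) x v) = L (\<partial> (\<lambda>y. \<partial> f y v) x u)"
proof (rule ccontr)
  assume ne: "L (\<partial> (\<lambda>y. \<partial> f y u) x v) \<noteq> L (\<partial> (\<lambda>y. \<partial> f y v) x u)"
  define P where "P y = L (\<partial> (\<lambda>y. \<partial> f y u) y v)" for y
  define Q where "Q y = L (\<partial> (\<lambda>y. \<partial> f y v) y u)" for y
  define e where "e = \<bar>P x - Q x\<bar> / 2"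
  have e: "e > 0" using ne unfolding e_def P_def Q_def by simp
  have "continuous_on UNIV P" "continuous_on UNIV Q"
    unfolding P_def[abs_def] Q_def[abs_def]
    by (intro linear_continuous_on_compose[OF _ bounded_linear.linear[OF L]] smooth_on_imp_continuous_on
        smooth_on_pderiv f)+
  then have "isCont P x" "isCont Q x" by (simp_all add: continuous_on_eq_continuous_at)
  then obtain d1 d2 where d1: "d1 > 0" "\<And>y. dist y x < d1 \<Longrightarrow> dist (P y) (P x) < e"
    and d2: "d2 > 0" "\<And>y. dist y x < d2 \<Longrightarrow> dist (Q y) (Q x) < e"
    unfolding continuous_at_eps_delta using e by metis
  \<comment> \<open>Small enough for all points of the parallelogram to stay close to \<open>x\<close>.\<close>
  define s where "s = min d1 d2 / (norm u + norm v + 1)"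
  have np: "0 < norm u + norm v + 1" by (simp add: add_nonneg_pos)
  then have s: "s > 0" using d1 d2 unfolding s_def by simp
  have near: "dist (x + a *\<^sub>R u + b *\<^sub>R v) x < min d1 d2" if "0 < a" "a < s" "0 < b" "b < s" for a b
  proof -
    have "dist (x + a *\<^sub>R u + b *\<^sub>R v) x \<le> a * norm u + b * norm v"
      using norm_triangle_ineq[of "a *\<^sub>R u" "b *\<^sub>R v"] that by (simp add: dist_norm)
    also have "\<dots> \<le> s * norm u + s * norm v"
      using that by (intro add_mono mult_right_mono) auto
    also have "\<dots> < s * (norm u + norm v + 1)" using s by (simp add: algebra_simps)
    also have "\<dots> = min d1 d2" using np unfolding s_def by simp
    finally show ?thesis .
  qed
  obtain a b where ab: "0 < a" "a < s" "0 < b" "b < s"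
    "L (f (x + s *\<^sub>R u + s *\<^sub>R v)) - L (f (x + s *\<^sub>R u)) - L (f (x + s *\<^sub>R v)) + L (f x)
      = s * s * P (x + a *\<^sub>R u + b *\<^sub>R v)"
    using second_difference_mean_value[OF f s L, of x u v] unfolding P_def by metis
  obtain a' b' where ab': "0 < a'" "a' < s" "0 < b'" "b' < s"
    "L (f (x + s *\<^sub>R v + s *\<^sub>R u)) - L (f (x + s *\<^sub>R v)) - L (f (x + s *\<^sub>R u)) + L (f x)
      = s * s * Q (x + a' *\<^sub>R v + b' *\<^sub>R u)"
    using second_difference_mean_value[OF f s L, of x v u] unfolding Q_def by metis
  have "s * s * P (x + a *\<^sub>R u + b *\<^sub>R v) = s * s * Q (x + b' *\<^sub>R u + a' *\<^sub>R v)"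
  proof -
    have 1: "x + s *\<^sub>R u + s *\<^sub>R v = x + s *\<^sub>R v + s *\<^sub>R u" by simp
    have 2: "x + a' *\<^sub>R v + b' *\<^sub>R u = x + b' *\<^sub>R u + a' *\<^sub>R v" by simp
    show ?thesis using ab(5) ab'(5) unfolding 1 2 by linarith
  qed
  then have "P (x + a *\<^sub>R u + b *\<^sub>R v) = Q (x + b' *\<^sub>R u + a' *\<^sub>R v)" using s by simp
  moreover have "dist (P (x + a *\<^sub>R u + b *\<^sub>R v)) (P x) < e" using near[of a b] ab d1 by simp
  moreover have "dist (Q (x + b' *\<^sub>R u + a' *\<^sub>R v)) (Q x) < e" using near[of b' a'] ab' d2 by simp
  ultimately show False unfolding e_def dist_real_def by (simp add: abs_if split: if_splits)
qed

lemma pderiv_commute: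
  fixes f :: "'a::euclidean_space \<Rightarrow> complex"
  assumes f: "smooth_on UNIV f"
  shows "\<partial> (\<lambda>y. \<partial> f y u) x v = \<partial> (\<lambda>y. \<partial> f y v) x u"
  using pderiv_commute_functional[OF f bounded_linear_Re] pderiv_commute_functional[OF f bounded_linear_Im]
  by (simp add: complex_eq_iff)

section \<open>Alternating multilinear functions of a list of vectors\<close>

lemma alternatingD_linear:
  assumes "alternating_multilinear w"
  shows "linear (\<lambda>v. w (xs @ v # ys))"
proof -
  have "linear (\<lambda>v. w ((xs @ 0 # ys)[length xs := v]))"
    using assms unfolding alternating_multilinear_def by (metis add_Suc_right length_Cons length_append less_add_Suc1)
  then show ?thesis by simp
qed

lemma alternatingD_add:
  "alternating_multilinear w \<Longrightarrow> w (xs @ (u + v) # ys) = w (xs @ u # ys) + w (xs @ v # ys)"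
  using linear_add[OF alternatingD_linear] .

lemma alternatingD_scale:
  "alternating_multilinear w \<Longrightarrow> w (xs @ (c *\<^sub>R v) # ys) = of_real c * w (xs @ v # ys)"
  using linear_scale[OF alternatingD_linear] by (metis scaleR_conv_of_real)

lemma alternatingD_zero: "alternating_multilinear w \<Longrightarrow> w (xs @ 0 # ys) = 0"
  using linear_0[OF alternatingD_linear] .

lemma alternatingD_distinct: "alternating_multilinear w \<Longrightarrow> \<not> distinct vs \<Longrightarrow> w vs = 0"
  unfolding alternating_multilinear_def by blast

lemma alternating_multilinearI:
  assumes "\<And>xs ys. linear (\<lambda>v. w (xs @ v # ys))" "\<And>vs. \<not> distinct vs \<Longrightarrow> w vs = 0"
  shows "alternating_multilinear w"
  unfolding alternating_multilinear_def
proof (intro conjI allI impI)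
  fix vs :: "'a list" and i assume "i < length vs"
  then have "vs[i := v] = take i vs @ v # drop (Suc i) vs" for v by (simp add: upd_conv_take_nth_drop)
  then show "linear (\<lambda>v. w (vs[i := v]))" using assms(1) by simp
qed (use assms in auto)

lemma alternating_swap:
  assumes "alternating_multilinear w"
  shows "w (xs @ a # b # ys) = - w (xs @ b # a # ys)"
proof -
  note add1 = alternatingD_add[OF assms] and z = alternatingD_distinct[OF assms]
  have add2: "w (xs @ c # (a + b) # ys) = w (xs @ c # a # ys) + w (xs @ c # b # ys)" for c
    using add1[of "xs @ [c]"] by simp
  have "0 = w (xs @ (a + b) # (a + b) # ys)" by (rule z[symmetric]) simp
  also have "\<dots> = w (xs @ a # a # ys) + w (xs @ a # b # ys) + (w (xs @ b # a # ys) + w (xs @ b # b # ys))"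
    by (simp only: add1 add2)
  also have "w (xs @ a # a # ys) = 0" by (rule z) simp
  also have "w (xs @ b # b # ys) = 0" by (rule z) simp
  finally show ?thesis by (simp add: add_eq_0_iff)
qed

lemma alternating_move_to_front:
  assumes "alternating_multilinear w"
  shows "w (xs @ a # ys) = (-1) ^ length xs * w (a # xs @ ys)"
proof (induction xs arbitrary: ys rule: rev_induct)
  case (snoc x xs)
  have "w ((xs @ [x]) @ a # ys) = - w (xs @ a # x # ys)"
    using alternating_swap[OF assms, of xs x a ys] by simp
  then show ?case using snoc[of "x # ys"] by simp
qed simp

lemma remove_nth_0 [simp]: "remove_nth 0 (v # vs) = vs"
  and remove_nth_Suc [simp]: "remove_nth (Suc i) (v # vs) = v # remove_nth i vs"
  and remove_nth_append [simp]: "remove_nth (length xs) (xs @ v # ys) = xs @ ys"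
  unfolding remove_nth_def by simp_all

lemma remove_nth_map: "remove_nth i (map f vs) = map f (remove_nth i vs)"
  unfolding remove_nth_def by (simp add: take_map drop_map)

lemma length_remove_nth [simp]: "i < length vs \<Longrightarrow> length (remove_nth i vs) = length vs - 1"
  unfolding remove_nth_def by simp

lemma alternating_nth_to_front:
  assumes "alternating_multilinear w" "i < length vs"
  shows "w vs = (-1) ^ i * w (vs ! i # remove_nth i vs)"
  using alternating_move_to_front[OF assms(1), of "take i vs" "vs ! i" "drop (Suc i) vs"] assms(2)
  unfolding remove_nth_def by (simp flip: id_take_nth_drop)

lemma alternating_zero [simp]: "alternating_multilinear (\<lambda>vs. 0)"
  by (intro alternating_multilinearI) (auto intro: linearI)

lemma alternating_add:
  "alternating_multilinear w \<Longrightarrow> alternating_multilinear w' \<Longrightarrow> alternating_multilinear (\<lambda>vs. w vs + w' vs)"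
  by (rule alternating_multilinearI, rule linearI)
     (auto simp: alternatingD_distinct alternatingD_add alternatingD_scale scaleR_conv_of_real algebra_simps)

lemma alternating_cmult:
  assumes "alternating_multilinear w"
  shows "alternating_multilinear (\<lambda>vs. c * w vs)"
proof (intro alternating_multilinearI)
  show "linear (\<lambda>v. c * w (xs @ v # ys))" for xs ys
    by (rule linearI)
      (simp_all add: alternatingD_add[OF assms] alternatingD_scale[OF assms] scaleR_conv_of_real algebra_simps)
qed (auto simp: alternatingD_distinct[OF assms])

lemma alternating_sum:
  "(\<And>i. i \<in> I \<Longrightarrow> alternating_multilinear (w i)) \<Longrightarrow> alternating_multilinear (\<lambda>vs. \<Sum>i\<in>I. w i vs)"
  by (induction I rule: infinite_finite_induct) (auto intro: alternating_add)

lemma alternating_Cons: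
  assumes "alternating_multilinear w"
  shows "alternating_multilinear (\<lambda>vs. w (a # vs))"
  using alternatingD_linear[OF assms, of "a # _"] alternatingD_distinct[OF assms]
  by (intro alternating_multilinearI) auto

lemma alternating_map:
  assumes "alternating_multilinear w" "linear A"
  shows "alternating_multilinear (\<lambda>vs. w (map A vs))"
proof (intro alternating_multilinearI)
  show "linear (\<lambda>v. w (map A (xs @ v # ys)))" for xs ys
    using linear_compose[OF assms(2) alternatingD_linear[OF assms(1), of "map A xs" "map A ys"]]
    by (simp add: o_def)
qed (auto simp: distinct_map intro: alternatingD_distinct[OF assms(1)])

subsection \<open>Expansion in a basis\<close>

text \<open>The coefficient of \<open>w bs\<close> in the expansion of \<open>w vs\<close>, for \<open>w\<close> multilinear.\<close>

fun basis_coeff :: "'a::euclidean_space list \<Rightarrow> 'a list \<Rightarrow> real" where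
  "basis_coeff (v # vs) (b # bs) = (v \<bullet> b) * basis_coeff vs bs"
| "basis_coeff _ _ = 1"

lemma basis_lists_0 [simp]: "basis_lists 0 = {[]}"
  unfolding basis_lists_def by auto

lemma basis_lists_Suc: "basis_lists (Suc k) = (\<lambda>(b, bs). b # bs) ` (Basis \<times> basis_lists k)"
  unfolding basis_lists_def by (auto simp: length_Suc_conv image_iff)

lemma finite_basis_lists [simp]: "finite (basis_lists k)"
  by (induction k) (auto simp: basis_lists_Suc)

lemma sum_basis_lists_Suc:
  "(\<Sum>bs\<in>basis_lists (Suc k). f bs) = (\<Sum>b\<in>Basis. \<Sum>bs\<in>basis_lists k. f (b # bs))"
  unfolding basis_lists_Suc
  by (subst sum.reindex) (auto simp: inj_on_def sum.cartesian_product case_prod_beta)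

lemma alternating_basis_expansion_append:
  assumes "alternating_multilinear w"
  shows "w (us @ vs) = (\<Sum>bs\<in>basis_lists (length vs). of_real (basis_coeff vs bs) * w (us @ bs))"
proof (induction vs arbitrary: us)
  case (Cons v vs)
  have "w (us @ v # vs) = w (us @ (\<Sum>b\<in>Basis. (v \<bullet> b) *\<^sub>R b) # vs)"
    by (simp add: euclidean_representation)
  also have "\<dots> = (\<Sum>b\<in>Basis. of_real (v \<bullet> b) * w (us @ b # vs))"
    using linear_sum[OF alternatingD_linear[OF assms], of us "\<lambda>b. (v \<bullet> b) *\<^sub>R b" Basis vs]
    by (simp add: alternatingD_scale[OF assms])
  also have "\<dots> = (\<Sum>b\<in>Basis. of_real (v \<bullet> b) *
      (\<Sum>bs\<in>basis_lists (length vs). of_real (basis_coeff vs bs) * w (us @ b # bs)))"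
    using Cons[of "us @ [b]" for b] by simp
  finally show ?case
    by (simp add: sum_basis_lists_Suc sum_distrib_left mult.assoc)
qed simp

lemma alternating_basis_expansion:
  "alternating_multilinear w \<Longrightarrow>
    w vs = (\<Sum>bs\<in>basis_lists (length vs). of_real (basis_coeff vs bs) * w bs)"
  using alternating_basis_expansion_append[of w "[]" vs] by simp

lemma alternating_eqI_Basis:
  assumes "alternating_multilinear w" "alternating_multilinear w'"
    and "\<And>bs. bs \<in> basis_lists (length vs) \<Longrightarrow> w bs = w' bs"
  shows "w vs = w' vs"
  unfolding alternating_basis_expansion[OF assms(1), of vs] alternating_basis_expansion[OF assms(2), of vs]
  by (intro sum.cong) (simp_all add: assms(3))

subsection \<open>Antisymmetrisation over one slot\<close>

text \<open>The common pattern of the exterior differential (\<open>B a us\<close> is the derivative of \<open>w us\<close> in direction \<open>a\<close>)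
  and of the wedge product with a one-form.\<close>

definition alternate :: "('a \<Rightarrow> 'a list \<Rightarrow> complex) \<Rightarrow> 'a list \<Rightarrow> complex" where
  "alternate B vs = (\<Sum>i<length vs. (-1) ^ i * B (vs ! i) (remove_nth i vs))"

lemma alternate_Nil [simp]: "alternate B [] = 0"
  unfolding alternate_def by simp

lemma alternate_Cons: "alternate B (v # vs) = B v vs - alternate (\<lambda>a us. B a (v # us)) vs"
  unfolding alternate_def by (simp add: sum.lessThan_Suc_shift sum_negf del: sum.lessThan_Suc)

lemma alternate_add: "alternate (\<lambda>a us. B a us + C a us) vs = alternate B vs + alternate C vs"
  unfolding alternate_def by (simp add: sum.distrib algebra_simps)

lemma alternate_cmult: "alternate (\<lambda>a us. c * B a us) vs = c * alternate B vs"
  unfolding alternate_def by (simp add: sum_distrib_left algebra_simps)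

lemma alternate_diff: "alternate (\<lambda>a us. B a us - C a us) vs = alternate B vs - alternate C vs"
  unfolding alternate_def by (simp add: sum_subtractf algebra_simps)

lemma alternate_map: "alternate B (map f vs) = alternate (\<lambda>a us. B (f a) (map f us)) vs"
  unfolding alternate_def by (auto simp: remove_nth_map intro!: sum.cong)

lemma alternate_zero: "(\<And>a us. length us = length vs - 1 \<Longrightarrow> B a us = 0) \<Longrightarrow> alternate B vs = 0"
  unfolding alternate_def by (auto intro!: sum.neutral)

lemma alternate_linear:
  assumes B: "\<And>us. linear (\<lambda>a. B a us)" and alt: "\<And>a. alternating_multilinear (B a)"
  shows "linear (\<lambda>v. alternate B (xs @ v # ys))"
  using assms
proof (induction xs arbitrary: B)
  case Nil
  have "linear (\<lambda>v. alternate (\<lambda>a us. B a (v # us)) ys)"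
    using alternatingD_add[OF Nil(2), of _ "[]"] alternatingD_scale[OF Nil(2), of _ "[]"]
    by (intro linearI) (simp_all add: alternate_add alternate_cmult scaleR_conv_of_real)
  then show ?case using Nil(1) by (auto simp: alternate_Cons intro!: linear_compose_sub)
next
  case (Cons x xs)
  have "linear (\<lambda>v. alternate (\<lambda>a us. B a (x # us)) (xs @ v # ys))"
    by (intro Cons.IH Cons.prems alternating_Cons)
  then show ?case
    using alternatingD_linear[OF Cons.prems(2)] by (auto simp: alternate_Cons intro!: linear_compose_sub)
qed

lemma alternate_not_distinct:
  assumes "\<And>us. linear (\<lambda>a. B a us)" "\<And>a. alternating_multilinear (B a)" "\<not> distinct vs"
  shows "alternate B vs = 0"
  using assms
proof (induction vs arbitrary: B)
  case (Cons v vs)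
  show ?case
  proof (cases "distinct vs")
    case False
    then have "alternate (\<lambda>a us. B a (v # us)) vs = 0"
      by (intro Cons.IH Cons.prems alternating_Cons)
    then show ?thesis using alternatingD_distinct[OF Cons.prems(2)] False by (simp add: alternate_Cons)
  next
    case True
    then obtain xs ys where vs: "vs = xs @ v # ys" using Cons.prems(3) by (auto dest: split_list)
    \<comment> \<open>Only the term that extracts the second copy of \<open>v\<close> does not contain \<open>v\<close> twice.\<close>
    have "(-1) ^ i * B (vs ! i) (v # remove_nth i vs) = 0" if i: "i < length vs" "i \<noteq> length xs" for i
    proof -
      have "v \<in> set (remove_nth i vs)"
      proof (cases "i < length xs")
        case True
        then show ?thesis unfolding vs remove_nth_def by simp
      next
        case False
        then have "length xs < i" using i by simp
        then show ?thesis unfolding vs remove_nth_def by (simp add: take_Cons')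
      qed
      then show ?thesis using alternatingD_distinct[OF Cons.prems(2)] by simp
    qed
    then have "alternate (\<lambda>a us. B a (v # us)) vs
        = (\<Sum>i\<in>{length xs}. (-1) ^ i * B (vs ! i) (v # remove_nth i vs))"
      unfolding alternate_def by (intro sum.mono_neutral_right) (auto simp: vs)
    also have "\<dots> = (-1) ^ length xs * B v (v # xs @ ys)" by (simp add: vs)
    also have "\<dots> = B v vs"
      using alternating_move_to_front[OF Cons.prems(2), of v xs v ys] vs by simp
    finally show ?thesis by (simp add: alternate_Cons)
  qed
qed simp

lemma alternating_alternate:
  assumes "\<And>us. linear (\<lambda>a. B a us)" "\<And>a. alternating_multilinear (B a)"
  shows "alternating_multilinear (alternate B)"
  by (intro alternating_multilinearI alternate_linear alternate_not_distinct assms)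

text \<open>Exchanging the roles of the two extracted vectors changes the sign, because extracting one
  shifts the position of the other.  This gives \<open>dd = 0\<close> once second derivatives commute.\<close>

lemma alternate_twice_swap:
  "alternate (\<lambda>a. alternate (C a)) vs = - alternate (\<lambda>b. alternate (\<lambda>a. C a b)) vs"
proof (induction vs arbitrary: C)
  case (Cons v vs)
  have *: "alternate (\<lambda>a. alternate (C a)) (v # vs)
      = alternate (C v) vs - alternate (\<lambda>a us. C a v us) vs + alternate (\<lambda>a. alternate (\<lambda>b us. C a b (v # us))) vs" for C
    by (simp add: alternate_Cons alternate_diff)
  show ?case unfolding *[of C] *[of "\<lambda>b a. C a b"] using Cons[of "\<lambda>a b us. C a b (v # us)"] by simp
qed simp

lemma alternate_twice_symmetric:
  assumes "\<And>a b us. C a b us = C b a us"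
  shows "alternate (\<lambda>a. alternate (C a)) vs = 0"
proof -
  have "(\<lambda>b. alternate (\<lambda>a. C a b)) = (\<lambda>a. alternate (C a))"
    using assms by presburger
  then show ?thesis using alternate_twice_swap[of C vs] by (simp add: eq_neg_iff_add_eq_0)
qed

subsection \<open>Products with a line\<close>

text \<open>A vector of the product is a horizontal one plus a multiple of \<open>(0, 1)\<close>, and a list with two
  vertical entries is mapped to \<open>0\<close>.  So an alternating function is determined by lists of horizontal vectors, possibly
  preceded by one vertical vector; these two cases are the tangential and the normal part of a form.\<close>

lemma alternating_prod_eqI:
  fixes W W' :: "('a::euclidean_space \<times> real) list \<Rightarrow> complex"
  assumes W: "alternating_multilinear W" and W': "alternating_multilinear W'"
    and hor: "\<And>us. W (map (\<lambda>v. (v, 0)) us) = W' (map (\<lambda>v. (v, 0)) us)"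
    and ver: "\<And>us. W ((0, 1) # map (\<lambda>v. (v, 0)) us) = W' ((0, 1) # map (\<lambda>v. (v, 0)) us)"
  shows "W vs = W' vs"
proof -
  have split: "w (xs @ (v, t) # ys) = w (xs @ (v, 0) # ys) + of_real t * w (xs @ (0, 1) # ys)"
    if "alternating_multilinear w" for w :: "('a \<times> real) list \<Rightarrow> complex" and xs v t ys
    using alternatingD_add[OF that, of xs "(v, 0)" "t *\<^sub>R (0, 1)" ys] alternatingD_scale[OF that, of xs t "(0,1)" ys]
    by simp
  have ver': "W ((0, 1) # map (\<lambda>v. (v, 0)) us @ ys) = W' ((0, 1) # map (\<lambda>v. (v, 0)) us @ ys)" for us ys
  proof (induction ys arbitrary: us)
    case (Cons y ys)
    obtain v t where y: "y = (v, t)" by (cases y)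
    have "W ((0, 1) # map (\<lambda>v. (v, 0)) us @ (v, 0) # ys) = W' ((0, 1) # map (\<lambda>v. (v, 0)) us @ (v, 0) # ys)"
      using Cons[of "us @ [v]"] by simp
    then show ?case
      using split[OF W, of "(0, 1) # map (\<lambda>v. (v, 0)) us" v t ys]
        split[OF W', of "(0, 1) # map (\<lambda>v. (v, 0)) us" v t ys]
        alternatingD_distinct[OF W] alternatingD_distinct[OF W'] unfolding y by simp
  qed (use ver in simp)
  have "W (map (\<lambda>v. (v, 0)) us @ ys) = W' (map (\<lambda>v. (v, 0)) us @ ys)" for us ys
  proof (induction ys arbitrary: us)
    case (Cons y ys)
    obtain v t where y: "y = (v, t)" by (cases y)
    have "W (map (\<lambda>v. (v, 0)) us @ (v, 0) # ys) = W' (map (\<lambda>v. (v, 0)) us @ (v, 0) # ys)"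
      using Cons[of "us @ [v]"] by simp
    moreover have "W (map (\<lambda>v. (v, 0)) us @ (0, 1) # ys) = W' (map (\<lambda>v. (v, 0)) us @ (0, 1) # ys)"
      using alternating_move_to_front[OF W, of "map (\<lambda>v. (v, 0)) us" "(0,1)" ys]
        alternating_move_to_front[OF W', of "map (\<lambda>v. (v, 0)) us" "(0,1)" ys] ver'[of us ys] by simp
    ultimately show ?case 
      using split[OF W, of "map (\<lambda>v. (v, 0)) us" v t ys] split[OF W', of "map (\<lambda>v. (v, 0)) us" v t ys]
      unfolding y by simp
  qed (use hor in simp)
  from this[of "[]"] show ?thesis by simp
qed

section \<open>Flat differential and codifferential\<close>

lemma OmegaD_alternating: "w \<in> Omega U k \<Longrightarrow> alternating_multilinear (w x)"
  and OmegaD_smooth: "w \<in> Omega U k \<Longrightarrow> smooth_on U (\<lambda>x. w x vs)"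
  and OmegaD_outside: "w \<in> Omega U k \<Longrightarrow> x \<notin> U \<Longrightarrow> w x vs = 0"
  and OmegaD_length: "w \<in> Omega U k \<Longrightarrow> int (length vs) \<noteq> k \<Longrightarrow> w x vs = 0"
  unfolding Omega_def by blast+

lemma OmegaI:
  assumes "\<And>x. alternating_multilinear (w x)" "\<And>x vs. x \<notin> U \<Longrightarrow> w x vs = 0"
    "\<And>x vs. int (length vs) \<noteq> k \<Longrightarrow> w x vs = 0" "\<And>vs. smooth_on U (\<lambda>x. w x vs)"
  shows "w \<in> Omega U k"
  using assms unfolding Omega_def by blast

lemma OmegaD_differentiable: "w \<in> Omega U k \<Longrightarrow> x \<in> U \<Longrightarrow> (\<lambda>y. w y vs) differentiable (at x)"
  using smooth_onD_differentiable[OF OmegaD_smooth] .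

lemma Omega_zero: "(\<lambda>x vs. 0) \<in> Omega U k"
  by (rule OmegaI) auto

lemma Omega_add:
  "open U \<Longrightarrow> w \<in> Omega U k \<Longrightarrow> w' \<in> Omega U k \<Longrightarrow> (\<lambda>x vs. w x vs + w' x vs) \<in> Omega U k"
  by (rule OmegaI)
     (auto simp: OmegaD_outside OmegaD_length intro: alternating_add OmegaD_alternating smooth_on_add OmegaD_smooth)

lemma Omega_mult:
  "open U \<Longrightarrow> smooth_on U c \<Longrightarrow> w \<in> Omega U k \<Longrightarrow> (\<lambda>x vs. c x * w x vs) \<in> Omega U k"
  by (rule OmegaI)
     (auto simp: OmegaD_outside OmegaD_length intro: alternating_cmult OmegaD_alternating smooth_on_mult OmegaD_smooth)

lemma Omega_cmult: "open U \<Longrightarrow> w \<in> Omega U k \<Longrightarrow> (\<lambda>x vs. c * w x vs) \<in> Omega U k"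
  using Omega_mult[of U "\<lambda>x. c"] by simp

lemma Omega_uminus: "open U \<Longrightarrow> w \<in> Omega U k \<Longrightarrow> (\<lambda>x vs. - w x vs) \<in> Omega U k"
  using Omega_cmult[of U w k "-1"] by simp

lemma Omega_diff:
  "open U \<Longrightarrow> w \<in> Omega U k \<Longrightarrow> w' \<in> Omega U k \<Longrightarrow> (\<lambda>x vs. w x vs - w' x vs) \<in> Omega U k"
  using Omega_add[of U w k "\<lambda>x vs. - w' x vs"] Omega_uminus[of U w' k] by simp

lemma Omega_sum:
  "open U \<Longrightarrow> (\<And>i. i \<in> I \<Longrightarrow> w i \<in> Omega U k) \<Longrightarrow> (\<lambda>x vs. \<Sum>i\<in>I. w i x vs) \<in> Omega U k"
  by (induction I rule: infinite_finite_induct) (auto intro: Omega_add Omega_zero)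

lemma alternating_pderiv:
  assumes w: "w \<in> Omega U k" and x: "x \<in> U"
  shows "alternating_multilinear (\<lambda>vs. \<partial> (\<lambda>y. w y vs) x v)"
proof (rule alternating_multilinearI)
  note alt = OmegaD_alternating[OF w] and d = OmegaD_differentiable[OF w x]
  show "linear (\<lambda>u. \<partial> (\<lambda>y. w y (xs @ u # ys)) x v)" for xs ys
    by (rule linearI)
      (simp_all add: alternatingD_add[OF alt] alternatingD_scale[OF alt] pderiv_add pderiv_cmult d scaleR_conv_of_real)
  show "\<partial> (\<lambda>y. w y vs) x v = 0" if "\<not> distinct vs" for vs
    using alternatingD_distinct[OF alt that] by simp
qed

lemma ext_d_alternate:
  "ext_d U w x vs = (if x \<in> U then alternate (\<lambda>a us. \<partial> (\<lambda>y. w y us) x a) vs else 0)"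
  unfolding ext_d_def alternate_def by simp

lemma ext_d_Omega:
  assumes U: "open U" and w: "w \<in> Omega U k"
  shows "ext_d U w \<in> Omega U (k + 1)"
proof (rule OmegaI)
  fix x
  show "alternating_multilinear (ext_d U w x)"
  proof (cases "x \<in> U")
    case True
    have "alternating_multilinear (alternate (\<lambda>a us. \<partial> (\<lambda>y. w y us) x a))"
      using pderiv_linear OmegaD_differentiable[OF w True] alternating_pderiv[OF w True]
      by (intro alternating_alternate) auto
    then show ?thesis using True by (simp add: ext_d_alternate[abs_def])
  qed (simp add: ext_d_alternate[abs_def])
next
  fix x and vs :: "'a list" assume "int (length vs) \<noteq> k + 1"
  then have "\<partial> (\<lambda>y. w y us) x a = 0" if "length us = length vs - 1" "vs \<noteq> []" for a us
    using OmegaD_length[OF w, of us] that by (cases vs) auto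
  then show "ext_d U w x vs = 0"
    by (cases "vs = []") (auto simp: ext_d_alternate intro!: alternate_zero)
next
  fix vs
  have "smooth_on U (\<lambda>x. \<Sum>i<length vs. (-1) ^ i * \<partial> (\<lambda>y. w y (remove_nth i vs)) x (vs ! i))"
    by (intro smooth_on_sum smooth_on_mult U smooth_on_const smooth_on_pderiv OmegaD_smooth[OF w])
  then show "smooth_on U (\<lambda>x. ext_d U w x vs)"
    by (subst smooth_on_cong[OF U, where g = "\<lambda>x. \<Sum>i<length vs. (-1) ^ i * \<partial> (\<lambda>y. w y (remove_nth i vs)) x (vs ! i)"])
      (auto simp: ext_d_def)
qed (simp add: ext_d_def)

text \<open>The negative divergence; the formal adjoint of \<open>d\<close> for the flat metric.\<close>

definition flat_codiff :: "'a::euclidean_space set \<Rightarrow> 'a form \<Rightarrow> 'a form" where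
  "flat_codiff U w = (\<lambda>x vs. if x \<in> U then - (\<Sum>b\<in>Basis. \<partial> (\<lambda>y. w y (b # vs)) x b) else 0)"

lemma flat_codiff_Omega:
  assumes U: "open U" and w: "w \<in> Omega U k"
  shows "flat_codiff U w \<in> Omega U (k - 1)"
proof (rule OmegaI)
  fix x
  show "alternating_multilinear (flat_codiff U w x)"
  proof (cases "x \<in> U")
    case True
    have "alternating_multilinear (\<lambda>vs. \<Sum>b\<in>Basis. (-1) * \<partial> (\<lambda>y. w y (b # vs)) x b)"
      by (intro alternating_sum alternating_cmult alternating_Cons[OF alternating_pderiv[OF w True]])
    then show ?thesis using True by (simp add: flat_codiff_def sum_negf)
  qed (simp add: flat_codiff_def)
next
  fix x and vs :: "'a list" assume "int (length vs) \<noteq> k - 1"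
  then show "flat_codiff U w x vs = 0"
    using OmegaD_length[OF w, of "_ # vs"] by (simp add: flat_codiff_def)
next
  fix vs
  have "smooth_on U (\<lambda>x. - (\<Sum>b\<in>Basis. \<partial> (\<lambda>y. w y (b # vs)) x b))"
    by (intro smooth_on_sum smooth_on_uminus U smooth_on_pderiv OmegaD_smooth[OF w])
  then show "smooth_on U (\<lambda>x. flat_codiff U w x vs)"
    by (subst smooth_on_cong[OF U, where g = "\<lambda>x. - (\<Sum>b\<in>Basis. \<partial> (\<lambda>y. w y (b # vs)) x b)"])
      (auto simp: flat_codiff_def)
qed (simp add: flat_codiff_def)

lemma ext_d_add:
  assumes "w \<in> Omega U k" "w' \<in> Omega U k'"
  shows "ext_d U (\<lambda>x vs. w x vs + w' x vs) = (\<lambda>x vs. ext_d U w x vs + ext_d U w' x vs)"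
  by (intro ext) (auto simp: ext_d_alternate alternate_add pderiv_add OmegaD_differentiable[OF assms(1)] OmegaD_differentiable[OF assms(2)])

lemma ext_d_cmult:
  assumes "w \<in> Omega U k"
  shows "ext_d U (\<lambda>x vs. c * w x vs) = (\<lambda>x vs. c * ext_d U w x vs)"
  by (intro ext) (auto simp: ext_d_alternate alternate_cmult pderiv_cmult OmegaD_differentiable[OF assms])

lemma ext_d_divide:
  "w \<in> Omega U k \<Longrightarrow> ext_d U (\<lambda>x vs. w x vs / c) = (\<lambda>x vs. ext_d U w x vs / c)"
  using ext_d_cmult[of w U k "1 / c"] by simp

lemma ext_d_zero [simp]: "ext_d U (\<lambda>x vs. 0) = (\<lambda>x vs. 0)"
  by (intro ext) (simp add: ext_d_def)

lemma flat_codiff_add: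
  assumes "w \<in> Omega U k" "w' \<in> Omega U k'"
  shows "flat_codiff U (\<lambda>x vs. w x vs + w' x vs) = (\<lambda>x vs. flat_codiff U w x vs + flat_codiff U w' x vs)"
  by (intro ext) (auto simp: flat_codiff_def pderiv_add sum.distrib OmegaD_differentiable[OF assms(1)] OmegaD_differentiable[OF assms(2)])

lemma flat_codiff_cmult:
  assumes "w \<in> Omega U k"
  shows "flat_codiff U (\<lambda>x vs. c * w x vs) = (\<lambda>x vs. c * flat_codiff U w x vs)"
  by (intro ext) (auto simp: flat_codiff_def sum_distrib_left pderiv_cmult OmegaD_differentiable[OF assms])

lemma flat_codiff_divide:
  "w \<in> Omega U k \<Longrightarrow> flat_codiff U (\<lambda>x vs. w x vs / c) = (\<lambda>x vs. flat_codiff U w x vs / c)"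
  using flat_codiff_cmult[of w U k "1 / c"] by simp

lemma flat_codiff_zero [simp]: "flat_codiff U (\<lambda>x vs. 0) = (\<lambda>x vs. 0)"
  by (intro ext) (simp add: flat_codiff_def)

lemma ext_d_ext_d:
  assumes w: "w \<in> Omega UNIV k"
  shows "ext_d UNIV (ext_d UNIV w) = (\<lambda>x vs. 0)"
proof (intro ext)
  fix x and vs :: "'a list"
  have "\<partial> (\<lambda>y. alternate (\<lambda>b ws. \<partial> (\<lambda>z. w z ws) y b) us) x a =
      alternate (\<lambda>b ws. \<partial> (\<lambda>y. \<partial> (\<lambda>z. w z ws) y b) x a) us" for a us
  proof -
    have d: "(\<lambda>y. \<partial> (\<lambda>z. w z ws) y b) differentiable at x" for ws b
      using smooth_onD_differentiable[OF smooth_on_pderiv[OF OmegaD_smooth[OF w]]] by simp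
    show ?thesis unfolding alternate_def
      by (subst pderiv_sum) (auto simp: d pderiv_cmult)
  qed
  then have "ext_d UNIV (ext_d UNIV w) x vs =
      alternate (\<lambda>a. alternate (\<lambda>b ws. \<partial> (\<lambda>y. \<partial> (\<lambda>z. w z ws) y b) x a)) vs"
    by (simp add: ext_d_alternate)
  also have "\<dots> = 0"
    by (rule alternate_twice_symmetric) (rule pderiv_commute[OF OmegaD_smooth[OF w]])
  finally show "ext_d UNIV (ext_d UNIV w) x vs = 0" .
qed

text \<open>Second derivatives are symmetric while the two inserted basis vectors anticommute.\<close>

lemma flat_codiff_flat_codiff:
  assumes w: "w \<in> Omega UNIV k"
  shows "flat_codiff UNIV (flat_codiff UNIV w) = (\<lambda>x vs. 0)"
proof (intro ext)
  fix x and vs :: "'a list"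
  define S where "S b c = \<partial> (\<lambda>y. \<partial> (\<lambda>z. w z (c # b # vs)) y c) x b" for b c
  have d: "(\<lambda>y. \<partial> (\<lambda>z. w z ws) y b) differentiable at x" for ws b
    using smooth_onD_differentiable[OF smooth_on_pderiv[OF OmegaD_smooth[OF w]]] by simp
  have e: "(\<lambda>z. w z (c # b # vs)) = (\<lambda>z. - w z (b # c # vs))" for b c
    using alternating_swap[OF OmegaD_alternating[OF w], of _ "[]" c b vs] by simp
  have S: "S b c = \<partial> (\<lambda>y. \<partial> (\<lambda>z. - w z (b # c # vs)) y c) x b" for b c
    unfolding S_def e[of c b] ..
  have "S b c = - \<partial> (\<lambda>y. \<partial> (\<lambda>z. w z (b # c # vs)) y c) x b" for b c
    unfolding S using OmegaD_differentiable[OF w] by (simp add: pderiv_uminus d)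
  then have anti: "S b c = - S c b" for b c
    unfolding S_def using pderiv_commute[OF OmegaD_smooth[OF w]] by metis
  have "flat_codiff UNIV (flat_codiff UNIV w) x vs =
      - (\<Sum>b\<in>Basis. \<partial> (\<lambda>y. - (\<Sum>c\<in>Basis. \<partial> (\<lambda>z. w z (c # b # vs)) y c)) x b)"
    by (simp add: flat_codiff_def)
  also have "\<dots> = (\<Sum>b\<in>Basis. \<Sum>c\<in>Basis. S b c)"
    unfolding S_def using d by (simp add: pderiv_uminus pderiv_sum sum_negf)
  finally have 1: "flat_codiff UNIV (flat_codiff UNIV w) x vs = (\<Sum>b\<in>Basis. \<Sum>c\<in>Basis. S b c)" .
  have "(\<Sum>b\<in>Basis. \<Sum>c\<in>Basis. S b c) = (\<Sum>b\<in>Basis. \<Sum>c\<in>Basis. - S c b)"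
    using anti by (intro sum.cong refl)
  also have "\<dots> = - (\<Sum>b\<in>Basis. \<Sum>c\<in>Basis. S b c)"
    by (subst sum.swap) (simp add: sum_negf)
  finally show "flat_codiff UNIV (flat_codiff UNIV w) x vs = 0"
    using 1 by simp
qed

section \<open>Bump functions and integration by parts\<close>

text \<open>The flat functions \<open>t\<^bsup>-n\<^esup> exp(-1/t)\<close>, continued by \<open>0\<close>.  All \<open>n\<close> are treated at once since the
  derivative of one of them is a combination of two others.\<close>

definition flat_exp :: "nat \<Rightarrow> real \<Rightarrow> real" where
  "flat_exp n t = (if t > 0 then exp (- 1 / t) / t ^ n else 0)"

text \<open>A quadratic bound suffices for differentiability at \<open>0\<close>.  It follows from
  \<open>(1 + x/m)\<^sup>m \<le> exp x\<close> with \<open>m = n + 2\<close> and \<open>x = 1/t\<close>.\<close>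

lemma flat_exp_bound: "\<bar>flat_exp n t\<bar> \<le> real (n + 2) ^ (n + 2) * t\<^sup>2"
proof (cases "t > 0")
  case True
  define m where "m = n + 2"
  have m: "real m > 0" unfolding m_def by simp
  have "(1 / (real m * t)) ^ m \<le> (1 + (1 / t) / real m) ^ m"
    using True m by (intro power_mono) (auto simp: field_simps)
  also have "\<dots> \<le> exp (1 / t)"
    using True m by (intro exp_ge_one_plus_x_over_n_power_n) (auto intro: order_trans[of _ 0])
  finally have "1 \<le> exp (1 / t) * (real m * t) ^ m"
    using True m by (simp add: power_divide field_simps)
  then have "exp (- 1 / t) \<le> (real m * t) ^ m"
    using True by (simp add: exp_minus field_simps)
  then have "exp (- 1 / t) / t ^ n \<le> (real m * t) ^ m / t ^ n"
    using True by (intro divide_right_mono) auto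
  also have "\<dots> = real m ^ m * t\<^sup>2"
    using True unfolding m_def by (simp add: power_mult_distrib power_add power2_eq_square)
  finally show ?thesis using True by (simp add: flat_exp_def m_def)
qed (simp add: flat_exp_def)

lemma flat_exp_deriv:
  "(flat_exp n has_real_derivative flat_exp (n + 2) t - real n * flat_exp (n + 1) t) (at t)"
proof -
  consider "t > 0" | "t < 0" | "t = 0" by linarith
  then show ?thesis
  proof cases
    case 1
    have "((\<lambda>t. exp (- 1 / t) / t ^ n) has_real_derivative
        flat_exp (n + 2) t - real n * flat_exp (n + 1) t) (at t)"
    proof (induction n)
      case 0
      then show ?case using 1
        by (auto intro!: derivative_eq_intros simp: flat_exp_def field_simps power2_eq_square)
    next
      case (Suc n)
      define e y where "e = exp (- 1 / t)" and "y = 1 / t"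
      have F: "flat_exp k t = e * y ^ k" and F': "exp (- 1 / t) / t ^ n = e * y ^ n" for k
        using 1 by (simp_all add: flat_exp_def e_def y_def power_one_over)
      have "((\<lambda>t. exp (- 1 / t) / t ^ n * (1 / t)) has_real_derivative
          (flat_exp (n + 2) t - real n * flat_exp (n + 1) t) * (1 / t) + - (1 / t)\<^sup>2 * (exp (- 1 / t) / t ^ n)) (at t)"
        using 1 by (intro DERIV_mult Suc) (auto intro!: derivative_eq_intros simp: power2_eq_square)
      moreover have "(flat_exp (n + 2) t - real n * flat_exp (n + 1) t) * (1 / t) + - (1 / t)\<^sup>2 * (exp (- 1 / t) / t ^ n)
          = flat_exp (Suc n + 2) t - real (Suc n) * flat_exp (Suc n + 1) t"
        unfolding F F' y_def[symmetric] by (simp add: algebra_simps power2_eq_square)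
      ultimately have "((\<lambda>t. exp (- 1 / t) / t ^ n * (1 / t)) has_real_derivative
          flat_exp (Suc n + 2) t - real (Suc n) * flat_exp (Suc n + 1) t) (at t)"
        by simp
      then show ?case by (simp add: mult.commute)
    qed
    then show ?thesis
      by (rule has_field_derivative_transform_within_open[of _ _ _ "{0<..}"]) (use 1 in \<open>auto simp: flat_exp_def\<close>)
  next
    case 2
    have "((\<lambda>t. 0) has_real_derivative 0) (at t)" by simp
    then have "(flat_exp n has_real_derivative 0) (at t)"
      by (rule has_field_derivative_transform_within_open[of _ _ _ "{..<0}"]) (use 2 in \<open>auto simp: flat_exp_def\<close>)
    then show ?thesis using 2 by (simp add: flat_exp_def)
  next
    case 3
    define C where "C = real (n + 2) ^ (n + 2)"
    have "norm ((flat_exp n (0 + h) - flat_exp n 0) / h) \<le> C * \<bar>h\<bar>" for h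
    proof -
      have "\<bar>flat_exp n h\<bar> \<le> C * \<bar>h\<bar> * \<bar>h\<bar>"
        using flat_exp_bound[of n h] unfolding C_def by (simp add: power2_eq_square mult.assoc)
      then show ?thesis by (cases "h = 0") (auto simp: flat_exp_def field_simps)
    qed
    then have ev: "\<forall>\<^sub>F h in at 0. norm ((flat_exp n (0 + h) - flat_exp n 0) / h) \<le> C * \<bar>h\<bar>"
      by (intro always_eventually allI)
    have "((\<lambda>h. C * \<bar>h\<bar>) \<longlongrightarrow> 0) (at 0)"
      by (auto intro!: tendsto_eq_intros)
    with ev have "((\<lambda>h. (flat_exp n (0 + h) - flat_exp n 0) / h) \<longlongrightarrow> 0) (at 0)"
      by (rule Lim_null_comparison)
    then have "(flat_exp n has_real_derivative 0) (at 0)" by (simp add: DERIV_def)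
    then show ?thesis using 3 by (simp add: flat_exp_def)
  qed
qed

definition bump :: "'a::euclidean_space \<Rightarrow> real \<Rightarrow> 'a \<Rightarrow> real" where
  "bump c r x = flat_exp 0 (r\<^sup>2 - (x - c) \<bullet> (x - c))"

lemma smooth_on_bump: "smooth_on UNIV (\<lambda>x. complex_of_real (bump c r x))"
proof -
  let ?q = "\<lambda>x. r\<^sup>2 - (x - c) \<bullet> (x - c)"
  have d: "((\<lambda>x. complex_of_real (flat_exp n (?q x))) has_derivative
      (\<lambda>v. complex_of_real ((flat_exp (n + 2) (?q x) - real n * flat_exp (n + 1) (?q x))
        * (- 2 * ((x - c) \<bullet> v))))) (at x)" for n x
  proof -
    have "(?q has_derivative (\<lambda>v. - 2 * ((x - c) \<bullet> v))) (at x)"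
      by (auto intro!: derivative_eq_intros simp: inner_commute)
    from diff_chain_at[OF this has_field_derivative_imp_has_derivative[OF flat_exp_deriv]]
    have "((\<lambda>x. flat_exp n (?q x)) has_derivative
      (\<lambda>v. (flat_exp (n + 2) (?q x) - real n * flat_exp (n + 1) (?q x)) * (- 2 * ((x - c) \<bullet> v)))) (at x)"
      by (simp add: o_def)
    then show ?thesis by (rule bounded_linear.has_derivative[OF bounded_linear_of_real])
  qed
  have "differentiable_upto k UNIV (\<lambda>x. complex_of_real (flat_exp n (?q x)))" for k n
  proof (induction k arbitrary: n)
    case 0
    have "(\<lambda>x. complex_of_real (flat_exp n (?q x))) differentiable at x" for x
      using d unfolding differentiable_def by blast
    then have "continuous_on UNIV (\<lambda>x. complex_of_real (flat_exp n (?q x)))"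
      by (intro continuous_at_imp_continuous_on ballI differentiable_imp_continuous_within)
    then show ?case by simp
  next
    case (Suc k)
    have lin: "differentiable_upto k UNIV (\<lambda>x. complex_of_real ((x - c) \<bullet> v))" for v
    proof -
      have "smooth_on UNIV (\<lambda>x. complex_of_real (x \<bullet> v) - complex_of_real (c \<bullet> v))"
        by (intro smooth_on_diff smooth_on_bounded_linear smooth_on_const
            bounded_linear_compose[OF bounded_linear_of_real bounded_linear_inner_left] open_UNIV)
      then show ?thesis unfolding smooth_on_def by (simp add: inner_diff_left)
    qed
    have "differentiable_upto k UNIV (\<lambda>x. ((complex_of_real (flat_exp (n + 2) (?q x))
        + (- of_nat n) * complex_of_real (flat_exp (n + 1) (?q x))) * ((- 2) * complex_of_real ((x - c) \<bullet> v))))" for v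
      by (intro differentiable_upto_mult differentiable_upto_add open_UNIV Suc lin differentiable_upto_const)
    then show ?case
      using differentiableI[OF d] by (auto simp: pderiv_eqI[OF d])
  qed
  then show ?thesis unfolding smooth_on_def bump_def by blast
qed

lemma bump_nonneg: "bump c r x \<ge> 0"
  and bump_pos: "r > 0 \<Longrightarrow> bump c r c > 0"
  by (simp_all add: bump_def flat_exp_def)

lemma bump_outside: "r > 0 \<Longrightarrow> x \<notin> cball c r \<Longrightarrow> bump c r x = 0"
  using power_strict_mono[of r "norm (x - c)" 2]
  by (simp add: bump_def flat_exp_def dist_norm norm_minus_commute flip: power2_norm_eq_inner)

lemma smooth_on_Un:
  assumes "open U" "open V" "smooth_on U f" "smooth_on V f"
  shows "smooth_on (U \<union> V) f"
proof -
  have "differentiable_upto k U f \<Longrightarrow> differentiable_upto k V f \<Longrightarrow> differentiable_upto k (U \<union> V) f" for k f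
    by (induction k arbitrary: f) (auto intro: continuous_on_open_Un assms(1,2))
  then show ?thesis using assms(3,4) unfolding smooth_on_def by blast
qed

text \<open>Products with a compactly supported form are moved to the whole space, where the integral of
  a derivative is easy to compute.\<close>

lemma smooth_on_extend_zero:
  assumes "open U" "smooth_on U f" "compact K" "K \<subseteq> U" "\<And>x. x \<notin> K \<Longrightarrow> f x = 0"
  shows "smooth_on UNIV f"
proof -
  have oK: "open (- K)" using assms(3) by (simp add: compact_imp_closed open_Compl)
  have "smooth_on (- K) f"
    using smooth_on_cong[OF oK, of f "\<lambda>x. 0"] assms(5) by simp
  then have "smooth_on (U \<union> - K) f" using smooth_on_Un[OF assms(1) oK assms(2)] by blast
  moreover have "U \<union> - K = UNIV" using assms(4) by blast
  ultimately show ?thesis by simp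
qed

lemma integrable_compact_support:
  fixes f :: "'a::euclidean_space \<Rightarrow> 'b::{banach, second_countable_topology}"
  assumes "continuous_on UNIV f" "compact K" "\<And>x. x \<notin> K \<Longrightarrow> f x = 0"
  shows "integrable lborel f"
proof -
  have "integrable lborel (\<lambda>x. indicator K x *\<^sub>R f x)"
    using assms by (intro borel_integrable_compact continuous_on_subset[OF assms(1)]) auto
  moreover have "(\<lambda>x. indicator K x *\<^sub>R f x) = f"
    using assms(3) by (auto simp: indicator_def)
  ultimately show ?thesis by simp
qed

lemma pderiv_outside_support:
  assumes "compact K" "\<And>x. x \<notin> K \<Longrightarrow> f x = 0" "x \<notin> K"
  shows "\<partial> f x v = 0"
  using pderiv_cong[of "- K" x f "\<lambda>x. 0"] assms by (simp add: compact_imp_closed open_Compl)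

lemma integrable_pderiv:
  assumes "smooth_on UNIV f" "compact K" "\<And>x. x \<notin> K \<Longrightarrow> f x = 0"
  shows "integrable lborel (\<lambda>x. \<partial> f x b)"
  using assms pderiv_outside_support[OF assms(2,3)]
  by (intro integrable_compact_support[OF _ assms(2)] smooth_on_imp_continuous_on smooth_on_pderiv) auto

text \<open>The difference quotients of \<open>f\<close> have integral \<open>0\<close> by translation invariance of the Lebesgue measure,
  and they converge dominatedly to the derivative.  This avoids Fubini and coordinates.\<close>

lemma integral_pderiv_eq_0:
  fixes f :: "'a::euclidean_space \<Rightarrow> complex"
  assumes f: "smooth_on UNIV f" and K: "compact K" and z: "\<And>x. x \<notin> K \<Longrightarrow> f x = 0"
  shows "integral\<^sup>L lborel (\<lambda>x. \<partial> f x b) = 0"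
proof -
  have cont: "continuous_on UNIV f" by (rule smooth_on_imp_continuous_on[OF f])
  have contd: "continuous_on UNIV (\<lambda>x. \<partial> f x b)"
    by (rule smooth_on_imp_continuous_on[OF smooth_on_pderiv[OF f]])
  have [measurable]: "f \<in> borel_measurable borel" "(\<lambda>x. \<partial> f x b) \<in> borel_measurable borel"
    using cont contd by (auto intro: borel_measurable_continuous_onI)
  have intf: "integrable lborel f" by (rule integrable_compact_support[OF cont K z])
  have shift: "integrable lborel (\<lambda>x. f (c + x))"
    "integral\<^sup>L lborel (\<lambda>x. f (c + x)) = integral\<^sup>L lborel f" for c
  proof -
    have "integral\<^sup>L lborel f = integral\<^sup>L (distr lborel borel ((+) c)) f"
      by (simp add: lborel_distr_plus)
    also have "\<dots> = integral\<^sup>L lborel (\<lambda>x. f (c + x))" by (subst integral_distr) auto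
    finally show "integral\<^sup>L lborel (\<lambda>x. f (c + x)) = integral\<^sup>L lborel f" by simp
    have "integrable (distr lborel borel ((+) c)) f" using intf by (simp add: lborel_distr_plus)
    then show "integrable lborel (\<lambda>x. f (c + x))" by (subst (asm) integrable_distr_eq) auto
  qed
  define h where "h n = inverse (real (Suc n))" for n
  have h: "0 < h n" "h n \<le> 1" for n unfolding h_def by (auto simp: field_simps)
  have h0: "h \<longlonglongrightarrow> 0" unfolding h_def[abs_def] by (rule LIMSEQ_inverse_real_of_nat)
  define g where "g n x = (f (h n *\<^sub>R b + x) - f x) /\<^sub>R h n" for n x
  have g0: "integral\<^sup>L lborel (g n) = 0" for n
    unfolding g_def[abs_def] using shift intf by simp
  obtain M where M: "\<And>x. norm (\<partial> f x b) \<le> M"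
  proof -
    have "bounded ((\<lambda>x. \<partial> f x b) ` K)"
      using K by (intro compact_imp_bounded compact_continuous_image continuous_on_subset[OF contd]) auto
    then obtain M where "\<And>x. x \<in> K \<Longrightarrow> norm (\<partial> f x b) \<le> M" unfolding bounded_iff by auto
    moreover have "norm (\<partial> f x b) = 0" if "x \<notin> K" for x
      using pderiv_outside_support[OF K z that] by simp
    ultimately have "norm (\<partial> f x b) \<le> max M 0" for x by (cases "x \<in> K") (auto simp: le_max_iff_disj)
    then show thesis using that by blast
  qed
  \<comment> \<open>A compact set that supports all difference quotients with step at most \<open>1\<close>.\<close>
  define K' where "K' = (\<lambda>(x, t). x - t *\<^sub>R b) ` (K \<times> {0..1})"
  have K': "compact K'" unfolding K'_def case_prod_beta
    using K by (intro compact_continuous_image compact_Times continuous_intros) auto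
  have bound: "norm (g n x) \<le> M * indicator K' x" for n x
  proof (cases "x \<in> K'")
    case True
    have d: "((\<lambda>t. f (x + t *\<^sub>R b)) has_derivative (\<lambda>s. s *\<^sub>R \<partial> f (x + t *\<^sub>R b) b)) (at t within {0..1})" for t
    proof -
      have 1: "((\<lambda>t. x + t *\<^sub>R b) has_derivative (\<lambda>s. s *\<^sub>R b)) (at t)"
        by (auto intro!: derivative_eq_intros)
      have 2: "(f has_derivative \<partial> f (x + t *\<^sub>R b)) (at (x + t *\<^sub>R b))"
        by (intro has_pderiv smooth_onD_differentiable[OF f]) simp
      have "((\<lambda>t. f (x + t *\<^sub>R b)) has_derivative (\<lambda>s. \<partial> f (x + t *\<^sub>R b) (s *\<^sub>R b))) (at t)"
        using diff_chain_at[OF 1 2] by (simp add: o_def)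
      then show ?thesis
        using has_derivative_linear[OF 2] by (simp add: linear_scale has_derivative_at_withinI)
    qed
    have "norm (f (x + h n *\<^sub>R b) - f (x + 0 *\<^sub>R b)) \<le> M * norm (h n - 0)"
    proof (rule differentiable_bound[OF _ d])
      show "onorm (\<lambda>s. s *\<^sub>R \<partial> f (x + t *\<^sub>R b) b) \<le> M" for t
        using M[of "x + t *\<^sub>R b"] by (intro onorm_le) (auto simp: mult.commute[of M] intro: mult_left_mono)
    qed (use h[of n] in auto)
    moreover have "norm (g n x) = norm (f (x + h n *\<^sub>R b) - f (x + 0 *\<^sub>R b)) / h n"
      using h(1)[of n] unfolding g_def by (simp add: add.commute divide_inverse mult.commute)
    ultimately show ?thesis using True h[of n] by (simp add: pos_divide_le_eq)
  next
    case False
    have "x \<notin> K" using False unfolding K'_def by (force simp: image_iff)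
    moreover have "h n *\<^sub>R b + x \<notin> K"
    proof
      assume "h n *\<^sub>R b + x \<in> K"
      then have "(\<lambda>(x, t). x - t *\<^sub>R b) (h n *\<^sub>R b + x, h n) \<in> K'"
        unfolding K'_def using h[of n] by (intro imageI) auto
      then show False using False by simp
    qed
    ultimately show ?thesis using z False by (simp add: g_def)
  qed
  have "(\<lambda>n. integral\<^sup>L lborel (g n)) \<longlonglongrightarrow> integral\<^sup>L lborel (\<lambda>x. \<partial> f x b)"
  proof (rule integral_dominated_convergence)
    show "integrable lborel (\<lambda>x. M * indicator K' x)"
      using borel_integrable_compact[OF K', of "\<lambda>x. 1::real"] by simp
    show "AE x in lborel. (\<lambda>n. g n x) \<longlonglongrightarrow> \<partial> f x b"
    proof (rule AE_I2)
      fix x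
      have 1: "((\<lambda>t. x + t *\<^sub>R b) has_derivative (\<lambda>s. s *\<^sub>R b)) (at 0)"
        by (auto intro!: derivative_eq_intros)
      have 2: "(f has_derivative \<partial> f x) (at (x + 0 *\<^sub>R b))"
        using has_pderiv[OF smooth_onD_differentiable[OF f, of x]] by simp
      have "((\<lambda>t. f (x + t *\<^sub>R b)) has_derivative (\<lambda>s. s *\<^sub>R \<partial> f x b)) (at 0)"
        using diff_chain_at[OF 1 2] has_derivative_linear[OF 2] by (simp add: o_def linear_scale)
      then have "((\<lambda>t. norm (f (x + t *\<^sub>R b) - f x - t *\<^sub>R \<partial> f x b) / norm t) \<longlongrightarrow> 0) (at 0)"
        unfolding has_derivative_at by simp
      then have "((\<lambda>t. norm ((f (x + t *\<^sub>R b) - f x) /\<^sub>R t - \<partial> f x b)) \<longlongrightarrow> 0) (at 0)"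
      proof (rule Lim_transform_eventually)
        have "norm (f (x + t *\<^sub>R b) - f x - t *\<^sub>R \<partial> f x b) / norm t
            = norm ((f (x + t *\<^sub>R b) - f x) /\<^sub>R t - \<partial> f x b)" if "t \<noteq> 0" for t
        proof -
          have "(f (x + t *\<^sub>R b) - f x) /\<^sub>R t - \<partial> f x b = (f (x + t *\<^sub>R b) - f x - t *\<^sub>R \<partial> f x b) /\<^sub>R t"
            using that by (simp add: scaleR_diff_right)
          then show ?thesis by (simp add: divide_inverse mult.commute)
        qed
        then show "\<forall>\<^sub>F t in at 0. norm (f (x + t *\<^sub>R b) - f x - t *\<^sub>R \<partial> f x b) / norm t
            = norm ((f (x + t *\<^sub>R b) - f x) /\<^sub>R t - \<partial> f x b)"
          by (simp add: eventually_at_filter)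
      qed
      then have "((\<lambda>t. (f (x + t *\<^sub>R b) - f x) /\<^sub>R t) \<longlongrightarrow> \<partial> f x b) (at 0)"
        by (rule LIM_zero_cancel[OF tendsto_norm_zero_cancel])
      moreover have "filterlim h (at 0) sequentially"
        using h0 h(1) by (auto simp: filterlim_at less_imp_neq[symmetric])
      ultimately have "(\<lambda>n. (f (x + h n *\<^sub>R b) - f x) /\<^sub>R h n) \<longlonglongrightarrow> \<partial> f x b"
        by (rule filterlim_compose)
      then show "(\<lambda>n. g n x) \<longlonglongrightarrow> \<partial> f x b" unfolding g_def by (simp add: add.commute)
    qed
    show "AE x in lborel. norm (g n x) \<le> M * indicator K' x" for n using bound by simp
    show "g n \<in> borel_measurable lborel" for n unfolding g_def[abs_def] by measurable
  qed measurable
  then have "(\<lambda>n::nat. 0) \<longlonglongrightarrow> integral\<^sup>L lborel (\<lambda>x. \<partial> f x b)"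
    by (simp only: g0)
  from LIMSEQ_unique[OF this tendsto_const] show ?thesis .
qed

section \<open>The codifferential of a conformally flat metric\<close>

definition flat_inner :: "nat \<Rightarrow> 'a::euclidean_space form \<Rightarrow> 'a form \<Rightarrow> 'a \<Rightarrow> complex" where
  "flat_inner k v w x = (\<Sum>bs\<in>basis_lists k. v x bs * cnj (w x bs)) / fact k"

lemma smooth_on_flat_inner:
  assumes U: "open U" and "v \<in> Omega U l" "w \<in> Omega U l'"
  shows "smooth_on U (flat_inner k v w)"
proof -
  have "smooth_on U (\<lambda>x. (\<Sum>bs\<in>basis_lists k. v x bs * cnj (w x bs)) * (1 / fact k))"
    by (intro smooth_on_mult smooth_on_sum smooth_on_cnj smooth_on_const OmegaD_smooth[OF assms(2)] OmegaD_smooth[OF assms(3)] U)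
  then show ?thesis unfolding flat_inner_def[abs_def] by simp
qed

text \<open>In a sum over all index tuples it does not matter which position is split off; the terms of \<open>dv\<close>
  split off different ones.\<close>

lemma sum_basis_lists_remove_nth:
  fixes \<psi> :: "'a::euclidean_space \<Rightarrow> 'a list \<Rightarrow> complex"
  assumes "i \<le> k"
  shows "(\<Sum>bs\<in>basis_lists (Suc k). \<psi> (bs ! i) (remove_nth i bs)) = (\<Sum>b\<in>Basis. \<Sum>bs\<in>basis_lists k. \<psi> b bs)"
  using assms
proof (induction i arbitrary: k \<psi>)
  case 0
  then show ?case by (simp add: sum_basis_lists_Suc)
next
  case (Suc i)
  then obtain m where k: "k = Suc m" "i \<le> m" by (cases k) auto
  have "(\<Sum>bs\<in>basis_lists (Suc k). \<psi> (bs ! Suc i) (remove_nth (Suc i) bs))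
      = (\<Sum>c\<in>Basis. \<Sum>bs\<in>basis_lists (Suc m). \<psi> (bs ! i) (c # remove_nth i bs))"
    unfolding k(1) sum_basis_lists_Suc[of _ "Suc m"] by simp
  also have "\<dots> = (\<Sum>c\<in>Basis. \<Sum>b\<in>Basis. \<Sum>bs\<in>basis_lists m. \<psi> b (c # bs))"
    by (intro sum.cong refl Suc.IH[OF k(2)])
  also have "\<dots> = (\<Sum>b\<in>Basis. \<Sum>bs\<in>basis_lists (Suc m). \<psi> b bs)"
    by (subst sum.swap) (simp add: sum_basis_lists_Suc)
  finally show ?case unfolding k(1) .
qed

text \<open>The pointwise form of the adjointness: the defect is a divergence.  In \<open>\<langle>dv, w\<rangle>\<close> each of the \<open>m + 1\<close>
  terms of \<open>dv\<close> contributes the same amount, since \<open>w\<close> is alternating; this turns the factor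
  \<open>1/(m+1)!\<close> into \<open>1/m!\<close>.\<close>

lemma flat_adjoint_pointwise:
  assumes U: "open U" and v: "v \<in> Omega U (int m)" and w: "w \<in> Omega U (int (Suc m))" and x: "x \<in> U"
  shows "flat_inner (Suc m) (ext_d U v) w x - flat_inner m v (flat_codiff U w) x
    = (\<Sum>b\<in>Basis. \<partial> (flat_inner m v (\<lambda>y us. w y (b # us))) x b)"
proof -
  define \<psi> where "\<psi> b us = \<partial> (\<lambda>y. v y us) x b * cnj (w x (b # us))" for b us
  have "flat_inner (Suc m) (ext_d U v) w x
      = (\<Sum>bs\<in>basis_lists (Suc m). \<Sum>i<Suc m. \<psi> (bs ! i) (remove_nth i bs)) / fact (Suc m)"
  proof -
    have "ext_d U v x bs * cnj (w x bs) = (\<Sum>i<Suc m. \<psi> (bs ! i) (remove_nth i bs))"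
      if "bs \<in> basis_lists (Suc m)" for bs
    proof -
      have len: "length bs = Suc m" using that unfolding basis_lists_def by simp
      have "(-1) ^ i * \<partial> (\<lambda>y. v y (remove_nth i bs)) x (bs ! i) * cnj (w x bs) = \<psi> (bs ! i) (remove_nth i bs)"
        if "i < Suc m" for i
      proof -
        have "w x bs = (-1) ^ i * w x (bs ! i # remove_nth i bs)"
          using that len by (intro alternating_nth_to_front[OF OmegaD_alternating[OF w]]) simp
        moreover have "(-1) ^ i * (-1) ^ i = (1::complex)" by (simp flip: power_add mult_2)
        ultimately show ?thesis unfolding \<psi>_def by (simp add: mult_ac)
      qed
      then show ?thesis using x unfolding ext_d_def len by (simp add: sum_distrib_right del: sum.lessThan_Suc)
    qed
    then show ?thesis unfolding flat_inner_def by simp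
  qed
  also have "(\<Sum>bs\<in>basis_lists (Suc m). \<Sum>i<Suc m. \<psi> (bs ! i) (remove_nth i bs))
      = (\<Sum>i<Suc m. \<Sum>b\<in>Basis. \<Sum>us\<in>basis_lists m. \<psi> b us)"
    by (subst sum.swap) (intro sum.cong refl sum_basis_lists_remove_nth, simp)
  also have "\<dots> / fact (Suc m) = (\<Sum>b\<in>Basis. \<Sum>us\<in>basis_lists m. \<psi> b us) / fact m"
    using of_nat_neq_0[of m, where ?'a = complex] by (simp add: divide_simps)
  finally have 1: "flat_inner (Suc m) (ext_d U v) w x = (\<Sum>b\<in>Basis. \<Sum>us\<in>basis_lists m. \<psi> b us) / fact m" .
  have "flat_inner m v (flat_codiff U w) x
      = (\<Sum>us\<in>basis_lists m. \<Sum>b\<in>Basis. - (v x us * cnj (\<partial> (\<lambda>y. w y (b # us)) x b))) / fact m"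
    using x unfolding flat_inner_def flat_codiff_def by (simp add: sum_distrib_left sum_negf)
  then have 2: "flat_inner m v (flat_codiff U w) x
      = (\<Sum>b\<in>Basis. \<Sum>us\<in>basis_lists m. - (v x us * cnj (\<partial> (\<lambda>y. w y (b # us)) x b))) / fact m"
    by (subst (asm) sum.swap)
  have 3: "\<partial> (flat_inner m v (\<lambda>y us. w y (b # us))) x b
      = (\<Sum>us\<in>basis_lists m. \<psi> b us + v x us * cnj (\<partial> (\<lambda>y. w y (b # us)) x b)) / fact m" for b
  proof -
    have dc: "((\<lambda>y. cnj (w y us)) has_derivative (\<lambda>h. cnj (\<partial> (\<lambda>y. w y us) x h))) (at x)" for us
      by (intro bounded_linear.has_derivative[OF bounded_linear_cnj] has_pderiv OmegaD_differentiable[OF w x])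
    have "((\<lambda>y. (\<Sum>us\<in>basis_lists m. v y us * cnj (w y (b # us))) / fact m) has_derivative
      (\<lambda>h. (\<Sum>us\<in>basis_lists m. v x us * cnj (\<partial> (\<lambda>y. w y (b # us)) x h) + \<partial> (\<lambda>y. v y us) x h * cnj (w x (b # us))) / fact m)) (at x)"
      unfolding divide_inverse
      by (intro has_derivative_mult_left has_derivative_sum has_derivative_mult dc has_pderiv OmegaD_differentiable[OF v x])
    from pderiv_eqI[OF this] show ?thesis
      unfolding flat_inner_def[abs_def] \<psi>_def by (simp add: add.commute)
  qed
  show ?thesis unfolding 1 2 3
    by (simp add: sum.distrib sum_negf flip: sum_divide_distrib) (simp add: add_divide_distrib)
qed

lemma inverse_metric_conformal:
  fixes g :: "'a::euclidean_space metric"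
  assumes "s > 0" "\<And>u v. g x u v = (u \<bullet> v) / s\<^sup>2"
  shows "inverse_metric g x = (\<lambda>a b. if a \<in> Basis \<and> a = b then s\<^sup>2 else 0)"
proof -
  have row: "(\<Sum>c\<in>Basis. g x a c * h c b) = h a b / s\<^sup>2" if "a \<in> Basis" for a b and h :: "'a \<Rightarrow> 'a \<Rightarrow> real"
  proof -
    have "(\<Sum>c\<in>Basis. g x a c * h c b) = (\<Sum>c\<in>Basis. if c = a then h a b / s\<^sup>2 else 0)"
      using that by (intro sum.cong) (auto simp: assms(2) inner_Basis)
    then show ?thesis using that by simp
  qed
  show ?thesis
    unfolding inverse_metric_def
  proof (rule the_equality)
    fix h
    assume h: "(\<forall>a\<in>Basis. \<forall>b\<in>Basis. (\<Sum>c\<in>Basis. g x a c * h c b) = (if a = b then 1 else 0)) \<and>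
      (\<forall>a b. a \<notin> Basis \<or> b \<notin> Basis \<longrightarrow> h a b = 0)"
    show "h = (\<lambda>a b. if a \<in> Basis \<and> a = b then s\<^sup>2 else 0)"
    proof (intro ext)
      fix a b
      show "h a b = (if a \<in> Basis \<and> a = b then s\<^sup>2 else 0)"
      proof (cases "a \<in> Basis \<and> b \<in> Basis")
        case True
        then have "h a b / s\<^sup>2 = (if a = b then 1 else 0)" using h row by metis
        then show ?thesis using True assms(1) by (auto simp: field_simps split: if_splits)
      next
        case False
        then show ?thesis using h by auto
      qed
    qed
  next
    let ?h = "\<lambda>a b. if a \<in> Basis \<and> a = b then s\<^sup>2 else 0"
    have "(\<Sum>c\<in>Basis. g x a c * ?h c b) = (if a = b then 1 else 0)" if "a \<in> Basis" for a b
      using row[OF that, of ?h b] that assms(1) by auto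
    then show "(\<forall>a\<in>Basis. \<forall>b\<in>Basis. (\<Sum>c\<in>Basis. g x a c * ?h c b) = (if a = b then 1 else 0)) \<and>
      (\<forall>a b. a \<notin> Basis \<or> b \<notin> Basis \<longrightarrow> ?h a b = 0)"
      by auto
  qed
qed

text \<open>Only the identity permutation contributes to the determinant of a diagonal matrix.\<close>

lemma volume_density_conformal:
  fixes g :: "'a::euclidean_space metric"
  assumes "s > 0" "\<And>u v. g x u v = (u \<bullet> v) / s\<^sup>2"
  shows "volume_density g x = s powi (- int DIM('a))"
proof -
  have "(\<Sum>\<sigma> | \<sigma> permutes Basis. of_int (sign \<sigma>) * (\<Prod>b\<in>Basis. g x b (\<sigma> b)))
      = (\<Sum>\<sigma>\<in>{id}. of_int (sign \<sigma>) * (\<Prod>b\<in>Basis. g x b (\<sigma> b)))"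
  proof (rule sum.mono_neutral_right)
    show "\<forall>\<sigma>\<in>{\<sigma>. \<sigma> permutes (Basis::'a set)} - {id}. of_int (sign \<sigma>) * (\<Prod>b\<in>Basis. g x b (\<sigma> b)) = 0"
    proof
      fix \<sigma> :: "'a \<Rightarrow> 'a" assume \<sigma>: "\<sigma> \<in> {\<sigma>. \<sigma> permutes Basis} - {id}"
      then obtain b where "\<sigma> b \<noteq> b" by (auto simp: fun_eq_iff)
      moreover from this have b: "b \<in> Basis" using \<sigma> by (auto simp: permutes_def)
      moreover have "\<sigma> b \<in> Basis" using \<sigma> b permutes_in_image by fastforce
      ultimately have "g x b (\<sigma> b) = 0" by (simp add: assms(2) inner_Basis)
      then have "(\<Prod>b\<in>Basis. g x b (\<sigma> b)) = 0" using b by (intro prod_zero) auto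
      then show "of_int (sign \<sigma>) * (\<Prod>b\<in>Basis. g x b (\<sigma> b)) = 0" by simp
    qed
  qed (auto simp: permutes_id finite_permutations)
  also have "\<dots> = (1 / s ^ DIM('a))\<^sup>2"
    by (simp add: sign_id assms(2) inner_Basis power_one_over flip: power_mult)
       (simp add: mult.commute)
  finally show ?thesis
    using assms(1) by (simp add: volume_density_def power_int_minus divide_inverse)
qed

lemma form_inner_conformal:
  fixes g :: "'a::euclidean_space metric"
  assumes "s > 0" "\<And>u v. g x u v = (u \<bullet> v) / s\<^sup>2"
  shows "form_inner g (int k) v w x = of_real (s ^ (2 * k)) * flat_inner k v w x"
proof -
  have "(\<Prod>r<k. inverse_metric g x (bs ! r) (cs ! r)) = (if bs = cs then s ^ (2 * k) else 0)"
    if bl: "bs \<in> basis_lists k" "cs \<in> basis_lists k" for bs cs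
  proof (cases "bs = cs")
    case True
    have "bs ! r \<in> Basis" if "r < k" for r
      using \<open>bs \<in> basis_lists k\<close> that unfolding basis_lists_def by auto
    then show ?thesis
      using True by (simp add: inverse_metric_conformal[where g = g, OF assms] power_mult)
  next
    case False
    then obtain r where "r < k" "bs ! r \<noteq> cs ! r"
      using bl unfolding basis_lists_def by (auto simp: list_eq_iff_nth_eq)
    then have "(\<Prod>r<k. inverse_metric g x (bs ! r) (cs ! r)) = 0"
      by (intro prod_zero) (auto simp: inverse_metric_conformal[where g = g, OF assms])
    then show ?thesis using False by simp
  qed
  then have "form_inner g (int k) v w x =
      (\<Sum>bs\<in>basis_lists k. \<Sum>cs\<in>basis_lists k. if bs = cs then of_real (s ^ (2 * k)) * v x bs * cnj (w x cs) else 0) / fact k"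
    unfolding form_inner_def nat_int by (intro arg_cong2[of _ _ _ _ "(/)"] sum.cong refl) simp
  then show ?thesis
    unfolding flat_inner_def by (simp add: sum_distrib_left mult.assoc)
qed

text \<open>Smoothness is asked for all integer powers of the scale because the inner product of
  \<open>k\<close>-forms against the volume involves its power with exponent \<open>2k\<close> minus the dimension.\<close>

locale conformally_flat =
  fixes U :: "'a::euclidean_space set" and g :: "'a metric" and s :: "'a \<Rightarrow> real"
  assumes open_domain: "open U"
    and scale_pos: "x \<in> U \<Longrightarrow> s x > 0"
    and metric_eq: "x \<in> U \<Longrightarrow> g x u v = (u \<bullet> v) / (s x)\<^sup>2"
    and smooth_scale: "smooth_on U (\<lambda>x. complex_of_real (s x powi i))"
begin

definition weight :: "int \<Rightarrow> 'a \<Rightarrow> complex" where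
  "weight k x = of_real (s x powi (2 * k - int DIM('a)))"

lemma smooth_on_weight: "smooth_on U (weight k)"
  unfolding weight_def[abs_def] by (rule smooth_scale)

lemma L2_inner_eq:
  assumes v: "v \<in> Omega U l"
  shows "L2_inner U g (int k) v w = integral\<^sup>L lborel (\<lambda>x. weight (int k) x * flat_inner k v w x)"
  unfolding L2_inner_def set_lebesgue_integral_def
proof (intro arg_cong[of _ _ "integral\<^sup>L lborel"] ext)
  fix x
  show "indicator U x *\<^sub>R (volume_density g x *\<^sub>R form_inner g (int k) v w x) = weight (int k) x * flat_inner k v w x"
  proof (cases "x \<in> U")
    case True
    have "s x powi (- int DIM('a)) * s x ^ (2 * k) = s x powi (2 * int k - int DIM('a))"
      using scale_pos[OF True] by (simp add: power_int_diff power_int_minus divide_inverse mult.commute)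
        (simp add: power_int_def nat_mult_distrib)
    then have "weight (int k) x = of_real (s x powi (- int DIM('a))) * of_real (s x ^ (2 * k))"
      unfolding weight_def of_real_mult[symmetric] by simp
    then show ?thesis using True
      by (simp add: volume_density_conformal[where g = g, OF scale_pos[OF True] metric_eq[OF True]]
          form_inner_conformal[where g = g, OF scale_pos[OF True] metric_eq[OF True]] scaleR_conv_of_real mult.assoc)
  next
    case False
    then show ?thesis using OmegaD_outside[OF v] by (simp add: flat_inner_def)
  qed
qed

lemma weighted_inner_support:
  assumes v: "v \<in> Omega U l" and w: "w \<in> Omega U l'" and K: "compact K" "K \<subseteq> U" "\<And>x vs. x \<notin> K \<Longrightarrow> v x vs = 0"
  shows "smooth_on UNIV (\<lambda>x. weight i x * flat_inner k v w x)"
    and "x \<notin> K \<Longrightarrow> weight i x * flat_inner k v w x = 0"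
proof -
  show z: "weight i x * flat_inner k v w x = 0" if "x \<notin> K" for x
    using K(3)[OF that] by (simp add: flat_inner_def)
  show "smooth_on UNIV (\<lambda>x. weight i x * flat_inner k v w x)"
    by (intro smooth_on_extend_zero[OF open_domain _ K(1,2) z] smooth_on_mult open_domain smooth_on_weight
        smooth_on_flat_inner[OF open_domain v w])
qed

lemma weighted_inner_integrable:
  assumes v: "v \<in> Omega U l" and w: "w \<in> Omega U l'" and K: "compact K" "K \<subseteq> U" "\<And>x vs. x \<notin> K \<Longrightarrow> v x vs = 0"
  shows "integrable lborel (\<lambda>x. weight i x * flat_inner k v w x)"
  by (rule integrable_compact_support[OF smooth_on_imp_continuous_on[OF weighted_inner_support(1)[OF assms]]
        K(1) weighted_inner_support(2)[OF assms]])

definition weighted_codiff :: "int \<Rightarrow> 'a form \<Rightarrow> 'a form" where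
  "weighted_codiff k w = (\<lambda>x vs. of_real (s x powi (int DIM('a) - 2 * (k - 1))) * flat_codiff U (\<lambda>y us. weight k y * w y us) x vs)"

lemma weighted_codiff_Omega: "w \<in> Omega U k \<Longrightarrow> weighted_codiff k w \<in> Omega U (k - 1)"
  unfolding weighted_codiff_def
  by (intro Omega_mult flat_codiff_Omega open_domain smooth_scale smooth_on_weight)

lemma L2_adjoint:
  assumes v: "v \<in> Omega U (k - 1)" and w: "w \<in> Omega U k" and cs: "compactly_supported U v"
  shows "L2_inner U g k (ext_d U v) w = L2_inner U g (k - 1) v (weighted_codiff k w)"
proof (cases "k \<ge> 1")
  case False
  have vz: "v x vs = 0" for x vs using False OmegaD_length[OF v] by simp
  then have "ext_d U v x vs = 0" for x vs by (simp add: ext_d_def)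
  then show ?thesis using vz unfolding L2_inner_def form_inner_def by simp
next
  case True
  define m where "m = nat (k - 1)"
  have k: "k = int (Suc m)" "k - 1 = int m" using True unfolding m_def by auto
  obtain K where K: "compact K" "K \<subseteq> U" "\<And>x vs. x \<notin> K \<Longrightarrow> v x vs = 0"
    using cs unfolding compactly_supported_def by blast
  have dK: "ext_d U v x vs = 0" if "x \<notin> K" for x vs
    using pderiv_outside_support[OF K(1) K(3) that] by (simp add: ext_d_alternate alternate_zero)
  define w' where "w' = (\<lambda>x vs. weight k x * w x vs)"
  have w': "w' \<in> Omega U k" unfolding w'_def by (intro Omega_mult open_domain smooth_on_weight w)
  have u: "weighted_codiff k w \<in> Omega U (k - 1)" by (rule weighted_codiff_Omega[OF w])
  have dv: "ext_d U v \<in> Omega U k" using ext_d_Omega[OF open_domain v] by simp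
  define G where "G b = flat_inner m v (\<lambda>y us. w' y (b # us))" for b
  have Gz: "G b x = 0" if "x \<notin> K" for b x using K(3)[OF that] unfolding G_def flat_inner_def by simp
  have Gs: "smooth_on UNIV (G b)" for b
  proof (rule smooth_on_extend_zero[OF open_domain _ K(1,2) Gz])
    have "smooth_on U (\<lambda>x. (\<Sum>bs\<in>basis_lists m. v x bs * cnj (w' x (b # bs))) * (1 / fact m))"
      by (intro smooth_on_mult smooth_on_sum smooth_on_cnj smooth_on_const OmegaD_smooth[OF v] OmegaD_smooth[OF w'] open_domain)
    then show "smooth_on U (G b)" unfolding G_def flat_inner_def[abs_def] by simp
  qed
  have pt: "weight k x * flat_inner (Suc m) (ext_d U v) w x
      - weight (k - 1) x * flat_inner m v (weighted_codiff k w) x = (\<Sum>b\<in>Basis. \<partial> (G b) x b)" for x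
  proof (cases "x \<in> U")
    case True
    have c: "cnj (weight i x) = weight i x" for i unfolding weight_def by simp
    define e where "e = complex_of_real (s x powi (int DIM('a) - 2 * (k - 1)))"
    have "weight (k - 1) x * e = 1"
      using scale_pos[OF True] unfolding weight_def e_def of_real_mult[symmetric]
      by (simp flip: power_int_add)
    then have t: "weight (k - 1) x * (a * cnj (e * z)) = a * cnj z" for a z
      by (simp add: e_def mult.left_commute[of _ a] flip: mult.assoc)
    have "weight (k - 1) x * flat_inner m v (weighted_codiff k w) x = flat_inner m v (flat_codiff U w') x"
      unfolding flat_inner_def weighted_codiff_def w'_def times_divide_eq_right sum_distrib_left e_def[symmetric]
      by (simp only: t)
    moreover have "weight k x * flat_inner (Suc m) (ext_d U v) w x = flat_inner (Suc m) (ext_d U v) w' x"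
      unfolding flat_inner_def w'_def by (simp add: c sum_distrib_left mult.left_commute)
    ultimately show ?thesis
      using flat_adjoint_pointwise[OF open_domain, of v m w' x] v w' True unfolding k(2) k(1) G_def by simp
  next
    case False
    then have "x \<notin> K" using K(2) by blast
    then show ?thesis
      using pderiv_outside_support[OF K(1) Gz] K(3) dK by (simp add: flat_inner_def)
  qed
  have "L2_inner U g k (ext_d U v) w - L2_inner U g (k - 1) v (weighted_codiff k w)
      = integral\<^sup>L lborel (\<lambda>x. weight k x * flat_inner (Suc m) (ext_d U v) w x)
        - integral\<^sup>L lborel (\<lambda>x. weight (k - 1) x * flat_inner m v (weighted_codiff k w) x)"
    unfolding k(2) unfolding k(1) using L2_inner_eq[OF dv, of "Suc m"] L2_inner_eq[OF v, of m] by simp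
  also have "\<dots> = integral\<^sup>L lborel (\<lambda>x. \<Sum>b\<in>Basis. \<partial> (G b) x b)"
    by (subst Bochner_Integration.integral_diff[symmetric])
      (auto intro!: weighted_inner_integrable[OF dv w K(1,2) dK] weighted_inner_integrable[OF v u K] simp: pt)
  also have "\<dots> = (\<Sum>b\<in>Basis. integral\<^sup>L lborel (\<lambda>x. \<partial> (G b) x b))"
    by (intro Bochner_Integration.integral_sum integrable_pderiv[OF Gs K(1) Gz])
  also have "\<dots> = 0"
    by (intro sum.neutral ballI integral_pderiv_eq_0[OF Gs K(1) Gz])
  finally show ?thesis by simp
qed

text \<open>Testing with the difference of the two forms times a bump function around \<open>x0\<close> makes the
  integrand a nonnegative continuous function with integral zero.\<close>

lemma L2_nondegenerate:
  assumes u: "u \<in> Omega U k" and u': "u' \<in> Omega U k"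
    and eq: "\<And>v. v \<in> Omega U k \<Longrightarrow> compactly_supported U v \<Longrightarrow> L2_inner U g k v u = L2_inner U g k v u'"
  shows "u = u'"
proof (intro ext)
  fix x0 vs0
  define D where "D = (\<lambda>x vs. u x vs - u' x vs)"
  have D: "D \<in> Omega U k" unfolding D_def by (rule Omega_diff[OF open_domain u u'])
  have "D x0 vs0 = 0"
  proof (cases "x0 \<in> U \<and> int (length vs0) = k")
    case False
    then show ?thesis using OmegaD_outside[OF D] OmegaD_length[OF D] by blast
  next
    case True
    define m where "m = length vs0"
    have k: "k = int m" and x0: "x0 \<in> U" using True unfolding m_def by auto
    obtain r where r: "r > 0" "cball x0 r \<subseteq> U"
      using open_domain x0 open_contains_cball by metis
    define v where "v = (\<lambda>x vs. complex_of_real (bump x0 r x) * D x vs)"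
    have v: "v \<in> Omega U k"
    proof -
      have "smooth_on U (\<lambda>x. complex_of_real (bump x0 r x))"
        using smooth_on_compose_affine(1)[OF open_domain linear_id smooth_on_bump, of 0] by simp
      then show ?thesis unfolding v_def by (rule Omega_mult[OF open_domain _ D])
    qed
    have K: "compact (cball x0 r)" "cball x0 r \<subseteq> U" "\<And>x vs. x \<notin> cball x0 r \<Longrightarrow> v x vs = 0"
      using r bump_outside[OF r(1)] unfolding v_def by auto
    then have cs: "compactly_supported U v" unfolding compactly_supported_def by blast
    define F where "F x = weight k x * flat_inner m v D x" for x
    define R where "R x = s x powi (2 * k - int DIM('a)) * bump x0 r x * (\<Sum>bs\<in>basis_lists m. (cmod (D x bs))\<^sup>2) / fact m" for x
    have sq: "z * cnj z = (complex_of_real (cmod z))\<^sup>2" for z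
      using complex_norm_square[of z] by simp
    have FR: "F x = of_real (R x)" for x
      unfolding F_def R_def weight_def flat_inner_def v_def
      by (simp add: sum_distrib_left mult.assoc sq)
    have Fi: "integrable lborel F" unfolding F_def[abs_def] by (rule weighted_inner_integrable[OF v D K])
    have Fc: "continuous_on UNIV F" unfolding F_def[abs_def]
      by (rule smooth_on_imp_continuous_on[OF weighted_inner_support(1)[OF v D K]])
    have "F x = weight k x * flat_inner m v u x - weight k x * flat_inner m v u' x" for x
      unfolding F_def flat_inner_def D_def by (simp add: sum_subtractf algebra_simps diff_divide_distrib)
    then have Fe: "F = (\<lambda>x. weight k x * flat_inner m v u x - weight k x * flat_inner m v u' x)"
      by (intro ext)
    have "integral\<^sup>L lborel F = integral\<^sup>L lborel (\<lambda>x. weight k x * flat_inner m v u x)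
        - integral\<^sup>L lborel (\<lambda>x. weight k x * flat_inner m v u' x)"
      unfolding Fe
      by (intro Bochner_Integration.integral_diff weighted_inner_integrable[OF v u K] weighted_inner_integrable[OF v u' K])
    also have "\<dots> = 0" using eq[OF v cs] L2_inner_eq[OF v, of m] unfolding k by simp
    finally have F0: "integral\<^sup>L lborel F = 0" .
    have R: "integrable lborel R" "continuous_on UNIV R"
      using integrable_Re[OF Fi] continuous_on_Re[OF Fc] by (simp_all add: FR)
    have Rpos: "R x \<ge> 0" for x
    proof (cases "x \<in> U")
      case True
      then show ?thesis unfolding R_def using scale_pos[OF True] bump_nonneg[of x0 r x]
        by (intro divide_nonneg_pos mult_nonneg_nonneg sum_nonneg) auto
    next
      case False
      then show ?thesis unfolding R_def using OmegaD_outside[OF D] by simp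
    qed
    have "integral\<^sup>L lborel R = 0" using F0 by (simp add: FR[abs_def])
    then have "AE x in lborel. R x = 0"
      using integral_nonneg_eq_0_iff_AE[OF R(1)] Rpos by simp
    moreover have op: "open {x. R x \<noteq> 0}"
      by (intro open_Collect_neq R(2) continuous_on_const)
    ultimately have "{x. R x \<noteq> 0} \<in> null_sets lborel"
      using AE_iff_null[of lborel "\<lambda>x. R x = 0"] by simp
    then have "negligible {x. R x \<noteq> 0}"
      unfolding negligible_iff_null_sets by (rule null_sets_completionI)
    with op have "R x0 = 0" using open_not_negligible by blast
    then have "(\<Sum>bs\<in>basis_lists m. (cmod (D x0 bs))\<^sup>2) = 0"
      unfolding R_def using bump_pos[OF r(1), of x0] scale_pos[OF x0] by (auto simp: power_int_eq_0_iff)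
    then have "D x0 bs = 0" if "bs \<in> basis_lists m" for bs
      using that by (simp add: sum_nonneg_eq_0_iff)
    then show ?thesis
      using alternating_eqI_Basis[OF OmegaD_alternating[OF D] alternating_zero, of vs0] unfolding m_def by simp
  qed
  then show "u x0 vs0 = u' x0 vs0" unfolding D_def by simp
qed

theorem codiff_eq:
  assumes w: "w \<in> Omega U k"
  shows "codiff U g k w = weighted_codiff k w"
  unfolding codiff_def
proof (rule the_equality)
  show "weighted_codiff k w \<in> Omega U (k - 1) \<and> (\<forall>v\<in>Omega U (k - 1). compactly_supported U v \<longrightarrow>
      L2_inner U g k (ext_d U v) w = L2_inner U g (k - 1) v (weighted_codiff k w))"
    using weighted_codiff_Omega[OF w] L2_adjoint[OF _ w] by blast
  then show "u = weighted_codiff k w" if "u \<in> Omega U (k - 1) \<and> (\<forall>v\<in>Omega U (k - 1). compactly_supported U v \<longrightarrow>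
      L2_inner U g k (ext_d U v) w = L2_inner U g (k - 1) v u)" for u
    using that by (intro L2_nondegenerate[of u "k - 1"]) auto
qed

end

lemma codiff_euclidean:
  fixes w :: "'a::euclidean_space form"
  assumes "w \<in> Omega UNIV k"
  shows "codiff UNIV euclidean_metric k w = flat_codiff UNIV w"
proof -
  interpret conformally_flat UNIV "euclidean_metric :: 'a metric" "\<lambda>_. 1"
    by unfold_locales (simp_all add: euclidean_metric_def)
  show ?thesis using codiff_eq[OF assms] by (simp add: weighted_codiff_def weight_def[abs_def])
qed

section \<open>The hyperbolic Laplacian on homogeneous forms\<close>

lemma open_half_space: "open half_space"
  unfolding half_space_def by (intro open_Collect_less continuous_intros)

abbreviation height_power :: "complex \<Rightarrow> 'a::euclidean_space \<times> real \<Rightarrow> complex" where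
  "height_power a z \<equiv> of_real (snd z) powr a"

lemma has_derivative_height_power:
  fixes z :: "'a::euclidean_space \<times> real"
  assumes "z \<in> half_space"
  shows "(height_power a has_derivative (\<lambda>v. a * height_power (a - 1) z * of_real (snd v))) (at z)"
proof -
  have t: "snd z > 0" using assms by (simp add: half_space_def)
  have 1: "((\<lambda>z::'a \<times> real. complex_of_real (snd z)) has_derivative (\<lambda>v. of_real (snd v))) (at z)"
    by (intro bounded_linear.has_derivative[OF bounded_linear_of_real] has_derivative_snd has_derivative_ident)
  have "((\<lambda>w. w powr a) has_field_derivative a * of_real (snd z) powr (a - 1)) (at (complex_of_real (snd z)))"
    using t by (intro has_field_derivative_powr) (simp add: complex_nonpos_Reals_iff)
  from diff_chain_at[OF 1 has_field_derivative_imp_has_derivative[OF this]]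
  show ?thesis by (simp add: o_def)
qed

lemma pderiv_height_power: "z \<in> half_space \<Longrightarrow> \<partial> (height_power a) z v = a * height_power (a - 1) z * of_real (snd v)"
  by (subst pderiv_eqI[OF has_derivative_height_power]) auto

lemma smooth_on_height_power: "smooth_on half_space (height_power a)"
proof -
  have "differentiable_upto k half_space (height_power a :: 'a \<times> real \<Rightarrow> complex)" for k
  proof (induction k arbitrary: a)
    case 0
    show ?case
      unfolding differentiable_upto.simps
      by (intro continuous_at_imp_continuous_on ballI differentiable_imp_continuous_within
          differentiableI[OF has_derivative_height_power])
  next
    case (Suc k)
    have "differentiable_upto k half_space (\<lambda>z::'a \<times> real. a * height_power (a - 1) z * of_real (snd v))" for v :: "'a \<times> real"
      by (intro differentiable_upto_mult differentiable_upto_const Suc open_half_space)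
    then have "differentiable_upto k half_space (\<lambda>z. \<partial> (height_power a) z v)" for v :: "'a \<times> real"
      by (subst differentiable_upto_cong[OF open_half_space pderiv_height_power])
    then show ?case using differentiableI[OF has_derivative_height_power] by auto
  qed
  then show ?thesis unfolding smooth_on_def by blast
qed

lemma height_power_of_int: "snd z > 0 \<Longrightarrow> height_power (of_int i) z = of_real (snd z powi i)"
  by (simp add: complex_powr_of_int)

interpretation hyperbolic: conformally_flat half_space hyperbolic_metric "snd :: 'a::euclidean_space \<times> real \<Rightarrow> real"
proof
  show "smooth_on half_space (\<lambda>z::'a \<times> real. complex_of_real (snd z powi i))" for i
    by (rule iffD2[OF smooth_on_cong[OF open_half_space] smooth_on_height_power[of "of_int i"]])
      (simp add: height_power_of_int half_space_def)
qed (use open_half_space in \<open>auto simp: half_space_def hyperbolic_metric_def\<close>)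

text \<open>Horizontal lift of vectors of the boundary.\<close>

abbreviation hor :: "'a::euclidean_space list \<Rightarrow> ('a \<times> real) list" where
  "hor us \<equiv> map (\<lambda>v. (v, 0)) us"

lemma wedge1_alternate: "wedge1 s w x vs = alternate (\<lambda>a us. s x a * w x us) vs"
  unfolding wedge1_def alternate_def by (simp add: mult.assoc)

lemma pullback_fst: "pullback fst u z vs = u (fst z) (map fst vs)"
proof -
  have f: "frechet_derivative fst (at z) = fst" for z :: "'a \<times> 'b"
    by (rule frechet_derivative_at[symmetric]) (intro has_derivative_fst has_derivative_ident)
  show ?thesis by (simp add: pullback_def f)
qed

lemma homogeneous_term_alternate:
  "homogeneous_term a u v z vs = (if z \<in> half_space then height_power a z *
    (u (fst z) (map fst vs) + alternate (\<lambda>b us. of_real (snd b / snd z) * v (fst z) (map fst us)) vs) else 0)"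
  by (simp add: homogeneous_term_def pullback_fst wedge1_alternate)

lemma homogeneous_term_hor:
  "z \<in> half_space \<Longrightarrow> homogeneous_term a u v z (hor us) = height_power a z * u (fst z) us"
  by (simp add: homogeneous_term_alternate alternate_map alternate_zero o_def)

lemma alternating_homogeneous_term:
  fixes u v :: "'a::euclidean_space form"
  assumes u: "u \<in> Omega UNIV k" and v: "v \<in> Omega UNIV l"
  shows "alternating_multilinear (homogeneous_term a u v z)"
proof -
  have A: "alternating_multilinear (alternate (\<lambda>b us. of_real (snd b / snd z) * v (fst z) (map fst us)))"
    by (intro alternating_alternate alternating_cmult alternating_map OmegaD_alternating[OF v] linearI)
      (auto simp: add_divide_distrib scaleR_conv_of_real algebra_simps linear_fst)
  have "alternating_multilinear (\<lambda>vs. height_power a z *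
      (u (fst z) (map fst vs) + alternate (\<lambda>b us. of_real (snd b / snd z) * v (fst z) (map fst us)) vs))"
    by (intro alternating_cmult alternating_add alternating_map OmegaD_alternating[OF u] linear_fst A)
  then show ?thesis
    unfolding homogeneous_term_alternate[abs_def] by (cases "z \<in> half_space") (simp_all only: if_True if_False alternating_zero)
qed

text \<open>The factor \<open>1/t\<close> of \<open>dt/t\<close> lowers the exponent by one.\<close>

lemma homogeneous_term_ver:
  assumes u: "u \<in> Omega UNIV k" and z: "z \<in> half_space"
  shows "homogeneous_term a u v z ((0, 1) # hor us) = height_power (a - 1) z * v (fst z) us"
proof -
  have t: "snd z > 0" using z by (simp add: half_space_def)
  have "u (fst z) (0 # us) = 0"
    using alternatingD_zero[OF OmegaD_alternating[OF u], of _ "[]"] by simp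
  moreover have "height_power a z = height_power (a - 1) z * of_real (snd z)"
    using t by (simp add: powr_diff)
  ultimately show ?thesis using z t
    by (simp add: homogeneous_term_alternate alternate_Cons alternate_map alternate_zero o_def)
qed

lemma smooth_on_compose_fst: "smooth_on UNIV f \<Longrightarrow> smooth_on half_space (\<lambda>z. f (fst z))"
  using smooth_on_compose_affine(1)[OF open_half_space linear_fst, of UNIV f 0] by simp

lemma pderiv_compose_fst:
  "smooth_on UNIV f \<Longrightarrow> z \<in> half_space \<Longrightarrow> \<partial> (\<lambda>z. f (fst z)) z h = \<partial> f (fst z) (fst h)"
  using smooth_on_compose_affine(2)[OF open_half_space linear_fst, of UNIV f 0 z h] by simp

lemma pderiv_homogeneous:
  assumes "smooth_on UNIV f" "z \<in> half_space"
  shows "\<partial> (\<lambda>z. height_power a z * f (fst z)) z h =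
    height_power a z * \<partial> f (fst z) (fst h) + a * height_power (a - 1) z * of_real (snd h) * f (fst z)"
proof -
  have "(\<lambda>z. f (fst z)) differentiable at z" "height_power a differentiable at z"
    using smooth_onD_differentiable[OF smooth_on_compose_fst[OF assms(1)] assms(2)]
      smooth_onD_differentiable[OF smooth_on_height_power assms(2)] by auto
  then show ?thesis
    by (simp add: pderiv_mult pderiv_compose_fst assms pderiv_height_power)
qed

lemma homogeneous_term_Omega:
  fixes u v :: "'a::euclidean_space form"
  assumes u: "u \<in> Omega UNIV k" and v: "v \<in> Omega UNIV (k - 1)"
  shows "homogeneous_term a u v \<in> Omega half_space k"
proof (rule OmegaI)
  fix x :: "'a \<times> real" and vs :: "('a \<times> real) list" assume len: "int (length vs) \<noteq> k"
  have "u (fst x) (map fst vs) = 0" using OmegaD_length[OF u] len by simp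
  moreover have "alternate (\<lambda>b us. of_real (snd b / snd x) * v (fst x) (map fst us)) vs = 0"
  proof (cases vs)
    case (Cons y ys)
    then show ?thesis using OmegaD_length[OF v] len by (intro alternate_zero) auto
  qed simp
  ultimately show "homogeneous_term a u v x vs = 0" by (simp add: homogeneous_term_alternate)
next
  fix vs :: "('a \<times> real) list"
  have "smooth_on half_space (\<lambda>z. height_power a z * u (fst z) (map fst vs) +
      (\<Sum>i<length vs. ((-1) ^ i * of_real (snd (vs ! i))) * (height_power (a - 1) z * v (fst z) (map fst (remove_nth i vs)))))"
    by (intro smooth_on_add smooth_on_mult smooth_on_sum smooth_on_const smooth_on_height_power
        smooth_on_compose_fst OmegaD_smooth[OF u] OmegaD_smooth[OF v] open_half_space)
  moreover have "homogeneous_term a u v z vs = height_power a z * u (fst z) (map fst vs) +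
      (\<Sum>i<length vs. ((-1) ^ i * of_real (snd (vs ! i))) * (height_power (a - 1) z * v (fst z) (map fst (remove_nth i vs))))"
    if "z \<in> half_space" for z
  proof -
    have t: "snd z > 0" using that by (simp add: half_space_def)
    have "height_power a z = height_power (a - 1) z * of_real (snd z)"
      using t by (simp add: powr_diff)
    then show ?thesis using that t
      by (simp add: homogeneous_term_alternate alternate_def distrib_left sum_distrib_left)
         (intro sum.cong refl, simp)
  qed
  ultimately show "smooth_on half_space (\<lambda>x. homogeneous_term a u v x vs)"
    by (subst smooth_on_cong[OF open_half_space]) auto
next
  show "alternating_multilinear (homogeneous_term a u v x)" for x
    by (rule alternating_homogeneous_term[OF assms])
qed (simp add: homogeneous_term_def)

lemma homogeneous_term_add:
  "homogeneous_term a u v z vs + homogeneous_term a u' v' z vs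
    = homogeneous_term a (\<lambda>x us. u x us + u' x us) (\<lambda>x us. v x us + v' x us) z vs"
  by (simp add: homogeneous_term_alternate distrib_left alternate_add)

lemma homogeneous_term_diff:
  "homogeneous_term a u v z vs - homogeneous_term a u' v' z vs
    = homogeneous_term a (\<lambda>x us. u x us - u' x us) (\<lambda>x us. v x us - v' x us) z vs"
  by (simp add: homogeneous_term_alternate distrib_left right_diff_distrib alternate_diff)

lemma homogeneous_term_cmult:
  "c * homogeneous_term a u v z vs = homogeneous_term a (\<lambda>x us. c * u x us) (\<lambda>x us. c * v x us) z vs"
proof -
  have "alternate (\<lambda>b us. of_real (snd b / snd z) * (c * v (fst z) (map fst us))) vs
      = c * alternate (\<lambda>b us. of_real (snd b / snd z) * v (fst z) (map fst us)) vs"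
    unfolding alternate_cmult[symmetric] by (simp only: mult.left_commute)
  then show ?thesis by (simp only: homogeneous_term_alternate) (simp add: algebra_simps)
qed

lemma ext_d_homogeneous_term:
  fixes u v :: "'a::euclidean_space form"
  assumes u: "u \<in> Omega UNIV k" and v: "v \<in> Omega UNIV (k - 1)"
  shows "ext_d half_space (homogeneous_term a u v)
    = homogeneous_term a (ext_d UNIV u) (\<lambda>x vs. a * u x vs - ext_d UNIV v x vs)"
proof (intro ext)
  fix z :: "'a \<times> real" and vs
  let ?H = "homogeneous_term a u v" and ?v' = "\<lambda>x vs. a * u x vs - ext_d UNIV v x vs"
  have H: "?H \<in> Omega half_space k" by (rule homogeneous_term_Omega[OF assms])
  have du: "ext_d UNIV u \<in> Omega UNIV (k + 1)" by (intro ext_d_Omega open_UNIV u)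
  have v': "?v' \<in> Omega UNIV k" 
    using Omega_diff[OF open_UNIV Omega_cmult[OF open_UNIV u] ext_d_Omega[OF open_UNIV v, simplified]] .
  show "ext_d half_space ?H z vs = homogeneous_term a (ext_d UNIV u) ?v' z vs"
  proof (cases "z \<in> half_space")
    case False
    then show ?thesis by (simp add: ext_d_def homogeneous_term_def)
  next
    case z: True
    note pu = pderiv_homogeneous[OF OmegaD_smooth[OF u] z] and pv = pderiv_homogeneous[OF OmegaD_smooth[OF v] z]
      and u0 = linear_0[OF pderiv_linear[OF OmegaD_differentiable[OF u UNIV_I]]]
      and v0 = linear_0[OF pderiv_linear[OF OmegaD_differentiable[OF v UNIV_I]]]
    have hor: "\<partial> (\<lambda>y. ?H y (hor us)) z h = \<partial> (\<lambda>z. height_power a z * u (fst z) us) z h" for us h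
      by (rule fun_cong[OF pderiv_cong[OF open_half_space z homogeneous_term_hor]])
    have ver: "\<partial> (\<lambda>y. ?H y ((0, 1) # hor us)) z h = \<partial> (\<lambda>z. height_power (a - 1) z * v (fst z) us) z h" for us h
      by (rule fun_cong[OF pderiv_cong[OF open_half_space z homogeneous_term_ver[OF u]]])
    have "ext_d half_space ?H z (hor us) = homogeneous_term a (ext_d UNIV u) ?v' z (hor us)" for us
      using z by (simp add: ext_d_alternate alternate_map hor pu homogeneous_term_hor alternate_cmult)
    moreover have "ext_d half_space ?H z ((0, 1) # hor us) = homogeneous_term a (ext_d UNIV u) ?v' z ((0, 1) # hor us)" for us
      using z by (simp add: ext_d_alternate alternate_map alternate_Cons hor ver pu pv
          homogeneous_term_ver[OF du] alternate_cmult) (simp add: u0 algebra_simps)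
    ultimately show ?thesis
      by (rule alternating_prod_eqI[OF OmegaD_alternating[OF ext_d_Omega[OF open_half_space H]]
          alternating_homogeneous_term[OF du v']])
  qed
qed

lemma sum_Basis_prod_real:
  fixes f :: "'a::euclidean_space \<times> real \<Rightarrow> complex"
  shows "(\<Sum>b\<in>Basis. f b) = (\<Sum>b\<in>Basis. f (b, 0)) + f (0, 1)"
proof -
  have "(\<Sum>b\<in>Basis. f b) = (\<Sum>b\<in>(\<lambda>u. (u, 0)) ` Basis. f b) + (\<Sum>b\<in>(\<lambda>v. (0, v)) ` Basis. f b)"
    unfolding Basis_prod_def by (rule sum.union_disjoint) auto
  then show ?thesis by (simp add: sum.reindex inj_on_def)
qed

text \<open>On \<open>t\<^sup>a u\<close> the conformal weights only change the exponent, while for the normal part the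
  derivative in direction \<open>t\<close> also hits these weights, which produces the constant \<open>\<kappa>\<close>.\<close>

lemma codiff_homogeneous_term:
  fixes u v :: "'a::euclidean_space form" and a :: complex
  assumes u: "u \<in> Omega UNIV k" and v: "v \<in> Omega UNIV (k - 1)"
  defines "\<kappa> \<equiv> of_int (int DIM('a) - 2 * k + 2) - a"
  shows "codiff half_space hyperbolic_metric k (homogeneous_term a u v)
    = (\<lambda>z vs. homogeneous_term (a + 2) (flat_codiff UNIV u) (\<lambda>x vs. - flat_codiff UNIV v x vs) z vs
        + homogeneous_term a (\<lambda>x vs. \<kappa> * v x vs) (\<lambda>x vs. 0) z vs)" (is "_ = ?R")
proof (intro ext)
  fix z :: "'a \<times> real" and vs
  let ?H = "homogeneous_term a u v"
  define c where "c = complex_of_int (2 * k - int (DIM('a) + 1))"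
  have H: "?H \<in> Omega half_space k" by (rule homogeneous_term_Omega[OF u v])
  have du: "flat_codiff UNIV u \<in> Omega UNIV (k - 1)" by (intro flat_codiff_Omega open_UNIV u)
  have dv: "(\<lambda>x vs. - flat_codiff UNIV v x vs) \<in> Omega UNIV (k - 2)"
    using Omega_uminus[OF open_UNIV flat_codiff_Omega[OF open_UNIV v]] by simp
  have v': "(\<lambda>x vs. \<kappa> * v x vs) \<in> Omega UNIV (k - 1)" by (rule Omega_cmult[OF open_UNIV v])
  have C: "codiff half_space hyperbolic_metric k ?H \<in> Omega half_space (k - 1)"
    unfolding hyperbolic.codiff_eq[OF H] by (rule hyperbolic.weighted_codiff_Omega[OF H])
  show "codiff half_space hyperbolic_metric k ?H z vs = ?R z vs"
  proof (cases "z \<in> half_space")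
    case False
    then show ?thesis using OmegaD_outside[OF C] by (simp add: homogeneous_term_def)
  next
    case z: True
    note pu = pderiv_homogeneous[OF OmegaD_smooth[OF u] z] and pv = pderiv_homogeneous[OF OmegaD_smooth[OF v] z]
      and u0 = linear_0[OF pderiv_linear[OF OmegaD_differentiable[OF u UNIV_I]]]
      and v0 = linear_0[OF pderiv_linear[OF OmegaD_differentiable[OF v UNIV_I]]]
    have t: "snd z > 0" using z by (simp add: half_space_def)
    have pw: "height_power x z * height_power y z = height_power (x + y) z" for x y
      by (rule powr_add[symmetric])
    have codiff: "codiff half_space hyperbolic_metric k ?H z vs
        = - height_power (2 - c) z * (\<Sum>b\<in>Basis. \<partial> (\<lambda>y. height_power c y * ?H y (b # vs)) z b)" for vs
    proof -
      have "hyperbolic.weight k y = height_power c y" if "y \<in> half_space" for y :: "'a \<times> real"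
        using height_power_of_int[of y "2 * k - int (DIM('a) + 1)"] that
        by (simp add: hyperbolic.weight_def c_def half_space_def)
      then have "\<partial> (\<lambda>y. hyperbolic.weight k y * ?H y ws) z b = \<partial> (\<lambda>y. height_power c y * ?H y ws) z b" for b ws
        by (subst pderiv_cong[OF open_half_space z]) auto
      moreover have "complex_of_real (snd z powi (int DIM('a \<times> real) - 2 * (k - 1))) = height_power (2 - c) z"
        using height_power_of_int[OF t, of "int DIM('a \<times> real) - 2 * (k - 1)"] unfolding c_def
        by (simp add: algebra_simps)
      ultimately show ?thesis
        unfolding hyperbolic.codiff_eq[OF H] hyperbolic.weighted_codiff_def flat_codiff_def using z by simp
    qed
    have hor: "\<partial> (\<lambda>y. height_power c y * ?H y (hor us)) z h
        = \<partial> (\<lambda>z. height_power (c + a) z * u (fst z) us) z h" for us h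
      by (subst pderiv_cong[OF open_half_space z, of _ "\<lambda>z. height_power (c + a) z * u (fst z) us"])
        (auto simp: homogeneous_term_hor powr_add)
    have ver: "\<partial> (\<lambda>y. height_power c y * ?H y ((0, 1) # hor us)) z h
        = \<partial> (\<lambda>z. height_power (c + a - 1) z * v (fst z) us) z h" for us h
    proof (subst pderiv_cong[OF open_half_space z, of _ "\<lambda>z. height_power (c + a - 1) z * v (fst z) us"])
      fix y :: "'a \<times> real" assume "y \<in> half_space"
      moreover have "c + a - 1 = c + (a - 1)" by simp
      ultimately show "height_power c y * ?H y ((0, 1) # hor us) = height_power (c + a - 1) y * v (fst y) us"
        by (simp only: homogeneous_term_ver[OF u] powr_add mult.assoc)
    qed simp
    \<comment> \<open>A horizontal vector in front of the vertical one is moved behind it.\<close>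
    have ver2: "\<partial> (\<lambda>y. height_power c y * ?H y ((b, 0) # (0, 1) # hor us)) z h
        = - \<partial> (\<lambda>z. height_power (c + a - 1) z * v (fst z) (b # us)) z h" for b us h
    proof -
      have "?H y ((b, 0) # (0, 1) # hor us) = - ?H y ((0, 1) # hor (b # us))" for y
        using alternating_swap[OF OmegaD_alternating[OF H], of y "[]" "(b, 0)" "(0, 1)" "hor us"] by simp
      then have "(\<lambda>y. height_power c y * ?H y ((b, 0) # (0, 1) # hor us)) = (\<lambda>y. - (height_power c y * ?H y ((0, 1) # hor (b # us))))"
        by simp
      moreover have "(\<lambda>y. height_power c y * ?H y ((0, 1) # hor (b # us))) differentiable at z"
        by (intro smooth_onD_differentiable[OF _ z] smooth_on_mult open_half_space smooth_on_height_power OmegaD_smooth[OF H])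
      ultimately show ?thesis by (simp only: pderiv_uminus ver)
    qed
    have ver3: "\<partial> (\<lambda>y. height_power c y * ?H y ((0, 1) # (0, 1) # us)) z h = 0" for us h
      using alternatingD_distinct[OF OmegaD_alternating[OF H]] by simp
    have \<kappa>: "\<kappa> = 1 - c - a" unfolding \<kappa>_def c_def by simp
    have "codiff half_space hyperbolic_metric k ?H z (hor us) = ?R z (hor us)" for us
    proof -
      have "codiff half_space hyperbolic_metric k ?H z (hor us)
          = - height_power (2 - c) z * (height_power (c + a) z * (\<Sum>b\<in>Basis. \<partial> (\<lambda>x. u x (b # us)) (fst z) b)
            + (c + a - 1) * height_power (c + a - 2) z * v (fst z) us)"
        unfolding codiff sum_Basis_prod_real ver
        using hor[of "_ # us"] z
        by (simp add: pu pv v0 sum_distrib_left)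
      also have "\<dots> = (height_power (2 - c) z * height_power (c + a) z) * - (\<Sum>b\<in>Basis. \<partial> (\<lambda>x. u x (b # us)) (fst z) b)
            + (height_power (2 - c) z * height_power (c + a - 2) z) * (\<kappa> * v (fst z) us)"
        unfolding \<kappa> by (simp add: algebra_simps)
      also have "\<dots> = ?R z (hor us)"
        unfolding pw using z by (simp add: homogeneous_term_hor flat_codiff_def add.commute)
      finally show ?thesis .
    qed
    moreover have "codiff half_space hyperbolic_metric k ?H z ((0, 1) # hor us) = ?R z ((0, 1) # hor us)" for us
    proof -
      have "codiff half_space hyperbolic_metric k ?H z ((0, 1) # hor us)
          = height_power (2 - c) z * (height_power (c + a - 1) z * (\<Sum>b\<in>Basis. \<partial> (\<lambda>x. v x (b # us)) (fst z) b))"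
        unfolding codiff sum_Basis_prod_real ver2 ver3
        using z by (simp add: pv sum_distrib_left sum_negf)
      also have "\<dots> = (height_power (2 - c) z * height_power (c + a - 1) z) * - flat_codiff UNIV v (fst z) us"
        by (simp add: flat_codiff_def)
      also have "\<dots> = ?R z ((0, 1) # hor us)"
        unfolding pw using z by (simp add: homogeneous_term_ver[OF du] homogeneous_term_ver[OF v'] add.commute)
      finally show ?thesis .
    qed
    ultimately show ?thesis
      by (rule alternating_prod_eqI[OF OmegaD_alternating[OF C] alternating_add[OF
          alternating_homogeneous_term[OF du dv] alternating_homogeneous_term[OF v' Omega_zero]]])
  qed
qed

definition flat_laplacian :: "'a::euclidean_space form \<Rightarrow> 'a form" where
  "flat_laplacian w = (\<lambda>x vs. ext_d UNIV (flat_codiff UNIV w) x vs + flat_codiff UNIV (ext_d UNIV w) x vs)"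

lemma flat_laplacian_Omega:
  assumes w: "w \<in> Omega UNIV k"
  shows "flat_laplacian w \<in> Omega UNIV k"
proof -
  have "ext_d UNIV (flat_codiff UNIV w) \<in> Omega UNIV k" "flat_codiff UNIV (ext_d UNIV w) \<in> Omega UNIV k"
    using ext_d_Omega[OF open_UNIV flat_codiff_Omega[OF open_UNIV w]]
      flat_codiff_Omega[OF open_UNIV ext_d_Omega[OF open_UNIV w]] by simp_all
  then show ?thesis unfolding flat_laplacian_def by (rule Omega_add[OF open_UNIV])
qed

text \<open>The coupling terms are what remains of cancellations: \<open>2 dv\<close> because the constants \<open>\<kappa>\<close> for the degrees
  \<open>k\<close> and \<open>k + 1\<close> differ by \<open>2\<close>, and \<open>2 \<delta>u\<close> because \<open>d\<close> is applied after the codifferential has raised the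
  exponent by \<open>2\<close>.\<close>

lemma form_laplacian_homogeneous_term:
  fixes u v :: "'a::euclidean_space form" and a :: complex
  assumes u: "u \<in> Omega UNIV k" and v: "v \<in> Omega UNIV (k - 1)"
  defines "N \<equiv> of_int (int DIM('a) - 2 * k)"
  shows "form_laplacian half_space hyperbolic_metric k (homogeneous_term a u v) z vs
    = homogeneous_term a (\<lambda>x vs. a * (N - a) * u x vs + 2 * ext_d UNIV v x vs)
        (\<lambda>x vs. a * (N + 2 - a) * v x vs) z vs
      + homogeneous_term (a + 2) (flat_laplacian u)
          (\<lambda>x vs. 2 * flat_codiff UNIV u x vs + flat_laplacian v x vs) z vs"
proof -
  let ?d = "ext_d UNIV" and ?\<delta> = "flat_codiff UNIV"
  define \<kappa> where "\<kappa> = N + 2 - a"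
  have \<kappa>: "of_int (int DIM('a) - 2 * k + 2) - a = \<kappa>" "of_int (int DIM('a) - 2 * (k + 1) + 2) - a = \<kappa> - 2"
    unfolding \<kappa>_def N_def by simp_all
  have \<delta>u: "?\<delta> u \<in> Omega UNIV (k - 1)" and \<delta>v: "?\<delta> v \<in> Omega UNIV (k - 2)"
    and du: "?d u \<in> Omega UNIV (k + 1)" and dv: "?d v \<in> Omega UNIV k"
    using flat_codiff_Omega[OF open_UNIV u] flat_codiff_Omega[OF open_UNIV v]
      ext_d_Omega[OF open_UNIV u] ext_d_Omega[OF open_UNIV v] by auto
  have \<delta>v': "(\<lambda>x vs. - ?\<delta> v x vs) \<in> Omega UNIV (k - 1 - 1)" using Omega_uminus[OF open_UNIV \<delta>v] by simp
  have \<kappa>v: "(\<lambda>x vs. \<kappa> * v x vs) \<in> Omega UNIV (k - 1)" by (rule Omega_cmult[OF open_UNIV v])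
  have w: "(\<lambda>x vs. a * u x vs - ?d v x vs) \<in> Omega UNIV k"
    by (intro Omega_diff Omega_cmult open_UNIV u dv)
  have 1: "homogeneous_term (a + 2) (?\<delta> u) (\<lambda>x vs. - ?\<delta> v x vs) \<in> Omega half_space (k - 1)"
    by (rule homogeneous_term_Omega[OF \<delta>u \<delta>v'])
  have 2: "homogeneous_term a (\<lambda>x vs. \<kappa> * v x vs) (\<lambda>x vs. 0) \<in> Omega half_space (k - 1)"
    by (rule homogeneous_term_Omega[OF \<kappa>v Omega_zero])
  have dm: "?d (\<lambda>x vs. - ?\<delta> v x vs) = (\<lambda>x vs. - ?d (?\<delta> v) x vs)"
    using ext_d_cmult[OF \<delta>v, of "-1"] by simp
  have \<delta>w: "?\<delta> (\<lambda>x vs. a * u x vs - ?d v x vs) = (\<lambda>x vs. a * ?\<delta> u x vs - ?\<delta> (?d v) x vs)"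
    using flat_codiff_add[OF Omega_cmult[OF open_UNIV u, of a] Omega_uminus[OF open_UNIV dv]]
      flat_codiff_cmult[OF u, of a] flat_codiff_cmult[OF dv, of "-1"] by simp
  have "ext_d half_space (codiff half_space hyperbolic_metric k (homogeneous_term a u v)) z vs
    = homogeneous_term (a + 2) (?d (?\<delta> u)) (\<lambda>x vs. (a + 2) * ?\<delta> u x vs + ?d (?\<delta> v) x vs) z vs
      + homogeneous_term a (\<lambda>x vs. \<kappa> * ?d v x vs) (\<lambda>x vs. a * (\<kappa> * v x vs)) z vs"
    unfolding codiff_homogeneous_term[OF u v] \<kappa> ext_d_add[OF 1 2]
      ext_d_homogeneous_term[OF \<delta>u \<delta>v'] ext_d_homogeneous_term[OF \<kappa>v Omega_zero] dm ext_d_cmult[OF v]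
    by simp
  moreover have "codiff half_space hyperbolic_metric (k + 1) (ext_d half_space (homogeneous_term a u v)) z vs
    = homogeneous_term (a + 2) (?\<delta> (?d u)) (\<lambda>x vs. - (a * ?\<delta> u x vs - ?\<delta> (?d v) x vs)) z vs
      + homogeneous_term a (\<lambda>x vs. (\<kappa> - 2) * (a * u x vs - ?d v x vs)) (\<lambda>x vs. 0) z vs"
    unfolding ext_d_homogeneous_term[OF u v] using codiff_homogeneous_term[OF du, of _ a] w
    by (simp add: \<kappa>(2)[simplified] \<delta>w \<kappa>_def N_def)
  ultimately have "form_laplacian half_space hyperbolic_metric k (homogeneous_term a u v) z vs
     = (homogeneous_term a (\<lambda>x vs. \<kappa> * ?d v x vs) (\<lambda>x vs. a * (\<kappa> * v x vs)) z vs
        + homogeneous_term a (\<lambda>x vs. (\<kappa> - 2) * (a * u x vs - ?d v x vs)) (\<lambda>x vs. 0) z vs)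
      + (homogeneous_term (a + 2) (?d (?\<delta> u)) (\<lambda>x vs. (a + 2) * ?\<delta> u x vs + ?d (?\<delta> v) x vs) z vs
        + homogeneous_term (a + 2) (?\<delta> (?d u)) (\<lambda>x vs. - (a * ?\<delta> u x vs - ?\<delta> (?d v) x vs)) z vs)"
    by (simp add: form_laplacian_def)
  then show ?thesis
    unfolding homogeneous_term_add by (simp add: flat_laplacian_def \<kappa>_def algebra_simps)
qed

section \<open>The eigenequation as a recursion\<close>

lemma real_polyfun_eq_0:
  fixes c :: "nat \<Rightarrow> complex"
  assumes "\<And>t::real. t > 0 \<Longrightarrow> (\<Sum>i\<le>n. c i * of_real t ^ i) = 0" "i \<le> n"
  shows "c i = 0"
proof (rule ccontr)
  assume "c i \<noteq> 0"
  then have "finite {z. (\<Sum>i\<le>n. c i * z ^ i) = 0}"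
    using polyfun_finite_roots[of c n] assms(2) by blast
  moreover have "complex_of_real ` {0<..} \<subseteq> {z. (\<Sum>i\<le>n. c i * z ^ i) = 0}" using assms(1) by auto
  ultimately have "finite (complex_of_real ` {0<..})" by (rule rev_finite_subset)
  then have "finite {0::real<..}" by (rule finite_imageD) (simp add: inj_on_def)
  then show False using infinite_Ioi by blast
qed

lemma homogeneous_term_zero [simp]: "homogeneous_term a (\<lambda>x vs. 0) (\<lambda>x vs. 0) z vs = 0"
  by (simp add: homogeneous_term_alternate alternate_zero)

text \<open>Evaluation on horizontal lists, and on such lists preceded by the vertical vector, gives
  polynomials in \<open>t\<close>, up to a common power, that vanish for all \<open>t > 0\<close>.\<close>

lemma homogeneous_terms_independent:
  fixes E F :: "nat \<Rightarrow> 'a::euclidean_space form"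
  assumes E: "\<And>i. E i \<in> Omega UNIV k"
    and sum: "\<And>z vs. z \<in> half_space \<Longrightarrow> (\<Sum>i\<le>n. homogeneous_term (lam + of_nat i) (E i) (F i) z vs) = 0"
    and i: "i \<le> n"
  shows "E i y us = 0" "F i y us = 0"
proof -
  have split: "complex_of_real t powr (a + of_nat i) = of_real t powr a * of_real t ^ i" if "t > 0" for t a i
    using that by (simp add: powr_add powr_nat')
  show "E i y us = 0"
  proof (rule real_polyfun_eq_0[OF _ i])
    fix t :: real assume t: "t > 0"
    then have z: "(y, t) \<in> half_space" by (simp add: half_space_def)
    have "0 = (\<Sum>i\<le>n. homogeneous_term (lam + of_nat i) (E i) (F i) (y, t) (hor us))"
      using sum[OF z] by simp
    also have "\<dots> = of_real t powr lam * (\<Sum>i\<le>n. E i y us * of_real t ^ i)"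
      by (simp add: homogeneous_term_hor[OF z] split[OF t] sum_distrib_left mult_ac)
    finally show "(\<Sum>i\<le>n. E i y us * of_real t ^ i) = 0" using t by auto
  qed
  show "F i y us = 0"
  proof (rule real_polyfun_eq_0[OF _ i])
    fix t :: real assume t: "t > 0"
    then have z: "(y, t) \<in> half_space" by (simp add: half_space_def)
    have e: "lam + of_nat i - 1 = (lam - 1) + of_nat i" for i by simp
    have "0 = (\<Sum>i\<le>n. homogeneous_term (lam + of_nat i) (E i) (F i) (y, t) ((0, 1) # hor us))"
      using sum[OF z] by simp
    also have "\<dots> = of_real t powr (lam - 1) * (\<Sum>i\<le>n. F i y us * of_real t ^ i)"
      by (simp only: homogeneous_term_ver[OF E z] e snd_conv fst_conv split[OF t] sum_distrib_left mult_ac)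
    finally show "(\<Sum>i\<le>n. F i y us * of_real t ^ i) = 0" using t by auto
  qed
qed

text \<open>The coefficients of the image of the \<open>j\<close>-th term of the ansatz.\<close>

definition eigen_tangential ::
  "complex \<Rightarrow> complex \<Rightarrow> complex \<Rightarrow> (nat \<Rightarrow> 'a::euclidean_space form) \<Rightarrow> (nat \<Rightarrow> 'a form) \<Rightarrow> nat \<Rightarrow> nat \<Rightarrow> 'a form" where
  "eigen_tangential N lam mu u v j i =
    (if i = j then (\<lambda>y vs. ((lam + of_nat j) * (N - (lam + of_nat j)) - mu) * u j y vs + 2 * ext_d UNIV (v j) y vs)
     else if i = j + 2 then flat_laplacian (u j) else (\<lambda>y vs. 0))"

definition eigen_normal ::
  "complex \<Rightarrow> complex \<Rightarrow> complex \<Rightarrow> (nat \<Rightarrow> 'a::euclidean_space form) \<Rightarrow> (nat \<Rightarrow> 'a form) \<Rightarrow> nat \<Rightarrow> nat \<Rightarrow> 'a form" where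
  "eigen_normal N lam mu u v j i =
    (if i = j then (\<lambda>y vs. ((lam + of_nat j) * (N + 2 - (lam + of_nat j)) - mu) * v j y vs)
     else if i = j + 2 then (\<lambda>y vs. 2 * flat_codiff UNIV (u j) y vs + flat_laplacian (v j) y vs) else (\<lambda>y vs. 0))"

lemma sum_atMost_two_step:
  fixes f :: "nat \<Rightarrow> complex"
  assumes "\<And>j. j \<noteq> i \<Longrightarrow> j + 2 \<noteq> i \<Longrightarrow> f j = 0"
  shows "(\<Sum>j\<le>i. f j) = f i + (if 2 \<le> i then f (i - 2) else 0)"
proof (cases "2 \<le> i")
  case True
  have "f j = 0" if "j \<in> {..i} - {i, i - 2}" for j
    using that True by (intro assms) auto
  then have "(\<Sum>j\<le>i. f j) = (\<Sum>j\<in>{i, i - 2}. f j)"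
    by (intro sum.mono_neutral_right) auto
  then show ?thesis using True by simp
next
  case False
  have "f j = 0" if "j \<in> {..i} - {i}" for j
    using that False by (intro assms) auto
  then have "(\<Sum>j\<le>i. f j) = (\<Sum>j\<in>{i}. f j)"
    by (intro sum.mono_neutral_right) auto
  then show ?thesis using False by simp
qed

text \<open>By independence of the powers of \<open>t\<close> the expansion demanded in \<open>formal_eigenform\<close> must be the one
  given by \<open>form_laplacian_homogeneous_term\<close>, so each order \<open>i\<close> receives contributions from the terms \<open>i\<close> and \<open>i - 2\<close> only.\<close>

lemma formal_eigenform_iff:
  fixes u v :: "nat \<Rightarrow> 'a::euclidean_space form"
  assumes u: "\<And>j. u j \<in> Omega UNIV p" and v: "\<And>j. v j \<in> Omega UNIV (p - 1)"
  defines "N \<equiv> of_int (int DIM('a) - 2 * p)"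
  shows "formal_eigenform p lam mu u v \<longleftrightarrow> (\<forall>i y vs.
    ((lam + of_nat i) * (N - (lam + of_nat i)) - mu) * u i y vs + 2 * ext_d UNIV (v i) y vs
      + (if 2 \<le> i then flat_laplacian (u (i - 2)) y vs else 0) = 0 \<and>
    ((lam + of_nat i) * (N + 2 - (lam + of_nat i)) - mu) * v i y vs
      + (if 2 \<le> i then 2 * flat_codiff UNIV (u (i - 2)) y vs + flat_laplacian (v (i - 2)) y vs else 0) = 0)" (is "_ \<longleftrightarrow> ?rhs")
proof -
  let ?E = "eigen_tangential N lam mu u v" and ?F = "eigen_normal N lam mu u v"
  have \<delta>u: "flat_codiff UNIV (u j) \<in> Omega UNIV (p - 1)" and dv: "ext_d UNIV (v j) \<in> Omega UNIV p" for j
    using flat_codiff_Omega[OF open_UNIV u] ext_d_Omega[OF open_UNIV v, simplified] by auto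
  have E: "?E j i \<in> Omega UNIV p" for j i
    unfolding eigen_tangential_def
    using Omega_add[OF open_UNIV Omega_cmult[OF open_UNIV u] Omega_cmult[OF open_UNIV dv]]
      flat_laplacian_Omega[OF u] Omega_zero by auto
  have F: "?F j i \<in> Omega UNIV (p - 1)" for j i
    unfolding eigen_normal_def
    using Omega_add[OF open_UNIV Omega_cmult[OF open_UNIV \<delta>u] flat_laplacian_Omega[OF v]]
      Omega_cmult[OF open_UNIV v] Omega_zero by auto
  have E0: "?E j i y vs = 0" and F0: "?F j i y vs = 0" if "i \<notin> {j..j + 2}" for j i y vs
    using that by (auto simp: eigen_tangential_def eigen_normal_def)
  have tot: "(\<Sum>j\<le>i. ?E j i y vs) = ((lam + of_nat i) * (N - (lam + of_nat i)) - mu) * u i y vs + 2 * ext_d UNIV (v i) y vs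
      + (if 2 \<le> i then flat_laplacian (u (i - 2)) y vs else 0)"
    "(\<Sum>j\<le>i. ?F j i y vs) = ((lam + of_nat i) * (N + 2 - (lam + of_nat i)) - mu) * v i y vs
      + (if 2 \<le> i then 2 * flat_codiff UNIV (u (i - 2)) y vs + flat_laplacian (v (i - 2)) y vs else 0)" for i y vs
    by (subst sum_atMost_two_step; force simp: eigen_tangential_def eigen_normal_def)+
  have step: "form_laplacian half_space hyperbolic_metric p (homogeneous_term (lam + of_nat j) (u j) (v j)) z vs
      - mu * homogeneous_term (lam + of_nat j) (u j) (v j) z vs
      = (\<Sum>i\<in>{j..j + 2}. homogeneous_term (lam + of_nat i) (?E j i) (?F j i) z vs)" for j z vs
  proof -
    have "{j..j + 2} = {j, j + 1, j + 2}" by auto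
    then have "(\<Sum>i\<in>{j..j + 2}. homogeneous_term (lam + of_nat i) (?E j i) (?F j i) z vs)
      = homogeneous_term (lam + of_nat j) (?E j j) (?F j j) z vs
        + homogeneous_term (lam + of_nat j + 2) (?E j (j + 2)) (?F j (j + 2)) z vs"
      by (simp add: eigen_tangential_def[of _ _ _ _ _ _ "Suc j"] eigen_normal_def[of _ _ _ _ _ _ "Suc j"] add_ac)
    also have "homogeneous_term (lam + of_nat j) (?E j j) (?F j j) z vs
      = homogeneous_term (lam + of_nat j) (\<lambda>y vs. (lam + of_nat j) * (N - (lam + of_nat j)) * u j y vs + 2 * ext_d UNIV (v j) y vs)
          (\<lambda>y vs. (lam + of_nat j) * (N + 2 - (lam + of_nat j)) * v j y vs) z vs
        - mu * homogeneous_term (lam + of_nat j) (u j) (v j) z vs"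
      unfolding homogeneous_term_cmult homogeneous_term_diff
      by (intro arg_cong2[of _ _ _ _ "\<lambda>u v. homogeneous_term (lam + of_nat j) u v z vs"] ext)
        (simp_all add: eigen_tangential_def eigen_normal_def left_diff_distrib)
    also have "homogeneous_term (lam + of_nat j + 2) (?E j (j + 2)) (?F j (j + 2)) z vs
      = homogeneous_term (lam + of_nat j + 2) (flat_laplacian (u j))
          (\<lambda>x vs. 2 * flat_codiff UNIV (u j) x vs + flat_laplacian (v j) x vs) z vs"
      by (simp add: eigen_tangential_def eigen_normal_def)
    finally show ?thesis
      unfolding form_laplacian_homogeneous_term[OF u v] N_def by simp
  qed
  show ?thesis
  proof
    assume "formal_eigenform p lam mu u v"
    then show "?rhs"
      unfolding formal_eigenform_def
    proof (elim exE conjE, goal_cases)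
      case (1 E' F' K)
      have EF': "\<And>j i. E' j i \<in> Omega UNIV p" "\<And>j i. F' j i \<in> Omega UNIV (p - 1)"
        and out: "\<And>j i y vs. i \<notin> {j..K j} \<Longrightarrow> E' j i y vs = 0" "\<And>j i y vs. i \<notin> {j..K j} \<Longrightarrow> F' j i y vs = 0"
        and step': "\<And>j z vs. z \<in> half_space \<Longrightarrow>
             form_laplacian half_space hyperbolic_metric p (homogeneous_term (lam + of_nat j) (u j) (v j)) z vs
             - mu * homogeneous_term (lam + of_nat j) (u j) (v j) z vs
             = (\<Sum>i\<in>{j..K j}. homogeneous_term (lam + of_nat i) (E' j i) (F' j i) z vs)"
        and tot': "\<And>i y vs. (\<Sum>j\<le>i. E' j i y vs) = 0" "\<And>i y vs. (\<Sum>j\<le>i. F' j i y vs) = 0"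
        using 1 by blast+
      have "E' j i y vs = ?E j i y vs \<and> F' j i y vs = ?F j i y vs" for j i y vs
      proof (cases "i \<le> max (K j) (j + 2)")
        case True
        let ?n = "max (K j) (j + 2)"
        have z1: "(\<Sum>i\<in>{j..K j}. homogeneous_term (lam + of_nat i) (E' j i) (F' j i) z vs)
            = (\<Sum>i\<le>?n. homogeneous_term (lam + of_nat i) (E' j i) (F' j i) z vs)" for z vs
        proof (rule sum.mono_neutral_left)
          have "E' j i = (\<lambda>y vs. 0)" "F' j i = (\<lambda>y vs. 0)" if "i \<notin> {j..K j}" for i
            by (intro ext, simp add: out[OF that])+
          then show "\<forall>i\<in>{..?n} - {j..K j}. homogeneous_term (lam + of_nat i) (E' j i) (F' j i) z vs = 0" by simp
        qed auto
        have z2: "(\<Sum>i\<in>{j..j + 2}. homogeneous_term (lam + of_nat i) (?E j i) (?F j i) z vs)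
            = (\<Sum>i\<le>?n. homogeneous_term (lam + of_nat i) (?E j i) (?F j i) z vs)" for z vs
        proof (rule sum.mono_neutral_left)
          have "?E j i = (\<lambda>y vs. 0)" "?F j i = (\<lambda>y vs. 0)" if "i \<notin> {j..j + 2}" for i
            by (intro ext, simp add: E0[OF that] F0[OF that])+
          then show "\<forall>i\<in>{..?n} - {j..j + 2}. homogeneous_term (lam + of_nat i) (?E j i) (?F j i) z vs = 0" by simp
        qed auto
        have s: "(\<Sum>i\<le>?n. homogeneous_term (lam + of_nat i) (\<lambda>y vs. E' j i y vs - ?E j i y vs) (\<lambda>y vs. F' j i y vs - ?F j i y vs) z vs) = 0"
          if "z \<in> half_space" for z vs
          using step'[OF that, of j vs] step[of j z vs] unfolding z1 z2 homogeneous_term_diff[symmetric] sum_subtractf by simp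
        show ?thesis
          using homogeneous_terms_independent[OF Omega_diff[OF open_UNIV EF'(1) E] s True] by simp
      next
        case False
        then have "i \<notin> {j..K j}" "i \<notin> {j..j + 2}" by auto
        then show ?thesis using out[of i j] E0[of i j] F0[of i j] by simp
      qed
      then show "?rhs"
        using tot' unfolding tot[symmetric] by simp
    qed
  next
    assume "?rhs"
    then show "formal_eigenform p lam mu u v"
      unfolding formal_eigenform_def tot[symmetric]
      using E F E0 F0 step by (intro exI[of _ ?E] exI[of _ ?F] exI[of _ "\<lambda>j. j + 2"]) blast
  qed
qed

text \<open>The two equations of order \<open>2j\<close>, for the sequences of even coefficients.\<close>

definition solves_recursion ::
  "complex \<Rightarrow> complex \<Rightarrow> (nat \<Rightarrow> 'a::euclidean_space form) \<Rightarrow> (nat \<Rightarrow> 'a form) \<Rightarrow> nat \<Rightarrow> bool" where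
  "solves_recursion N lam u v j \<longleftrightarrow> (\<forall>y vs.
    2 * of_nat j * (N - 2 * lam - 2 * of_nat j) * u j y vs + 2 * ext_d UNIV (v j) y vs
      + (if j = 0 then 0 else flat_laplacian (u (j - 1)) y vs) = 0 \<and>
    (2 * of_nat j * (N - 2 * lam - 2 * of_nat j) + 2 * (lam + 2 * of_nat j)) * v j y vs
      + (if j = 0 then 0 else 2 * flat_codiff UNIV (u (j - 1)) y vs + flat_laplacian (v (j - 1)) y vs) = 0)"

lemma flat_laplacian_zero [simp]: "flat_laplacian (\<lambda>x vs. 0) = (\<lambda>x vs. 0)"
  unfolding flat_laplacian_def by simp

lemma formal_eigenform_even_iff:
  fixes u v :: "nat \<Rightarrow> 'a::euclidean_space form"
  assumes u: "\<And>j. u j \<in> Omega UNIV p" and v: "\<And>j. v j \<in> Omega UNIV (p - 1)"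
  defines "N \<equiv> of_int (int DIM('a) - 2 * p)"
  shows "formal_eigenform p lam (lam * (N - lam))
      (\<lambda>i. if even i then u (i div 2) else (\<lambda>y vs. 0)) (\<lambda>i. if even i then v (i div 2) else (\<lambda>y vs. 0))
    \<longleftrightarrow> (\<forall>j. solves_recursion N lam u v j)" (is "formal_eigenform p lam _ ?u ?v \<longleftrightarrow> _")
proof -
  let ?P = "\<lambda>i. \<forall>y vs. ((lam + of_nat i) * (N - (lam + of_nat i)) - lam * (N - lam)) * ?u i y vs + 2 * ext_d UNIV (?v i) y vs
      + (if 2 \<le> i then flat_laplacian (?u (i - 2)) y vs else 0) = 0 \<and>
    ((lam + of_nat i) * (N + 2 - (lam + of_nat i)) - lam * (N - lam)) * ?v i y vs
      + (if 2 \<le> i then 2 * flat_codiff UNIV (?u (i - 2)) y vs + flat_laplacian (?v (i - 2)) y vs else 0) = 0"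
  have odd: "?P i" if "odd i" for i using that by simp
  have even: "?P (2 * j) \<longleftrightarrow> solves_recursion N lam u v j" for j
  proof -
    have 1: "(lam + of_nat (2 * j)) * (N - (lam + of_nat (2 * j))) - lam * (N - lam)
        = 2 * of_nat j * (N - 2 * lam - 2 * of_nat j)"
      by (simp add: algebra_simps)
    have 2: "(lam + of_nat (2 * j)) * (N + 2 - (lam + of_nat (2 * j))) - lam * (N - lam)
        = 2 * of_nat j * (N - 2 * lam - 2 * of_nat j) + 2 * (lam + 2 * of_nat j)"
      by (simp add: algebra_simps)
    have 3: "(2 * j - 2) div 2 = j - 1" "even (2 * j)" "even (2 * j - 2)" "2 \<le> 2 * j \<longleftrightarrow> j \<noteq> 0" "2 * j div 2 = j"
      by auto
    show ?thesis unfolding 1 2 solves_recursion_def using 3 by (cases "j = 0") simp_all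
  qed
  have uv: "?u i \<in> Omega UNIV p" "?v i \<in> Omega UNIV (p - 1)" for i
    using u v Omega_zero by auto
  have "formal_eigenform p lam (lam * (N - lam)) ?u ?v \<longleftrightarrow> (\<forall>i. ?P i)"
    unfolding N_def by (rule formal_eigenform_iff[OF uv])
  also have "\<dots> \<longleftrightarrow> (\<forall>j. ?P (2 * j))"
    using odd by (metis evenE)
  finally show ?thesis unfolding even .
qed

section \<open>Solving the recursion\<close>

abbreviation d_delta_power :: "nat \<Rightarrow> 'a::euclidean_space form \<Rightarrow> 'a form" where
  "d_delta_power j \<equiv> (ext_d UNIV \<circ> flat_codiff UNIV) ^^ j"

abbreviation delta_d_power :: "nat \<Rightarrow> 'a::euclidean_space form \<Rightarrow> 'a form" where
  "delta_d_power j \<equiv> (flat_codiff UNIV \<circ> ext_d UNIV) ^^ j"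

lemma d_delta_power_Omega: "w \<in> Omega UNIV k \<Longrightarrow> d_delta_power j w \<in> Omega UNIV k"
proof (induction j)
  case (Suc j)
  then show ?case
    using ext_d_Omega[OF open_UNIV flat_codiff_Omega[OF open_UNIV Suc.IH]] by simp
qed simp

lemma delta_d_power_Omega: "w \<in> Omega UNIV k \<Longrightarrow> delta_d_power j w \<in> Omega UNIV k"
proof (induction j)
  case (Suc j)
  then show ?case
    using flat_codiff_Omega[OF open_UNIV ext_d_Omega[OF open_UNIV Suc.IH]] by simp
qed simp

text \<open>Up to signs the product of \<open>\<lambda> - N\<close> and of the leading coefficients \<open>-4i(\<lambda> - N/2 + i)\<close> of the tangential
  recursion for \<open>i = 1, \<dots>, j\<close>.\<close>

definition recursion_denominator :: "complex \<Rightarrow> nat \<Rightarrow> complex \<Rightarrow> complex" where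
  "recursion_denominator N j lam = 4 ^ j * fact j * pochhammer (lam - N / 2 + 1) j * (lam - N)"

text \<open>At \<open>j = 0\<close> the general expression would give \<open>2 \<phi>\<close>, as both powers are the identity then.\<close>

definition tangential_solution :: "complex \<Rightarrow> complex \<Rightarrow> 'a::euclidean_space form \<Rightarrow> nat \<Rightarrow> 'a form" where
  "tangential_solution N lam \<phi> j = (if j = 0 then \<phi> else (\<lambda>y vs. 1 / recursion_denominator N j lam *
     ((lam - N) * delta_d_power j \<phi> y vs + (lam - N + 2 * of_nat j) * d_delta_power j \<phi> y vs)))"

definition normal_solution :: "complex \<Rightarrow> complex \<Rightarrow> 'a::euclidean_space form \<Rightarrow> nat \<Rightarrow> 'a form" where
  "normal_solution N lam \<phi> j = (if j = 0 then (\<lambda>y vs. 0) else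
     (\<lambda>y vs. 1 / recursion_denominator N (j - 1) lam * flat_codiff UNIV (d_delta_power (j - 1) \<phi>) y vs))"

lemma recursion_denominator_Suc:
  "recursion_denominator N (Suc j) lam =
    4 * of_nat (Suc j) * (lam - N / 2 + of_nat (Suc j)) * recursion_denominator N j lam"
  unfolding recursion_denominator_def by (simp add: pochhammer_Suc algebra_simps)

lemma recursion_denominator_0: "recursion_denominator N 0 lam = lam - N"
  unfolding recursion_denominator_def by simp

text \<open>Unlike the formula for the solution itself, this one covers \<open>j = 0\<close>: the codifferential
  annihilates \<open>(\<delta>d)\<^sup>j \<phi>\<close> for \<open>j \<ge> 1\<close>, and for \<open>j = 0\<close> the coefficient is \<open>1\<close>.\<close>

lemma flat_codiff_tangential_solution:
  assumes \<phi>: "\<phi> \<in> Omega UNIV k" and q: "recursion_denominator N j lam \<noteq> 0"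
  shows "flat_codiff UNIV (tangential_solution N lam \<phi> j) y vs
    = (lam - N + 2 * of_nat j) / recursion_denominator N j lam * flat_codiff UNIV (d_delta_power j \<phi>) y vs"
proof (cases j)
  case 0
  then show ?thesis using q by (simp add: tangential_solution_def recursion_denominator_0)
next
  case (Suc i)
  note A = d_delta_power_Omega[OF \<phi>, of j] and B = delta_d_power_Omega[OF \<phi>, of j]
  have "flat_codiff UNIV (delta_d_power j \<phi>) = (\<lambda>x vs. 0)"
    using flat_codiff_flat_codiff[OF ext_d_Omega[OF open_UNIV delta_d_power_Omega[OF \<phi>, of i]]] Suc by simp
  then show ?thesis
    using Suc flat_codiff_divide[OF Omega_add[OF open_UNIV Omega_cmult[OF open_UNIV B] Omega_cmult[OF open_UNIV A]]]
      flat_codiff_add[OF Omega_cmult[OF open_UNIV B] Omega_cmult[OF open_UNIV A]]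
      flat_codiff_cmult[OF A] flat_codiff_cmult[OF B]
    by (simp add: tangential_solution_def del: funpow.simps)
qed

lemma ext_d_tangential_solution:
  assumes \<phi>: "\<phi> \<in> Omega UNIV k" and q: "recursion_denominator N j lam \<noteq> 0"
  shows "ext_d UNIV (tangential_solution N lam \<phi> j) y vs
    = (lam - N) / recursion_denominator N j lam * ext_d UNIV (delta_d_power j \<phi>) y vs"
proof (cases j)
  case 0
  then show ?thesis using q by (simp add: tangential_solution_def recursion_denominator_0)
next
  case (Suc i)
  note A = d_delta_power_Omega[OF \<phi>, of j] and B = delta_d_power_Omega[OF \<phi>, of j]
  have "ext_d UNIV (d_delta_power j \<phi>) = (\<lambda>x vs. 0)"
    using ext_d_ext_d[OF flat_codiff_Omega[OF open_UNIV d_delta_power_Omega[OF \<phi>, of i]]] Suc by simp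
  then show ?thesis
    using Suc ext_d_divide[OF Omega_add[OF open_UNIV Omega_cmult[OF open_UNIV B] Omega_cmult[OF open_UNIV A]]]
      ext_d_add[OF Omega_cmult[OF open_UNIV B] Omega_cmult[OF open_UNIV A]]
      ext_d_cmult[OF A] ext_d_cmult[OF B]
    by (simp add: tangential_solution_def del: funpow.simps)
qed

lemma flat_laplacian_tangential_solution:
  assumes \<phi>: "\<phi> \<in> Omega UNIV k" and q: "recursion_denominator N j lam \<noteq> 0"
  shows "flat_laplacian (tangential_solution N lam \<phi> j) y vs = 1 / recursion_denominator N j lam *
    ((lam - N) * delta_d_power (Suc j) \<phi> y vs + (lam - N + 2 * of_nat j) * d_delta_power (Suc j) \<phi> y vs)"
proof -
  have "flat_codiff UNIV (tangential_solution N lam \<phi> j) = (\<lambda>y vs.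
      (lam - N + 2 * of_nat j) / recursion_denominator N j lam * flat_codiff UNIV (d_delta_power j \<phi>) y vs)"
    by (intro ext flat_codiff_tangential_solution[OF assms])
  moreover have "ext_d UNIV (tangential_solution N lam \<phi> j) = (\<lambda>y vs.
      (lam - N) / recursion_denominator N j lam * ext_d UNIV (delta_d_power j \<phi>) y vs)"
    by (intro ext ext_d_tangential_solution[OF assms])
  ultimately show ?thesis
    unfolding flat_laplacian_def
    by (simp only: ext_d_cmult[OF flat_codiff_Omega[OF open_UNIV d_delta_power_Omega[OF \<phi>]]]
        flat_codiff_cmult[OF ext_d_Omega[OF open_UNIV delta_d_power_Omega[OF \<phi>]]])
      (simp add: q field_simps)
qed

lemma ext_d_normal_solution:
  assumes \<phi>: "\<phi> \<in> Omega UNIV k"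
  shows "ext_d UNIV (normal_solution N lam \<phi> (Suc j)) y vs
    = 1 / recursion_denominator N j lam * d_delta_power (Suc j) \<phi> y vs"
  using ext_d_divide[OF flat_codiff_Omega[OF open_UNIV d_delta_power_Omega[OF \<phi>]]]
  by (simp add: normal_solution_def)

lemma flat_laplacian_normal_solution:
  assumes \<phi>: "\<phi> \<in> Omega UNIV k"
  shows "flat_laplacian (normal_solution N lam \<phi> (Suc j)) y vs
    = 1 / recursion_denominator N j lam * flat_codiff UNIV (d_delta_power (Suc j) \<phi>) y vs"
proof -
  note A = d_delta_power_Omega[OF \<phi>, of j] and A' = d_delta_power_Omega[OF \<phi>, of "Suc j"]
  let ?c = "1 / recursion_denominator N j lam"
  have "normal_solution N lam \<phi> (Suc j) = (\<lambda>y vs. ?c * flat_codiff UNIV (d_delta_power j \<phi>) y vs)"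
    unfolding normal_solution_def by simp
  then have "flat_codiff UNIV (normal_solution N lam \<phi> (Suc j)) = (\<lambda>x vs. 0)"
    using flat_codiff_divide[OF flat_codiff_Omega[OF open_UNIV A]] flat_codiff_flat_codiff[OF A] by simp
  moreover have "ext_d UNIV (normal_solution N lam \<phi> (Suc j)) = (\<lambda>y vs. ?c * d_delta_power (Suc j) \<phi> y vs)"
    by (intro ext ext_d_normal_solution[OF \<phi>])
  ultimately show ?thesis
    unfolding flat_laplacian_def using flat_codiff_divide[OF A'] by simp
qed

text \<open>Both equations become scalar identities between the coefficients of \<open>(d\<delta>)\<^sup>j \<phi>\<close>, \<open>(\<delta>d)\<^sup>j \<phi>\<close> and
  \<open>\<delta>(d\<delta>)\<^bsup>j-1\<^esup> \<phi>\<close>.\<close>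

lemma solutions_solve_recursion:
  assumes \<phi>: "\<phi> \<in> Omega UNIV k" and q: "recursion_denominator N j lam \<noteq> 0"
  shows "solves_recursion N lam (tangential_solution N lam \<phi>) (normal_solution N lam \<phi>) j"
proof (cases j)
  case 0
  then show ?thesis by (simp add: solves_recursion_def normal_solution_def)
next
  case (Suc i)
  define q where "q = recursion_denominator N i lam"
  define e where "e = lam - N / 2 + of_nat (Suc i)"
  have qj: "recursion_denominator N (Suc i) lam = 4 * of_nat (Suc i) * e * q"
    unfolding q_def e_def by (rule recursion_denominator_Suc)
  have nz: "q \<noteq> 0" "e \<noteq> 0" "of_nat (Suc i) \<noteq> (0::complex)"
    using assms(2) qj Suc of_nat_neq_0[of i, where ?'a = complex] by auto
  have c: "2 * of_nat (Suc i) * (N - 2 * lam - 2 * of_nat (Suc i)) = - (4 * of_nat (Suc i) * e)"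
    unfolding e_def by (simp add: algebra_simps)
  show ?thesis
    unfolding solves_recursion_def Suc
  proof (intro allI conjI)
    fix y vs
    define A B where "A = d_delta_power (Suc i) \<phi> y vs" and "B = delta_d_power (Suc i) \<phi> y vs"
    have T: "tangential_solution N lam \<phi> (Suc i) y vs =
        1 / (4 * of_nat (Suc i) * e * q) * ((lam - N) * B + (lam - N + 2 * of_nat (Suc i)) * A)"
      unfolding tangential_solution_def qj A_def B_def by simp
    define T0 where "T0 = tangential_solution N lam \<phi> (Suc i) y vs"
    have F: "4 * of_nat (Suc i) * e * T0 = 1 / q * ((lam - N) * B + (lam - N + 2 * of_nat (Suc i)) * A)"
      unfolding T T0_def using nz by (simp add: field_simps del: of_nat_Suc)
    have "- (4 * of_nat (Suc i) * e) * T0 + 2 * (1 / q * A)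
        + 1 / q * ((lam - N) * B + (lam - N + 2 * of_nat i) * A) = 0"
      unfolding mult_minus_left F using nz(1) by (simp add: field_simps)
    then show "2 * of_nat (Suc i) * (N - 2 * lam - 2 * of_nat (Suc i)) * tangential_solution N lam \<phi> (Suc i) y vs
        + 2 * ext_d UNIV (normal_solution N lam \<phi> (Suc i)) y vs
        + (if Suc i = 0 then 0 else flat_laplacian (tangential_solution N lam \<phi> (Suc i - 1)) y vs) = 0"
      unfolding c ext_d_normal_solution[OF \<phi>] T0_def[symmetric]
      using flat_laplacian_tangential_solution[OF \<phi> nz(1)[unfolded q_def], of y vs]
      unfolding A_def[symmetric] B_def[symmetric] q_def[symmetric] by simp
    define D where "D = flat_codiff UNIV (d_delta_power i \<phi>) y vs"
    have n: "normal_solution N lam \<phi> (Suc i) y vs = 1 / q * D"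
      unfolding normal_solution_def q_def D_def by simp
    have t: "flat_codiff UNIV (tangential_solution N lam \<phi> i) y vs = (lam - N + 2 * of_nat i) / q * D"
      using flat_codiff_tangential_solution[OF \<phi> nz(1)[unfolded q_def]] unfolding q_def D_def .
    have l: "flat_laplacian (normal_solution N lam \<phi> i) y vs = 4 * of_nat i * (lam - N / 2 + of_nat i) / q * D"
    proof (cases i)
      case 0
      then show ?thesis by (simp add: normal_solution_def)
    next
      case (Suc l)
      have q': "q = 4 * of_nat i * (lam - N / 2 + of_nat i) * recursion_denominator N l lam"
        unfolding q_def Suc by (rule recursion_denominator_Suc)
      have cancel: "c / (c * w) = 1 / w" if "c * w \<noteq> 0" for c w :: complex
        using that by simp
      have "4 * of_nat i * (lam - N / 2 + of_nat i) / q = 1 / recursion_denominator N l lam"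
        unfolding q' by (rule cancel[OF nz(1)[unfolded q']])
      then show ?thesis
        using flat_laplacian_normal_solution[OF \<phi>, of N lam l y vs] unfolding D_def Suc[symmetric] by simp
    qed
    show "(2 * of_nat (Suc i) * (N - 2 * lam - 2 * of_nat (Suc i)) + 2 * (lam + 2 * of_nat (Suc i)))
          * normal_solution N lam \<phi> (Suc i) y vs
        + (if Suc i = 0 then 0 else 2 * flat_codiff UNIV (tangential_solution N lam \<phi> (Suc i - 1)) y vs
            + flat_laplacian (normal_solution N lam \<phi> (Suc i - 1)) y vs) = 0"
      using nz(1) by (simp add: n t l field_simps)
  qed
qed

lemma recursion_unique:
  fixes u v :: "nat \<Rightarrow> 'a::euclidean_space form"
  assumes \<phi>: "\<phi> \<in> Omega UNIV k"
    and rec: "\<And>j. solves_recursion N lam u v j" and init: "u 0 = \<phi>" "v 0 = (\<lambda>y vs. 0)"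
    and q: "\<And>j. recursion_denominator N j lam \<noteq> 0"
    and r: "\<And>j. j \<ge> 1 \<Longrightarrow> 2 * of_nat j * (N - 2 * lam - 2 * of_nat j) + 2 * (lam + 2 * of_nat j) \<noteq> 0"
  shows "u j = tangential_solution N lam \<phi> j \<and> v j = normal_solution N lam \<phi> j"
proof (induction j)
  case 0
  then show ?case using init by (simp add: tangential_solution_def normal_solution_def)
next
  case (Suc j)
  let ?u = "tangential_solution N lam \<phi>" and ?v = "normal_solution N lam \<phi>"
  have sol: "solves_recursion N lam ?u ?v (Suc j)" by (rule solutions_solve_recursion[OF \<phi> q])
  have "(2 * of_nat (Suc j) * (N - 2 * lam - 2 * of_nat (Suc j)) + 2 * (lam + 2 * of_nat (Suc j))) * v (Suc j) y vs
      = (2 * of_nat (Suc j) * (N - 2 * lam - 2 * of_nat (Suc j)) + 2 * (lam + 2 * of_nat (Suc j))) * ?v (Suc j) y vs" for y vs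
    using rec[of "Suc j"] sol Suc unfolding solves_recursion_def by (metis add_right_cancel diff_Suc_1)
  then have v: "v (Suc j) = ?v (Suc j)"
    using r[of "Suc j"] by (intro ext) (metis le_add1 mult_left_cancel plus_1_eq_Suc)
  have "2 * of_nat (Suc j) * (N - 2 * lam - 2 * of_nat (Suc j)) \<noteq> 0"
  proof -
    have "lam - N / 2 + of_nat (Suc j) \<noteq> 0"
      using q[of "Suc j"] unfolding recursion_denominator_Suc by auto
    moreover have e: "N - 2 * lam - 2 * of_nat (Suc j) = - 2 * (lam - N / 2 + of_nat (Suc j))"
      by (simp add: algebra_simps)
    ultimately show ?thesis
      unfolding e mult_eq_0_iff using of_nat_neq_0[of j, where ?'a = complex] by (simp del: of_nat_Suc)
  qed
  moreover have "2 * of_nat (Suc j) * (N - 2 * lam - 2 * of_nat (Suc j)) * u (Suc j) y vs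
      = 2 * of_nat (Suc j) * (N - 2 * lam - 2 * of_nat (Suc j)) * ?u (Suc j) y vs" for y vs
    using rec[of "Suc j"] sol Suc v unfolding solves_recursion_def by (metis add_right_cancel diff_Suc_1)
  ultimately have "u (Suc j) = ?u (Suc j)"
    by (intro ext) (metis mult_left_cancel)
  then show ?case using v by blast
qed

section \<open>Natural differential operators\<close>

text \<open>The differential expressions of order at most \<open>r\<close>, evaluated at a point and at a fixed list of vectors.
  The inductive presentation makes closure under differentiation a short induction; the rule \<open>cong\<close>
  reflects that only the values on forms matter.\<close>

inductive differential_functional :: "int \<Rightarrow> nat \<Rightarrow> ('a::euclidean_space form \<Rightarrow> 'a \<Rightarrow> complex) \<Rightarrow> bool"
  for k where
  coeff: "smooth_on UNIV c \<Longrightarrow> us \<in> basis_lists (nat k) \<Longrightarrow> bs \<in> basis_lists m \<Longrightarrow> m \<le> r \<Longrightarrow>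
    differential_functional k r (\<lambda>w y. c y * iter_deriv bs (\<lambda>x. w x us) y)"
| zero: "differential_functional k r (\<lambda>w y. 0)"
| add: "differential_functional k r L \<Longrightarrow> differential_functional k r L' \<Longrightarrow>
    differential_functional k r (\<lambda>w y. L w y + L' w y)"
| cong: "differential_functional k r L \<Longrightarrow> (\<And>w y. w \<in> Omega UNIV k \<Longrightarrow> L' w y = L w y) \<Longrightarrow>
    differential_functional k r L'"

lemma differential_functional_sum:
  "(\<And>i. i \<in> I \<Longrightarrow> differential_functional k r (L i)) \<Longrightarrow> differential_functional k r (\<lambda>w y. \<Sum>i\<in>I. L i w y)"
  by (induction I rule: infinite_finite_induct)
    (auto intro: differential_functional.zero differential_functional.add)

lemma differential_functional_cmult:
  assumes "differential_functional k r L"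
  shows "differential_functional k r (\<lambda>w y. a * L w y)"
  using assms
proof induction
  case (coeff c us bs m r)
  have "differential_functional k r (\<lambda>w y. (a * c y) * iter_deriv bs (\<lambda>x. w x us) y)"
    using coeff by (intro differential_functional.coeff smooth_on_mult smooth_on_const open_UNIV) auto
  then show ?case by (simp add: mult.assoc)
next
  case (zero r)
  then show ?case by (simp add: differential_functional.zero)
next
  case (add r L L')
  then show ?case by (simp add: distrib_left differential_functional.add)
next
  case (cong r L L')
  show ?case by (rule differential_functional.cong[OF cong.IH]) (simp add: cong.hyps)
qed

lemma differential_functional_mono:
  "differential_functional k r L \<Longrightarrow> r \<le> r' \<Longrightarrow> differential_functional k r' L"
proof (induction rule: differential_functional.induct)
  case (coeff c us bs m r)
  then show ?case by (intro differential_functional.coeff[of c us k bs m]) auto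
next
  case (cong r L L')
  show ?case by (rule differential_functional.cong[OF cong.IH]) (use cong in auto)
qed (auto intro: differential_functional.zero differential_functional.add)

lemma smooth_on_iter_deriv: "smooth_on UNIV f \<Longrightarrow> smooth_on UNIV (iter_deriv bs f)"
  by (induction bs) (auto intro: smooth_on_pderiv)

lemma smooth_on_differential_functional:
  assumes "differential_functional k r L" and w: "w \<in> Omega UNIV k"
  shows "smooth_on UNIV (L w)"
  using assms(1)
proof induction
  case (coeff c us bs m r)
  show ?case by (intro smooth_on_mult open_UNIV coeff smooth_on_iter_deriv OmegaD_smooth[OF w])
next
  case (cong r L L')
  have "L' w = L w" using cong.hyps(2)[OF w] by (intro ext)
  then show ?case using cong.IH by simp
qed (auto intro: smooth_on_add)

lemma differential_functional_pderiv:
  fixes L :: "'a::euclidean_space form \<Rightarrow> 'a \<Rightarrow> complex"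
  assumes "differential_functional k r L"
  shows "differential_functional k (Suc r) (\<lambda>w y. \<partial> (L w) y v)"
  using assms
proof induction
  case (coeff c us bs m r)
  have bs: "b # bs \<in> basis_lists (Suc m)" if "b \<in> Basis" for b
    using coeff(3) that by (auto simp: basis_lists_Suc)
  have "differential_functional k (Suc r) (\<lambda>w y. (\<Sum>b\<in>Basis. of_real (v \<bullet> b) * (c y * iter_deriv (b # bs) (\<lambda>x. w x us) y))
      + \<partial> c y v * iter_deriv bs (\<lambda>x. w x us) y)"
    using coeff bs
    by (intro differential_functional.add differential_functional_sum differential_functional_cmult
        differential_functional.coeff[of _ _ _ _ "Suc m"] differential_functional.coeff[of _ _ _ _ m] smooth_on_pderiv) auto
  then show ?case
  proof (rule differential_functional.cong)
    fix w :: "'a form" and y assume w: "w \<in> Omega UNIV k"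
    have d: "iter_deriv bs (\<lambda>x. w x us) differentiable at y" "c differentiable at y"
      using smooth_onD_differentiable[OF smooth_on_iter_deriv[OF OmegaD_smooth[OF w]]]
        smooth_onD_differentiable[OF coeff(1)] by auto
    show "\<partial> (\<lambda>y. c y * iter_deriv bs (\<lambda>x. w x us) y) y v = (\<Sum>b\<in>Basis. of_real (v \<bullet> b) * (c y * iter_deriv (b # bs) (\<lambda>x. w x us) y))
      + \<partial> c y v * iter_deriv bs (\<lambda>x. w x us) y"
      unfolding pderiv_mult[OF d(2,1)] pderiv_basis_expansion[OF d(1), of v]
      by (simp add: sum_distrib_left mult.left_commute)
  qed
next
  case (zero r)
  then show ?case by (simp add: differential_functional.zero)
next
  case (add r L L')
  show ?case
  proof (rule differential_functional.cong[OF differential_functional.add[OF add.IH]])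
    fix w :: "'a form" and y assume w: "w \<in> Omega UNIV k"
    show "\<partial> (\<lambda>y. L w y + L' w y) y v = \<partial> (L w) y v + \<partial> (L' w) y v"
      using smooth_onD_differentiable[OF smooth_on_differential_functional[OF add.hyps(1) w]]
        smooth_onD_differentiable[OF smooth_on_differential_functional[OF add.hyps(2) w]]
      by (intro pderiv_add) auto
  qed
next
  case (cong r L L')
  show ?case
  proof (rule differential_functional.cong[OF cong.IH])
    fix w :: "'a form" and y assume "w \<in> Omega UNIV k"
    then have "L' w = L w" using cong.hyps(2) by (intro ext)
    then show "\<partial> (L' w) y v = \<partial> (L w) y v" by simp
  qed
qed

lemma differential_functional_representation:
  fixes L :: "'a::euclidean_space form \<Rightarrow> 'a \<Rightarrow> complex"
  assumes "differential_functional k r L"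
  shows "\<exists>c. (\<forall>us bs. smooth_on UNIV (c us bs)) \<and> (\<forall>w\<in>Omega UNIV k. \<forall>y. L w y =
    (\<Sum>us\<in>basis_lists (nat k). \<Sum>m\<le>r. \<Sum>bs\<in>basis_lists m. c us bs y * iter_deriv bs (\<lambda>x. w x us) y))"
  using assms
proof induction
  case (coeff c us bs m r)
  define c' where "c' us' bs' = (if us' = us \<and> bs' = bs then c else (\<lambda>y. 0))" for us' bs'
  have m: "bs \<in> basis_lists m' \<longleftrightarrow> m' = m" for m'
    using coeff(3) unfolding basis_lists_def by auto
  have "(\<Sum>us'\<in>basis_lists (nat k). \<Sum>m'\<le>r. \<Sum>bs'\<in>basis_lists m'. c' us' bs' y * iter_deriv bs' (\<lambda>x. w x us') y)
      = c y * iter_deriv bs (\<lambda>x. w x us) y" for w y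
  proof -
    have "(\<Sum>bs'\<in>basis_lists m'. c' us' bs' y * iter_deriv bs' (\<lambda>x. w x us') y)
        = (if m' = m then if us' = us then c y * iter_deriv bs (\<lambda>x. w x us) y else 0 else 0)" for us' m'
    proof -
      have "(\<Sum>bs'\<in>basis_lists m'. c' us' bs' y * iter_deriv bs' (\<lambda>x. w x us') y)
        = (\<Sum>bs'\<in>basis_lists m'. if bs' = bs then if us' = us then c y * iter_deriv bs (\<lambda>x. w x us) y else 0 else 0)"
        by (intro sum.cong) (auto simp: c'_def)
      then show ?thesis by (simp add: m)
    qed
    then show ?thesis using coeff(2,4) by simp
  qed
  moreover have "smooth_on UNIV (c' us' bs')" for us' bs'
    using coeff(1) by (simp add: c'_def)
  ultimately show ?case by (intro exI[of _ c']) simp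
next
  case (zero r)
  then show ?case by (intro exI[of _ "\<lambda>us bs y. 0"]) simp
next
  case (add r L L')
  let ?R = "\<lambda>L c. (\<forall>us bs. smooth_on UNIV (c us bs)) \<and> (\<forall>w\<in>Omega UNIV k. \<forall>y. L w y =
    (\<Sum>us\<in>basis_lists (nat k). \<Sum>m\<le>r. \<Sum>bs\<in>basis_lists m. c us bs y * iter_deriv bs (\<lambda>x. w x us) y))"
  obtain c where c: "?R L c" by (rule exE[OF add.IH(1)])
  obtain c' where c': "?R L' c'" by (rule exE[OF add.IH(2)])
  show ?case
  proof (intro exI[of _ "\<lambda>us bs y. c us bs y + c' us bs y"] conjI allI ballI)
    show "smooth_on UNIV (\<lambda>y. c us bs y + c' us bs y)" for us bs
      by (intro smooth_on_add open_UNIV conjunct1[OF c, rule_format] conjunct1[OF c', rule_format])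
    fix w :: "'a form" and y assume w: "w \<in> Omega UNIV k"
    show "L w y + L' w y = (\<Sum>us\<in>basis_lists (nat k). \<Sum>m\<le>r. \<Sum>bs\<in>basis_lists m.
        (c us bs y + c' us bs y) * iter_deriv bs (\<lambda>x. w x us) y)"
      unfolding conjunct2[OF c, rule_format, OF w] conjunct2[OF c', rule_format, OF w] distrib_right sum.distrib ..
  qed
next
  case (cong r L L')
  show ?case using cong.IH by (simp add: cong.hyps(2))
qed

text \<open>The coefficients may depend on the evaluated list of vectors but the order may not, hence the
  order of the quantifiers.\<close>

lemma differential_operator_iff:
  "differential_operator k l D \<longleftrightarrow> (\<forall>w\<in>Omega UNIV k. D w \<in> Omega UNIV l) \<and>
    (\<exists>r. \<forall>vs. differential_functional k r (\<lambda>w y. D w y vs))" (is "_ \<longleftrightarrow> ?R")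
proof
  assume D: "differential_operator k l D"
  then obtain r c where c: "\<And>vs us bs. smooth_on UNIV (c vs us bs)"
    and eq: "\<And>w y vs. w \<in> Omega UNIV k \<Longrightarrow> D w y vs =
           (\<Sum>us\<in>basis_lists (nat k). \<Sum>m\<le>r. \<Sum>bs\<in>basis_lists m. c vs us bs y * iter_deriv bs (\<lambda>x. w x us) y)"
    unfolding differential_operator_def by blast
  have "differential_functional k r (\<lambda>w y. \<Sum>us\<in>basis_lists (nat k). \<Sum>m\<le>r. \<Sum>bs\<in>basis_lists m.
      c vs us bs y * iter_deriv bs (\<lambda>x. w x us) y)" for vs
    by (intro differential_functional_sum differential_functional.coeff[OF c]) auto
  then have "differential_functional k r (\<lambda>w y. D w y vs)" for vs
    by (rule differential_functional.cong) (rule eq)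
  then show ?R using D unfolding differential_operator_def by blast
next
  assume R: ?R
  then obtain r where r: "\<And>vs. differential_functional k r (\<lambda>w y. D w y vs)" by blast
  have "\<exists>c. \<forall>vs. (\<forall>us bs. smooth_on UNIV (c vs us bs)) \<and> (\<forall>w\<in>Omega UNIV k. \<forall>y. D w y vs =
    (\<Sum>us\<in>basis_lists (nat k). \<Sum>m\<le>r. \<Sum>bs\<in>basis_lists m. c vs us bs y * iter_deriv bs (\<lambda>x. w x us) y))"
    by (rule choice) (intro allI differential_functional_representation r)
  then show "differential_operator k l D"
    using R unfolding differential_operator_def by blast
qed

lemma natural_operatorD_Omega: "natural_operator k l D \<Longrightarrow> w \<in> Omega UNIV k \<Longrightarrow> D w \<in> Omega UNIV l"
  unfolding natural_operator_def differential_operator_def by blast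

lemma natural_operatorI:
  assumes "\<And>w. w \<in> Omega UNIV k \<Longrightarrow> D w \<in> Omega UNIV l"
    and "\<And>vs. differential_functional k r (\<lambda>w y. D w y vs)"
    and "\<And>f w. (\<And>x y. dist (f x) (f y) = dist x y) \<Longrightarrow> w \<in> Omega UNIV k \<Longrightarrow> D (pullback f w) = pullback f (D w)"
  shows "natural_operator k l D"
  unfolding natural_operator_def differential_operator_iff using assms by blast

lemma natural_operatorD_functional:
  assumes "natural_operator k l D"
  obtains r where "\<And>vs. differential_functional k r (\<lambda>w y. D w y vs)"
  using assms unfolding natural_operator_def differential_operator_iff by blast

lemma natural_operatorD_pullback:
  "natural_operator k l D \<Longrightarrow> (\<And>x y. dist (f x) (f y) = dist x y) \<Longrightarrow> w \<in> Omega UNIV k \<Longrightarrow>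
    D (pullback f w) = pullback f (D w)"
  unfolding natural_operator_def by blast

lemma natural_id: "natural_operator k k (\<lambda>w. w)"
proof (rule natural_operatorI[where r = 0])
  fix vs :: "'a list"
  show "differential_functional k 0 (\<lambda>w y. w y vs)"
  proof (cases "int (length vs) = k")
    case True
    have "differential_functional k 0
        (\<lambda>w y. \<Sum>us\<in>basis_lists (nat k). of_real (basis_coeff vs us) * iter_deriv [] (\<lambda>x. w x us) y)"
      by (intro differential_functional_sum differential_functional.coeff[where m = 0] smooth_on_const) auto
    then show ?thesis
    proof (rule differential_functional.cong)
      fix w :: "'a form" and y assume w: "w \<in> Omega UNIV k"
      have "nat k = length vs" using True by simp
      then show "w y vs = (\<Sum>us\<in>basis_lists (nat k). of_real (basis_coeff vs us) * iter_deriv [] (\<lambda>x. w x us) y)"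
        using alternating_basis_expansion[OF OmegaD_alternating[OF w], of y vs] by simp
    qed
  next
    case False
    show ?thesis
      by (rule differential_functional.cong[OF differential_functional.zero]) (rule OmegaD_length[OF _ False])
  qed
qed auto

lemma natural_zero: "natural_operator k l (\<lambda>w x vs. 0)"
  by (rule natural_operatorI[where r = 0])
    (auto simp: Omega_zero pullback_def intro: differential_functional.zero)

lemma natural_cmult:
  assumes D: "natural_operator k l D"
  shows "natural_operator k l (\<lambda>w x vs. a * D w x vs)"
proof -
  obtain r where r: "\<And>vs. differential_functional k r (\<lambda>w y. D w y vs)"
    by (rule natural_operatorD_functional[OF D]) (rule that)
  note e = natural_operatorD_pullback[OF D]
  show ?thesis
    by (rule natural_operatorI[where r = r])
      (auto simp: e pullback_def[of _ "\<lambda>x vs. a * _ x vs"] pullback_def[of _ "D _"]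
        intro!: Omega_cmult natural_operatorD_Omega[OF D] differential_functional_cmult r)
qed

lemma natural_add:
  assumes D: "natural_operator k l D" and D': "natural_operator k l D'"
  shows "natural_operator k l (\<lambda>w x vs. D w x vs + D' w x vs)"
proof -
  obtain r where r: "\<And>vs. differential_functional k r (\<lambda>w y. D w y vs)"
    by (rule natural_operatorD_functional[OF D]) (rule that)
  note e = natural_operatorD_pullback[OF D]
  obtain r' where r': "\<And>vs. differential_functional k r' (\<lambda>w y. D' w y vs)"
    by (rule natural_operatorD_functional[OF D']) (rule that)
  note e' = natural_operatorD_pullback[OF D']
  show ?thesis
  proof (rule natural_operatorI[where r = "max r r'"])
    show "differential_functional k (max r r') (\<lambda>w y. D w y vs + D' w y vs)" for vs
      by (intro differential_functional.add differential_functional_mono[OF r] differential_functional_mono[OF r']) auto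
  next
    fix f :: "'a \<Rightarrow> 'a" and w :: "'a form"
    assume f: "\<And>x y. dist (f x) (f y) = dist x y" and w: "w \<in> Omega UNIV k"
    show "(\<lambda>x vs. D (pullback f w) x vs + D' (pullback f w) x vs) = pullback f (\<lambda>x vs. D w x vs + D' w x vs)"
      unfolding e[OF f w] e'[OF f w] unfolding pullback_def ..
  qed (auto intro!: Omega_add natural_operatorD_Omega[OF D] natural_operatorD_Omega[OF D'])
qed

lemma natural_sum:
  "(\<And>i. i \<in> I \<Longrightarrow> natural_operator k l (D i)) \<Longrightarrow> natural_operator k l (\<lambda>w x vs. \<Sum>i\<in>I. D i w x vs)"
  by (induction I rule: infinite_finite_induct) (auto intro: natural_zero natural_add)

subsection \<open>Equivariance\<close>

lemma isometry_affine:
  fixes f :: "'a::euclidean_space \<Rightarrow> 'a"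
  assumes "\<And>x y. dist (f x) (f y) = dist x y"
  obtains A c where "orthogonal_transformation A" "f = (\<lambda>x. A x + c)" "\<And>x. frechet_derivative f (at x) = A"
proof -
  define A where "A x = f x - f 0" for x
  have A: "orthogonal_transformation A"
    unfolding orthogonal_transformation_isometry A_def using assms by (simp add: dist_norm)
  have f: "f = (\<lambda>x. A x + f 0)" unfolding A_def by simp
  have "(f has_derivative A) (at x)" for x
    using linear_imp_has_derivative[OF orthogonal_transformation_linear[OF A]] has_derivative_add_const f by metis
  then show thesis using that[OF A f] frechet_derivative_at by metis
qed

text \<open>The trace of a bilinear form is the same in every orthonormal basis; this is why the codifferential is
  equivariant.\<close>

lemma trace_orthogonal:
  fixes B :: "'a::euclidean_space \<Rightarrow> 'a \<Rightarrow> complex" and A :: "'a \<Rightarrow> 'a"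
  assumes A: "orthogonal_transformation A"
    and B: "\<And>v. linear (\<lambda>u. B u v)" "\<And>u. linear (B u)"
  shows "(\<Sum>b\<in>Basis. B (A b) (A b)) = (\<Sum>b\<in>Basis. B b b)"
proof -
  have expand: "B u v = (\<Sum>c\<in>Basis. \<Sum>d\<in>Basis. of_real ((u \<bullet> c) * (v \<bullet> d)) * B c d)" for u v
  proof -
    have "B u v = B (\<Sum>c\<in>Basis. (u \<bullet> c) *\<^sub>R c) v" by (simp add: euclidean_representation)
    also have "\<dots> = (\<Sum>c\<in>Basis. of_real (u \<bullet> c) * B c v)"
      by (simp only: linear_sum[OF B(1)] linear_scale[OF B(1)] scaleR_conv_of_real)
    also have "\<dots> = (\<Sum>c\<in>Basis. of_real (u \<bullet> c) * B c (\<Sum>d\<in>Basis. (v \<bullet> d) *\<^sub>R d))"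
      by (simp add: euclidean_representation)
    also have "\<dots> = (\<Sum>c\<in>Basis. \<Sum>d\<in>Basis. of_real ((u \<bullet> c) * (v \<bullet> d)) * B c d)"
      by (simp only: linear_sum[OF B(2)] linear_scale[OF B(2)] scaleR_conv_of_real sum_distrib_left mult.assoc of_real_mult)
    finally show ?thesis .
  qed
  have gram: "(\<Sum>b\<in>Basis. (A b \<bullet> c) * (A b \<bullet> d)) = c \<bullet> d" for c d
  proof -
    have inner: "A x \<bullet> A y = x \<bullet> y" for x y using A by (simp add: orthogonal_transformation_def)
    have "surj A" by (rule orthogonal_transformation_surj[OF A])
    then obtain c' d' where cd: "c = A c'" "d = A d'" by (metis surjD)
    show ?thesis unfolding cd inner by (simp add: euclidean_inner[of c' d'] inner_commute)
  qed
  have "(\<Sum>b\<in>Basis. B (A b) (A b))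
      = (\<Sum>b\<in>Basis. \<Sum>c\<in>Basis. \<Sum>d\<in>Basis. of_real ((A b \<bullet> c) * (A b \<bullet> d)) * B c d)"
    by (intro sum.cong refl expand)
  also have "\<dots> = (\<Sum>c\<in>Basis. \<Sum>d\<in>Basis. \<Sum>b\<in>Basis. of_real ((A b \<bullet> c) * (A b \<bullet> d)) * B c d)"
    by (subst sum.swap) (intro sum.cong refl sum.swap)
  also have "\<dots> = (\<Sum>c\<in>Basis. \<Sum>d\<in>Basis. of_real (c \<bullet> d) * B c d)"
    by (simp only: sum_distrib_right[symmetric] of_real_sum[symmetric] gram)
  also have "\<dots> = (\<Sum>c\<in>Basis. B c c)"
  proof (intro sum.cong refl)
    fix c :: 'a assume "c \<in> Basis"
    then have "(\<Sum>d\<in>Basis. of_real (c \<bullet> d) * B c d) = (\<Sum>d\<in>Basis. if d = c then B c c else 0)"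
      by (intro sum.cong) (auto simp: inner_Basis)
    then show "(\<Sum>d\<in>Basis. of_real (c \<bullet> d) * B c d) = B c c" using \<open>c \<in> Basis\<close> by simp
  qed
  finally show ?thesis .
qed

lemma pullback_isometry:
  fixes f :: "'a::euclidean_space \<Rightarrow> 'a"
  assumes f: "\<And>x y. dist (f x) (f y) = dist x y" and w: "w \<in> Omega UNIV k"
  shows ext_d_pullback: "ext_d UNIV (pullback f w) = pullback f (ext_d UNIV w)"
    and flat_codiff_pullback: "flat_codiff UNIV (pullback f w) = pullback f (flat_codiff UNIV w)"
proof -
  obtain A c where A: "orthogonal_transformation A" and fA: "f = (\<lambda>x. A x + c)"
    and df: "\<And>x. frechet_derivative f (at x) = A"
    by (rule isometry_affine[OF f]) (rule that)
  have pb: "pullback f w' x vs = w' (A x + c) (map A vs)" for w' x vs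
    unfolding pullback_def df using fA by simp
  have d: "\<partial> (\<lambda>x. w (A x + c) us) x v = \<partial> (\<lambda>y. w y us) (A x + c) (A v)" for us x v
    by (rule smooth_on_compose_affine(2)[OF open_UNIV orthogonal_transformation_linear[OF A] OmegaD_smooth[OF w]]) auto
  show "ext_d UNIV (pullback f w) = pullback f (ext_d UNIV w)"
    by (intro ext) (simp add: pb ext_d_alternate d alternate_map)
  show "flat_codiff UNIV (pullback f w) = pullback f (flat_codiff UNIV w)"
  proof (intro ext)
    fix x vs
    define B where "B u v = \<partial> (\<lambda>y. w y (v # map A vs)) (A x + c) u" for u v
    have "(\<Sum>b\<in>Basis. B (A b) (A b)) = (\<Sum>b\<in>Basis. B b b)"
    proof (rule trace_orthogonal[OF A, of B])
      show "linear (\<lambda>u. B u v)" for v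
        unfolding B_def by (rule pderiv_linear[OF OmegaD_differentiable[OF w UNIV_I]])
      show "linear (B u)" for u
        unfolding B_def[abs_def] using alternatingD_linear[OF alternating_pderiv[OF w UNIV_I], of "[]"] by simp
    qed
    then show "flat_codiff UNIV (pullback f w) x vs = pullback f (flat_codiff UNIV w) x vs"
      by (simp add: pb flat_codiff_def d B_def)
  qed
qed

lemma natural_ext_d:
  assumes D: "natural_operator k l D"
  shows "natural_operator k (l + 1) (\<lambda>w. ext_d UNIV (D w))"
proof -
  obtain r where r: "\<And>vs. differential_functional k r (\<lambda>w y. D w y vs)"
    by (rule natural_operatorD_functional[OF D]) (rule that)
  note e = natural_operatorD_pullback[OF D]
  show ?thesis
  proof (rule natural_operatorI[where r = "Suc r"])
    fix vs
    have "differential_functional k (Suc r)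
        (\<lambda>w y. \<Sum>i<length vs. (-1) ^ i * \<partial> (\<lambda>y. D w y (remove_nth i vs)) y (vs ! i))"
      by (intro differential_functional_sum differential_functional_cmult differential_functional_pderiv r)
    then show "differential_functional k (Suc r) (\<lambda>w y. ext_d UNIV (D w) y vs)"
      by (simp add: ext_d_def)
  next
    fix f :: "'a \<Rightarrow> 'a" and w :: "'a form"
    assume f: "\<And>x y. dist (f x) (f y) = dist x y" and w: "w \<in> Omega UNIV k"
    show "ext_d UNIV (D (pullback f w)) = pullback f (ext_d UNIV (D w))"
      unfolding e[OF f w] by (rule ext_d_pullback[OF f natural_operatorD_Omega[OF D w]])
  qed (auto simp: natural_operatorD_Omega[OF D] intro!: ext_d_Omega)
qed

lemma natural_flat_codiff:
  assumes D: "natural_operator k l D"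
  shows "natural_operator k (l - 1) (\<lambda>w. flat_codiff UNIV (D w))"
proof -
  obtain r where r: "\<And>vs. differential_functional k r (\<lambda>w y. D w y vs)"
    by (rule natural_operatorD_functional[OF D]) (rule that)
  note e = natural_operatorD_pullback[OF D]
  show ?thesis
  proof (rule natural_operatorI[where r = "Suc r"])
    fix vs
    have "differential_functional k (Suc r) (\<lambda>w y. (-1) * (\<Sum>b\<in>Basis. \<partial> (\<lambda>y. D w y (b # vs)) y b))"
      by (intro differential_functional_sum differential_functional_cmult differential_functional_pderiv r)
    then show "differential_functional k (Suc r) (\<lambda>w y. flat_codiff UNIV (D w) y vs)"
      by (simp add: flat_codiff_def)
  next
    fix f :: "'a \<Rightarrow> 'a" and w :: "'a form"
    assume f: "\<And>x y. dist (f x) (f y) = dist x y" and w: "w \<in> Omega UNIV k"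
    show "flat_codiff UNIV (D (pullback f w)) = pullback f (flat_codiff UNIV (D w))"
      unfolding e[OF f w] by (rule flat_codiff_pullback[OF f natural_operatorD_Omega[OF D w]])
  qed (auto simp: natural_operatorD_Omega[OF D] intro!: flat_codiff_Omega)
qed

lemma natural_d_delta_power: "natural_operator k k (d_delta_power j)"
proof (induction j)
  case 0
  then show ?case using natural_id by (simp add: id_def)
next
  case (Suc j)
  then show ?case using natural_ext_d[OF natural_flat_codiff[OF Suc]] by (simp add: o_def)
qed

lemma natural_delta_d_power: "natural_operator k k (delta_d_power j)"
proof (induction j)
  case 0
  then show ?case using natural_id by (simp add: id_def)
next
  case (Suc j)
  then show ?case using natural_flat_codiff[OF natural_ext_d[OF Suc]] by (simp add: o_def)
qed

section \<open>Rational families\<close>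

text \<open>Balls are uncountable, so identities between functions continuous at a point extend from the
  complement of a countable set to that point.\<close>

lemma isCont_eq_0_if_countable:
  fixes f :: "complex \<Rightarrow> complex"
  assumes "isCont f x" "countable {z. f z \<noteq> 0}"
  shows "f x = 0"
proof (rule ccontr)
  assume ne: "f x \<noteq> 0"
  then have "\<forall>\<^sub>F z in nhds x. f z \<noteq> 0"
    using assms(1) tendsto_imp_eventually_ne[of f "f x" "at x" 0]
    by (simp add: isCont_def eventually_nhds_conv_at)
  then obtain e where "e > 0" "\<And>z. dist z x < e \<Longrightarrow> f z \<noteq> 0"
    unfolding eventually_nhds_metric by blast
  then have "ball x e \<subseteq> {z. f z \<noteq> 0}" by (auto simp: dist_commute)
  then have "countable (ball x e)" using assms(2) countable_subset by blast
  then show False using uncountable_ball[OF \<open>e > 0\<close>] by blast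
qed

definition operator_polynomial :: "nat \<Rightarrow> (nat \<Rightarrow> 'a form \<Rightarrow> 'a form) \<Rightarrow> complex \<Rightarrow> 'a form \<Rightarrow> 'a form" where
  "operator_polynomial m N lam w = (\<lambda>y vs. \<Sum>i\<le>m. lam ^ i * N i w y vs)"

text \<open>At a common zero \<open>a\<close> of numerator and denominator both are divisible by \<open>\<lambda> - a\<close>.  The
  coefficients of the quotient of the numerator are linear combinations of the old ones, so they are natural operators
  again, and the degree of the denominator drops.\<close>

lemma lowest_terms:
  assumes "Q \<noteq> 0" "\<And>i. natural_operator k l (N i)"
  obtains Q' m' N' where "Q' \<noteq> 0" "\<And>i. natural_operator k l (N' i)"
    "\<And>lam. poly Q' lam = 0 \<Longrightarrow> \<exists>w\<in>Omega UNIV k. \<exists>y vs. operator_polynomial m' N' lam w y vs \<noteq> 0"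
    "\<And>lam. poly Q lam \<noteq> 0 \<Longrightarrow> poly Q' lam \<noteq> 0 \<and> (\<forall>w\<in>Omega UNIV k. \<forall>y vs.
       operator_polynomial m' N' lam w y vs / poly Q' lam = operator_polynomial m N lam w y vs / poly Q lam)"
  using assms
proof (induction "degree Q" arbitrary: Q N m thesis rule: less_induct)
  case less
  show ?case
  proof (cases "\<forall>lam. poly Q lam = 0 \<longrightarrow> (\<exists>w\<in>Omega UNIV k. \<exists>y vs. operator_polynomial m N lam w y vs \<noteq> 0)")
    case True
    then show ?thesis by (intro less.prems(1)[of Q N m] less.prems(2,3)) auto
  next
    case False
    then obtain a where a: "poly Q a = 0" and Na: "\<And>w y vs. w \<in> Omega UNIV k \<Longrightarrow> operator_polynomial m N a w y vs = 0"
      by blast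
    obtain Q1 where Q1: "Q = [:- a, 1:] * Q1" using a by (auto simp: poly_eq_0_iff_dvd dvd_def)
    have nz: "Q1 \<noteq> 0" using Q1 less.prems(2) by auto
    then have deg: "degree Q1 < degree Q" unfolding Q1 by (subst degree_mult_eq) auto
    \<comment> \<open>The coefficients of the quotient by \<open>\<lambda> - a\<close>, as in synthetic division.\<close>
    define N1 where "N1 j = (\<lambda>w y vs. \<Sum>i = Suc j..m. a ^ (i - j - 1) * N i w y vs)" for j
    have nat1: "natural_operator k l (N1 j)" for j
      unfolding N1_def by (intro natural_sum natural_cmult less.prems(3))
    have factor: "operator_polynomial m N lam w y vs = (lam - a) * operator_polynomial m N1 lam w y vs"
      if w: "w \<in> Omega UNIV k" for lam w y vs
    proof (cases "m = 0")
      case True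
      then show ?thesis using Na[OF w, of y vs] by (simp add: operator_polynomial_def N1_def)
    next
      case False
      then have "1 \<le> m" by simp
      have "operator_polynomial m N lam w y vs
          = (\<Sum>i\<le>m. N i w y vs * lam ^ i) - (\<Sum>i\<le>m. N i w y vs * a ^ i)"
        using Na[OF w, of y vs] unfolding operator_polynomial_def by (simp add: mult.commute)
      also have "\<dots> = (lam - a) * (\<Sum>j<m. (\<Sum>i = Suc j..m. N i w y vs * a ^ (i - j - 1)) * lam ^ j)"
        by (rule polyfun_diff[OF \<open>1 \<le> m\<close>])
      also have "(\<Sum>j<m. (\<Sum>i = Suc j..m. N i w y vs * a ^ (i - j - 1)) * lam ^ j) = operator_polynomial m N1 lam w y vs"
        unfolding operator_polynomial_def N1_def lessThan_Suc_atMost[symmetric] sum.lessThan_Suc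
        by (simp add: mult.commute)
      finally show ?thesis .
    qed
    obtain Q' m' N' where *: "Q' \<noteq> 0" "\<And>i. natural_operator k l (N' i)"
      "\<And>lam. poly Q' lam = 0 \<Longrightarrow> \<exists>w\<in>Omega UNIV k. \<exists>y vs. operator_polynomial m' N' lam w y vs \<noteq> 0"
      "\<And>lam. poly Q1 lam \<noteq> 0 \<Longrightarrow> poly Q' lam \<noteq> 0 \<and> (\<forall>w\<in>Omega UNIV k. \<forall>y vs.
         operator_polynomial m' N' lam w y vs / poly Q' lam = operator_polynomial m N1 lam w y vs / poly Q1 lam)"
      by (rule less.hyps[OF deg _ nz nat1, of m]) (rule that)
    show ?thesis
    proof (rule less.prems(1)[OF *(1,2,3)])
      fix lam assume "poly Q lam \<noteq> 0"
      then have "poly Q1 lam \<noteq> 0" "lam - a \<noteq> 0" "poly Q lam = (lam - a) * poly Q1 lam"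
        unfolding Q1 by (auto simp: left_diff_distrib)
      then show "poly Q' lam \<noteq> 0 \<and> (\<forall>w\<in>Omega UNIV k. \<forall>y vs.
         operator_polynomial m' N' lam w y vs / poly Q' lam = operator_polynomial m N lam w y vs / poly Q lam)"
        using *(4)[of lam] factor by simp
    qed
  qed
qed

lemma rational_family_exists:
  assumes "Q \<noteq> 0" "\<And>i. natural_operator k l (N i)"
  shows "\<exists>Q' T. rational_family k l Q' T \<and> (\<forall>lam. poly Q lam \<noteq> 0 \<longrightarrow> poly Q' lam \<noteq> 0 \<and>
    (\<forall>w\<in>Omega UNIV k. T lam w = (\<lambda>y vs. operator_polynomial m N lam w y vs / poly Q lam)))"
proof -
  obtain Q' m' N' where *: "Q' \<noteq> 0" "\<And>i. natural_operator k l (N' i)"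
    "\<And>lam. poly Q' lam = 0 \<Longrightarrow> \<exists>w\<in>Omega UNIV k. \<exists>y vs. operator_polynomial m' N' lam w y vs \<noteq> 0"
    "\<And>lam. poly Q lam \<noteq> 0 \<Longrightarrow> poly Q' lam \<noteq> 0 \<and> (\<forall>w\<in>Omega UNIV k. \<forall>y vs.
       operator_polynomial m' N' lam w y vs / poly Q' lam = operator_polynomial m N lam w y vs / poly Q lam)"
    by (rule lowest_terms[OF assms, of m]) (rule that)
  define T where "T lam w = (\<lambda>y vs. operator_polynomial m' N' lam w y vs / poly Q' lam)" for lam w
  have "rational_family k l Q' T"
    unfolding rational_family_def using *(1,2,3) unfolding T_def operator_polynomial_def by blast
  moreover have "\<forall>lam. poly Q lam \<noteq> 0 \<longrightarrow> poly Q' lam \<noteq> 0 \<and>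
    (\<forall>w\<in>Omega UNIV k. T lam w = (\<lambda>y vs. operator_polynomial m N lam w y vs / poly Q lam))"
    unfolding T_def using *(4) by (simp add: fun_eq_iff)
  ultimately show ?thesis by blast
qed

lemma rational_familyE:
  assumes "rational_family k l Q T"
  obtains m N where "Q \<noteq> 0" "\<And>i. i \<le> m \<Longrightarrow> natural_operator k l (N i)"
    "\<And>lam. poly Q lam = 0 \<Longrightarrow> \<exists>w\<in>Omega UNIV k. \<exists>y vs. operator_polynomial m N lam w y vs \<noteq> 0"
    "\<And>lam w. poly Q lam \<noteq> 0 \<Longrightarrow> w \<in> Omega UNIV k \<Longrightarrow> T lam w = (\<lambda>y vs. operator_polynomial m N lam w y vs / poly Q lam)"
  using assms unfolding rational_family_def operator_polynomial_def by blast

lemma rational_family_nonzero: "rational_family k l Q T \<Longrightarrow> Q \<noteq> 0"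
  unfolding rational_family_def by (rule conjunct1)

lemma rational_family_Omega:
  assumes "rational_family k l Q T" "poly Q lam \<noteq> 0" "w \<in> Omega UNIV k"
  shows "T lam w \<in> Omega UNIV l"
proof -
  obtain m N where N: "\<And>i. i \<le> m \<Longrightarrow> natural_operator k l (N i)"
    and T: "T lam w = (\<lambda>y vs. operator_polynomial m N lam w y vs / poly Q lam)"
    using rational_familyE[OF assms(1)] assms(2,3) by metis
  have "(\<lambda>y vs. 1 / poly Q lam * (\<Sum>i\<le>m. lam ^ i * N i w y vs)) \<in> Omega UNIV l"
    by (intro Omega_cmult Omega_sum open_UNIV natural_operatorD_Omega[OF N assms(3)]) auto
  then show ?thesis unfolding T operator_polynomial_def by simp
qed

text \<open>A family that generically equals a quotient \<open>G / q\<close> is regular wherever \<open>q\<close> does not vanish: the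
  cross-multiplied identity holds everywhere, and a zero of \<open>Q\<close> that is no zero of \<open>q\<close> would be a zero of the
  numerator.\<close>

lemma rational_family_regular:
  assumes T: "rational_family k l Q T"
    and gen: "countable {lam. \<not> P lam}"
      "\<And>lam w. P lam \<Longrightarrow> w \<in> Omega UNIV k \<Longrightarrow> poly Q lam \<noteq> 0 \<and> q lam \<noteq> 0 \<and> T lam w = (\<lambda>y vs. G lam w y vs / q lam)"
    and cont: "continuous_on UNIV q" "\<And>w y vs. continuous_on UNIV (\<lambda>lam. G lam w y vs)"
    and lam0: "q lam0 \<noteq> 0"
  shows "poly Q lam0 \<noteq> 0" "w \<in> Omega UNIV k \<Longrightarrow> T lam0 w = (\<lambda>y vs. G lam0 w y vs / q lam0)"
proof -
  obtain m N where Q: "Q \<noteq> 0" and low: "\<And>lam. poly Q lam = 0 \<Longrightarrow> \<exists>w\<in>Omega UNIV k. \<exists>y vs. operator_polynomial m N lam w y vs \<noteq> 0"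
    and TN: "\<And>lam w. poly Q lam \<noteq> 0 \<Longrightarrow> w \<in> Omega UNIV k \<Longrightarrow> T lam w = (\<lambda>y vs. operator_polynomial m N lam w y vs / poly Q lam)"
    by (rule rational_familyE[OF T]) (rule that)
  have key: "operator_polynomial m N lam w y vs * q lam = G lam w y vs * poly Q lam"
    if w: "w \<in> Omega UNIV k" for lam w y vs
  proof -
    define f where "f z = operator_polynomial m N z w y vs * q z - G z w y vs * poly Q z" for z
    have "continuous_on UNIV f"
      unfolding f_def operator_polynomial_def by (intro continuous_intros cont)
    moreover have "f z = 0" if P: "P z" for z
    proof -
      have 1: "poly Q z \<noteq> 0" "q z \<noteq> 0" "T z w = (\<lambda>y vs. G z w y vs / q z)" using gen(2)[OF P w] by auto
      have "operator_polynomial m N z w y vs / poly Q z = G z w y vs / q z"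
        using TN[OF 1(1) w] 1(3) by metis
      then show ?thesis using 1(1,2) unfolding f_def by (simp add: field_simps)
    qed
    then have "countable {z. f z \<noteq> 0}"
      by (intro countable_subset[OF _ gen(1)]) auto
    ultimately have "f lam = 0"
      by (intro isCont_eq_0_if_countable) (auto simp: continuous_on_eq_continuous_at)
    then show ?thesis unfolding f_def by simp
  qed
  show nz: "poly Q lam0 \<noteq> 0"
  proof
    assume z: "poly Q lam0 = 0"
    then obtain w y vs where "w \<in> Omega UNIV k" "operator_polynomial m N lam0 w y vs \<noteq> 0" using low by blast
    then show False using key[of w lam0 y vs] z lam0 by simp
  qed
  show "T lam0 w = (\<lambda>y vs. G lam0 w y vs / q lam0)" if w: "w \<in> Omega UNIV k"
    unfolding TN[OF nz w] using key[OF w] nz lam0 by (simp add: fun_eq_iff field_simps)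
qed

text \<open>Functionals through which continuity in the parameter passes from a family to its
  derivatives.\<close>

definition linear_functional_on_forms :: "int \<Rightarrow> ('a::euclidean_space form \<Rightarrow> complex) \<Rightarrow> bool" where
  "linear_functional_on_forms l X \<longleftrightarrow>
     (\<forall>w\<in>Omega UNIV l. \<forall>w'\<in>Omega UNIV l. X (\<lambda>y vs. w y vs + w' y vs) = X w + X w') \<and>
     (\<forall>c. \<forall>w\<in>Omega UNIV l. X (\<lambda>y vs. c * w y vs) = c * X w)"

lemma linear_functional_add:
  "linear_functional_on_forms l X \<Longrightarrow> w \<in> Omega UNIV l \<Longrightarrow> w' \<in> Omega UNIV l \<Longrightarrow>
    X (\<lambda>y vs. w y vs + w' y vs) = X w + X w'"
  unfolding linear_functional_on_forms_def by (drule conjunct1) (drule (1) bspec, drule (1) bspec, assumption)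

lemma linear_functional_cmult:
  "linear_functional_on_forms l X \<Longrightarrow> w \<in> Omega UNIV l \<Longrightarrow> X (\<lambda>y vs. c * w y vs) = c * X w"
  unfolding linear_functional_on_forms_def by (drule conjunct2) (drule spec, drule (1) bspec, assumption)

lemma linear_functional_sum:
  assumes X: "linear_functional_on_forms l X" and w: "\<And>i. i \<in> I \<Longrightarrow> w i \<in> Omega UNIV l"
  shows "X (\<lambda>y vs. \<Sum>i\<in>I. c i * w i y vs) = (\<Sum>i\<in>I. c i * X (w i))"
proof -
  have zero: "X (\<lambda>y vs. 0) = 0" using linear_functional_cmult[OF X Omega_zero, of 0] by simp
  show ?thesis using w
  proof (induction I rule: infinite_finite_induct)
    case (insert i I)
    have "X (\<lambda>y vs. c i * w i y vs + (\<Sum>i\<in>I. c i * w i y vs))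
        = X (\<lambda>y vs. c i * w i y vs) + X (\<lambda>y vs. \<Sum>i\<in>I. c i * w i y vs)"
      by (intro linear_functional_add[OF X] Omega_cmult Omega_sum open_UNIV insert.prems) simp_all
    then show ?case using insert linear_functional_cmult[OF X, of "w i" "c i"] by simp
  qed (simp_all add: zero)
qed

lemma linear_functional_eval: "linear_functional_on_forms l (\<lambda>w. w y vs)"
  unfolding linear_functional_on_forms_def by simp

lemma linear_functional_ext_d:
  assumes X: "linear_functional_on_forms (l + 1) X"
  shows "linear_functional_on_forms l (\<lambda>w. X (ext_d UNIV w))"
  unfolding linear_functional_on_forms_def
proof (intro conjI ballI allI)
  fix w w' :: "'a form" assume w: "w \<in> Omega UNIV l" and w': "w' \<in> Omega UNIV l"
  show "X (ext_d UNIV (\<lambda>y vs. w y vs + w' y vs)) = X (ext_d UNIV w) + X (ext_d UNIV w')"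
    unfolding ext_d_add[OF w w'] by (intro linear_functional_add[OF X] ext_d_Omega open_UNIV w w')
next
  fix w :: "'a form" and c assume w: "w \<in> Omega UNIV l"
  show "X (ext_d UNIV (\<lambda>y vs. c * w y vs)) = c * X (ext_d UNIV w)"
    unfolding ext_d_cmult[OF w] by (intro linear_functional_cmult[OF X] ext_d_Omega open_UNIV w)
qed

lemma linear_functional_flat_codiff:
  assumes X: "linear_functional_on_forms (l - 1) X"
  shows "linear_functional_on_forms l (\<lambda>w. X (flat_codiff UNIV w))"
  unfolding linear_functional_on_forms_def
proof (intro conjI ballI allI)
  fix w w' :: "'a form" assume w: "w \<in> Omega UNIV l" and w': "w' \<in> Omega UNIV l"
  show "X (flat_codiff UNIV (\<lambda>y vs. w y vs + w' y vs)) = X (flat_codiff UNIV w) + X (flat_codiff UNIV w')"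
    unfolding flat_codiff_add[OF w w'] by (intro linear_functional_add[OF X] flat_codiff_Omega open_UNIV w w')
next
  fix w :: "'a form" and c assume w: "w \<in> Omega UNIV l"
  show "X (flat_codiff UNIV (\<lambda>y vs. c * w y vs)) = c * X (flat_codiff UNIV w)"
    unfolding flat_codiff_cmult[OF w] by (intro linear_functional_cmult[OF X] flat_codiff_Omega open_UNIV w)
qed

lemma isCont_rational_family:
  assumes T: "rational_family k l Q T" and Q: "poly Q lam \<noteq> 0" and w: "w \<in> Omega UNIV k"
    and X: "linear_functional_on_forms l X"
  shows "isCont (\<lambda>z. X (T z w)) lam"
proof -
  obtain m N where N: "\<And>i. i \<le> m \<Longrightarrow> natural_operator k l (N i)"
    and TN: "\<And>lam w. poly Q lam \<noteq> 0 \<Longrightarrow> w \<in> Omega UNIV k \<Longrightarrow> T lam w = (\<lambda>y vs. operator_polynomial m N lam w y vs / poly Q lam)"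
    by (rule rational_familyE[OF T]) (rule that)
  have eq: "X (T z w) = (\<Sum>i\<le>m. z ^ i / poly Q z * X (N i w))" if "poly Q z \<noteq> 0" for z
  proof -
    have Tz: "T z w = (\<lambda>y vs. \<Sum>i\<le>m. z ^ i / poly Q z * N i w y vs)"
      unfolding TN[OF that w] operator_polynomial_def by (simp add: sum_divide_distrib)
    show ?thesis unfolding Tz
      by (rule linear_functional_sum[OF X]) (simp add: natural_operatorD_Omega[OF N w])
  qed
  have "open {z. poly Q z \<noteq> 0}" by (intro open_Collect_neq continuous_intros)
  then have "\<forall>\<^sub>F z in nhds lam. poly Q z \<noteq> 0" using Q by (intro eventually_nhds_in_open[of "{z. poly Q z \<noteq> 0}", simplified]) auto
  then have ev: "\<forall>\<^sub>F z in nhds lam. X (T z w) = (\<Sum>i\<le>m. z ^ i / poly Q z * X (N i w))"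
    by eventually_elim (rule eq)
  have "isCont (\<lambda>z. \<Sum>i\<le>m. z ^ i / poly Q z * X (N i w)) lam"
    using Q by (intro continuous_intros) auto
  then show ?thesis using isCont_cong[OF ev] by blast
qed

section \<open>The solution operators\<close>

lemma recursion_denominator_poly:
  obtains Q where "Q \<noteq> 0" "\<And>lam. poly Q lam = recursion_denominator N j lam"
proof -
  have "\<exists>Q. Q \<noteq> 0 \<and> (\<forall>lam. poly Q lam = recursion_denominator N j lam)"
  proof (induction j)
    case 0
    show ?case by (intro exI[of _ "[:- N, 1:]"]) (simp add: recursion_denominator_0)
  next
    case (Suc j)
    then obtain Q where Q: "Q \<noteq> 0" "\<And>lam. poly Q lam = recursion_denominator N j lam" by blast
    have "smult (4 * of_nat (Suc j)) ([:of_nat (Suc j) - N / 2, 1:] * Q) \<noteq> 0"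
      using Q(1) of_nat_neq_0[of j, where ?'a = complex] by (simp del: of_nat_Suc mult_pCons_left)
    moreover have "poly (smult (4 * of_nat (Suc j)) ([:of_nat (Suc j) - N / 2, 1:] * Q)) lam
        = recursion_denominator N (Suc j) lam" for lam
      unfolding recursion_denominator_Suc by (simp add: Q(2) algebra_simps)
    ultimately show ?case by blast
  qed
  then show thesis using that by blast
qed

lemma countable_recursion_denominator: "countable {lam. recursion_denominator N j lam = 0}"
proof -
  obtain Q where Q: "Q \<noteq> 0" "\<And>lam. poly Q lam = recursion_denominator N j lam"
    by (rule recursion_denominator_poly[of N j]) (rule that)
  show ?thesis using poly_roots_finite[OF Q(1)] by (simp add: Q(2) countable_finite)
qed

lemma continuous_on_recursion_denominator: "continuous_on UNIV (recursion_denominator N j)"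
proof -
  obtain Q where Q: "\<And>lam. poly Q lam = recursion_denominator N j lam"
    by (rule recursion_denominator_poly[of N j]) (rule that)
  have "continuous_on UNIV (poly Q)" by (intro continuous_intros)
  moreover have "poly Q = recursion_denominator N j" using Q by blast
  ultimately show ?thesis by simp
qed

lemma tangential_family:
  "\<exists>Q T. rational_family k k Q T \<and> (\<forall>lam. j = 0 \<or> recursion_denominator N j lam \<noteq> 0 \<longrightarrow>
    poly Q lam \<noteq> 0 \<and> (\<forall>\<phi>\<in>Omega UNIV k. T lam \<phi> = tangential_solution N lam \<phi> j))"
proof (cases "j = 0")
  case True
  have "\<exists>Q T. rational_family k k Q T \<and> (\<forall>lam. poly 1 lam \<noteq> (0::complex) \<longrightarrow> poly Q lam \<noteq> 0 \<and>
    (\<forall>w\<in>Omega UNIV k. T lam w = (\<lambda>y vs. operator_polynomial 0 (\<lambda>i w. w) lam w y vs / poly 1 lam)))"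
    by (rule rational_family_exists) (auto intro: natural_id)
  then show ?thesis using True by (simp add: operator_polynomial_def tangential_solution_def)
next
  case False
  obtain Q where Q: "Q \<noteq> 0" "\<And>lam. poly Q lam = recursion_denominator N j lam"
    by (rule recursion_denominator_poly[of N j]) (rule that)
  define D :: "nat \<Rightarrow> 'a form \<Rightarrow> 'a form" where
    "D i \<phi> = (\<lambda>y vs. (if i = 0 then - N else 1) * delta_d_power j \<phi> y vs
      + (if i = 0 then 2 * of_nat j - N else 1) * d_delta_power j \<phi> y vs)" for i \<phi>
  have D: "natural_operator k k (D i)" for i
    unfolding D_def[abs_def] by (intro natural_add natural_cmult natural_delta_d_power natural_d_delta_power)
  have "operator_polynomial 1 D lam \<phi> y vs
      = (lam - N) * delta_d_power j \<phi> y vs + (lam - N + 2 * of_nat j) * d_delta_power j \<phi> y vs" for lam \<phi> y vs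
    unfolding operator_polynomial_def D_def by (simp add: algebra_simps)
  then have "(\<lambda>y vs. operator_polynomial 1 D lam \<phi> y vs / poly Q lam) = tangential_solution N lam \<phi> j" for lam \<phi>
    using False by (simp add: tangential_solution_def Q(2))
  then show ?thesis
    using rational_family_exists[of Q k k D 1, OF Q(1) D] False by (simp only: Q(2)) simp
qed

lemma normal_family:
  "\<exists>Q T. rational_family k (k - 1) Q T \<and> (\<forall>lam. j = 0 \<or> recursion_denominator N (j - 1) lam \<noteq> 0 \<longrightarrow>
    poly Q lam \<noteq> 0 \<and> (\<forall>\<phi>\<in>Omega UNIV k. T lam \<phi> = normal_solution N lam \<phi> j))"
proof (cases "j = 0")
  case True
  have "\<exists>Q T. rational_family k (k - 1) Q T \<and> (\<forall>lam. poly 1 lam \<noteq> (0::complex) \<longrightarrow> poly Q lam \<noteq> 0 \<and>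
    (\<forall>w\<in>Omega UNIV k. T lam w = (\<lambda>y vs. operator_polynomial 0 (\<lambda>i w y vs. 0) lam w y vs / poly 1 lam)))"
    by (rule rational_family_exists) (auto intro: natural_zero)
  then show ?thesis using True by (simp add: operator_polynomial_def normal_solution_def)
next
  case False
  obtain Q where Q: "Q \<noteq> 0" "\<And>lam. poly Q lam = recursion_denominator N (j - 1) lam"
    by (rule recursion_denominator_poly[of N "j - 1"]) (rule that)
  define D :: "nat \<Rightarrow> 'a form \<Rightarrow> 'a form" where "D i \<phi> = flat_codiff UNIV (d_delta_power (j - 1) \<phi>)" for i \<phi>
  have D: "natural_operator k (k - 1) (D i)" for i
    unfolding D_def[abs_def] by (intro natural_flat_codiff natural_d_delta_power)
  have "(\<lambda>y vs. operator_polynomial 0 D lam \<phi> y vs / poly Q lam) = normal_solution N lam \<phi> j" for lam \<phi>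
    using False unfolding operator_polynomial_def D_def normal_solution_def Q(2) by simp
  then show ?thesis
    using rational_family_exists[of Q k "k - 1" D 0, OF Q(1) D] False by (simp only: Q(2)) simp
qed

lemma d_delta_power_codiff:
  assumes "\<phi> \<in> Omega UNIV k"
  shows "((ext_d UNIV \<circ> codiff UNIV euclidean_metric k) ^^ j) \<phi> = d_delta_power j \<phi>"
proof (induction j)
  case (Suc j)
  have "((ext_d UNIV \<circ> codiff UNIV euclidean_metric k) ^^ Suc j) \<phi>
      = ext_d UNIV (codiff UNIV euclidean_metric k (((ext_d UNIV \<circ> codiff UNIV euclidean_metric k) ^^ j) \<phi>))"
    by simp
  also have "\<dots> = ext_d UNIV (flat_codiff UNIV (d_delta_power j \<phi>))"
    unfolding Suc codiff_euclidean[OF d_delta_power_Omega[OF assms]] ..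
  also have "\<dots> = d_delta_power (Suc j) \<phi>" by simp
  finally show ?case .
qed simp

lemma delta_d_power_codiff:
  assumes "\<phi> \<in> Omega UNIV k"
  shows "((codiff UNIV euclidean_metric (k + 1) \<circ> ext_d UNIV) ^^ j) \<phi> = delta_d_power j \<phi>"
proof (induction j)
  case (Suc j)
  have "((codiff UNIV euclidean_metric (k + 1) \<circ> ext_d UNIV) ^^ Suc j) \<phi>
      = codiff UNIV euclidean_metric (k + 1) (ext_d UNIV (((codiff UNIV euclidean_metric (k + 1) \<circ> ext_d UNIV) ^^ j) \<phi>))"
    by simp
  also have "\<dots> = flat_codiff UNIV (ext_d UNIV (delta_d_power j \<phi>))"
    unfolding Suc codiff_euclidean[OF ext_d_Omega[OF open_UNIV delta_d_power_Omega[OF assms]]] ..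
  also have "\<dots> = delta_d_power (Suc j) \<phi>" by simp
  finally show ?case .
qed simp

text \<open>The closed formulas in lowest terms.  They solve the recursion off the zeros of
  their original denominators, and by continuity at every parameter at which the reduced families are regular.\<close>

lemma solution_operators_exist:
  "\<exists>Tp Tm :: nat \<Rightarrow> complex \<Rightarrow> (real^'n) form \<Rightarrow> (real^'n) form. solution_operators p Tp Tm"
proof -
  define N where "N = complex_of_nat CARD('n) - 2 * of_nat p"
  have N: "complex_of_int (int DIM(real^'n) - 2 * int p) = N" unfolding N_def by simp
  let ?P = "\<lambda>j Q (T :: complex \<Rightarrow> (real^'n) form \<Rightarrow> (real^'n) form). rational_family (int p) (int p) Q T \<and>
    (\<forall>lam. j = 0 \<or> recursion_denominator N j lam \<noteq> 0 \<longrightarrow>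
      poly Q lam \<noteq> 0 \<and> (\<forall>\<phi>\<in>Omega UNIV (int p). T lam \<phi> = tangential_solution N lam \<phi> j))"
  have "\<forall>j. \<exists>Q T. ?P j Q T" by (intro allI tangential_family)
  then obtain Qp where "\<forall>j. \<exists>T. ?P j (Qp j) T" by (rule choice[THEN exE])
  then obtain Tp where Tp: "\<forall>j. ?P j (Qp j) (Tp j)" by (rule choice[THEN exE])
  let ?M = "\<lambda>j Q (T :: complex \<Rightarrow> (real^'n) form \<Rightarrow> (real^'n) form). rational_family (int p) (int p - 1) Q T \<and>
    (\<forall>lam. j = 0 \<or> recursion_denominator N (j - 1) lam \<noteq> 0 \<longrightarrow>
      poly Q lam \<noteq> 0 \<and> (\<forall>\<phi>\<in>Omega UNIV (int p). T lam \<phi> = normal_solution N lam \<phi> j))"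
  have "\<forall>j. \<exists>Q T. ?M j Q T" by (intro allI normal_family)
  then obtain Qm where "\<forall>j. \<exists>T. ?M j (Qm j) T" by (rule choice[THEN exE])
  then obtain Tm where Tm: "\<forall>j. ?M j (Qm j) (Tm j)" by (rule choice[THEN exE])
  have p: "rational_family (int p) (int p) (Qp j) (Tp j)"
    "j = 0 \<or> recursion_denominator N j lam \<noteq> 0 \<Longrightarrow> \<phi> \<in> Omega UNIV (int p) \<Longrightarrow>
      Tp j lam \<phi> = tangential_solution N lam \<phi> j" for j lam \<phi>
    using Tp by blast+
  have m: "rational_family (int p) (int p - 1) (Qm j) (Tm j)"
    "j = 0 \<or> recursion_denominator N (j - 1) lam \<noteq> 0 \<Longrightarrow> \<phi> \<in> Omega UNIV (int p) \<Longrightarrow>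
      Tm j lam \<phi> = normal_solution N lam \<phi> j" for j lam \<phi>
    using Tm by blast+
  have "solution_operators p Tp Tm"
    unfolding solution_operators_def
  proof (rule exI[of _ Qp], rule exI[of _ Qm], intro conjI allI ballI impI p(1) m(1))
    fix lam and \<phi> :: "(real^'n) form"
    assume reg: "\<forall>j. poly (Qp j) lam \<noteq> 0 \<and> poly (Qm j) lam \<noteq> 0" and \<phi>: "\<phi> \<in> Omega UNIV (int p)"
    show "Tp 0 lam \<phi> = \<phi>" using p(2)[OF _ \<phi>, of 0] by (simp add: tangential_solution_def)
    show "Tm 0 lam \<phi> = (\<lambda>y vs. 0)" using m(2)[OF _ \<phi>, of 0] by (simp add: normal_solution_def)
    have "solves_recursion N lam (\<lambda>j. Tp j lam \<phi>) (\<lambda>j. Tm j lam \<phi>) j" for j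
    proof -
      have generic: "solves_recursion N z (\<lambda>j. Tp j z \<phi>) (\<lambda>j. Tm j z \<phi>) j" if nz: "recursion_denominator N j z \<noteq> 0" for z
      proof -
        have pred: "recursion_denominator N (i - 1) z \<noteq> 0" if "recursion_denominator N i z \<noteq> 0" for i
        proof (cases i)
          case (Suc l)
          then show ?thesis using that recursion_denominator_Suc[of N l z] by auto
        qed (use that in simp)
        note nz' = pred[OF nz] and nz'' = pred[OF pred[OF nz]]
        have T: "Tp j z \<phi> = tangential_solution N z \<phi> j" "Tp (j - 1) z \<phi> = tangential_solution N z \<phi> (j - 1)"
          "Tm j z \<phi> = normal_solution N z \<phi> j" "Tm (j - 1) z \<phi> = normal_solution N z \<phi> (j - 1)"
          using p(2)[OF _ \<phi>] m(2)[OF _ \<phi>] nz nz' nz'' by auto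
        show ?thesis
          unfolding solves_recursion_def T
          by (rule solutions_solve_recursion[OF \<phi> nz, unfolded solves_recursion_def])
      qed
      have contp: "isCont (\<lambda>z. X (Tp i z \<phi>)) lam" if "linear_functional_on_forms (int p) X" for X i
        using isCont_rational_family[OF p(1) _ \<phi> that] reg by blast
      have contm: "isCont (\<lambda>z. X (Tm i z \<phi>)) lam" if "linear_functional_on_forms (int p - 1) X" for X i
        using isCont_rational_family[OF m(1) _ \<phi> that] reg by blast
      have cnt: "countable {z. f z \<noteq> 0}" if "\<And>z. recursion_denominator N j z \<noteq> 0 \<Longrightarrow> f z = 0" for f :: "complex \<Rightarrow> complex"
        using that by (intro countable_subset[OF _ countable_recursion_denominator[of N j]]) auto
      note lf = linear_functional_eval linear_functional_ext_d linear_functional_flat_codiff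
      have ev: "isCont (\<lambda>z. Tp i z \<phi> y vs) lam" "isCont (\<lambda>z. Tm i z \<phi> y vs) lam"
        "isCont (\<lambda>z. ext_d UNIV (Tm i z \<phi>) y vs) lam" "isCont (\<lambda>z. flat_codiff UNIV (Tp i z \<phi>) y vs) lam"
        "isCont (\<lambda>z. flat_laplacian (Tp i z \<phi>) y vs) lam" "isCont (\<lambda>z. flat_laplacian (Tm i z \<phi>) y vs) lam" for i y vs
        unfolding flat_laplacian_def
        by (intro contp contm lf continuous_add contp[OF lf(3)[OF lf(2)[OF lf(1)]]] contp[OF lf(2)[OF lf(3)[OF lf(1)]]]
            contm[OF lf(3)[OF lf(2)[OF lf(1)]]] contm[OF lf(2)[OF lf(3)[OF lf(1)]]])+
      show ?thesis
        unfolding solves_recursion_def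
      proof (intro allI conjI)
        fix y vs
        let ?f = "\<lambda>z. 2 * of_nat j * (N - 2 * z - 2 * of_nat j) * Tp j z \<phi> y vs + 2 * ext_d UNIV (Tm j z \<phi>) y vs
          + (if j = 0 then 0 else flat_laplacian (Tp (j - 1) z \<phi>) y vs)"
        show "?f lam = 0"
        proof (rule isCont_eq_0_if_countable[where f = ?f])
          show "isCont ?f lam" by (cases "j = 0") (auto intro!: continuous_intros ev)
        qed (rule cnt, rule conjunct1[OF generic[unfolded solves_recursion_def, THEN spec, THEN spec]])
        let ?g = "\<lambda>z. (2 * of_nat j * (N - 2 * z - 2 * of_nat j) + 2 * (z + 2 * of_nat j)) * Tm j z \<phi> y vs
          + (if j = 0 then 0 else 2 * flat_codiff UNIV (Tp (j - 1) z \<phi>) y vs + flat_laplacian (Tm (j - 1) z \<phi>) y vs)"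
        show "?g lam = 0"
        proof (rule isCont_eq_0_if_countable[where f = ?g])
          show "isCont ?g lam" by (cases "j = 0") (auto intro!: continuous_intros ev)
        qed (rule cnt, rule conjunct2[OF generic[unfolded solves_recursion_def, THEN spec, THEN spec]])
      qed
    qed
    moreover have "Tp j lam \<phi> \<in> Omega UNIV (int p)" "Tm j lam \<phi> \<in> Omega UNIV (int p - 1)" for j
      using rational_family_Omega[OF p(1) _ \<phi>] rational_family_Omega[OF m(1) _ \<phi>] reg by auto
    ultimately show "formal_eigenform (int p) lam (lam * (of_nat CARD('n) - 2 * of_nat p - lam))
        (\<lambda>i. if even i then Tp (i div 2) lam \<phi> else (\<lambda>y vs. 0))
        (\<lambda>i. if even i then Tm (i div 2) lam \<phi> else (\<lambda>y vs. 0))"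
      using formal_eigenform_even_iff[of "\<lambda>j. Tp j lam \<phi>" "int p" "\<lambda>j. Tm j lam \<phi>" lam]
      unfolding N unfolding N_def by blast
  qed
  then show ?thesis by blast
qed

text \<open>The recursion determines the operators off a countable set of parameters, and
  \<open>rational_family_regular\<close> extends the result.\<close>

lemma solution_operators_unique:
  fixes Tp Tm :: "nat \<Rightarrow> complex \<Rightarrow> (real^'n) form \<Rightarrow> (real^'n) form" and p :: nat
  defines "N \<equiv> complex_of_nat CARD('n) - 2 * of_nat p"
  assumes sol: "solution_operators p Tp Tm" and \<phi>: "\<phi> \<in> Omega UNIV (int p)"
  shows "j = 0 \<or> recursion_denominator N j lam \<noteq> 0 \<Longrightarrow> Tp j lam \<phi> = tangential_solution N lam \<phi> j"
    and "j = 0 \<or> recursion_denominator N (j - 1) lam \<noteq> 0 \<Longrightarrow> Tm j lam \<phi> = normal_solution N lam \<phi> j"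
proof -
  have N: "complex_of_int (int DIM(real^'n) - 2 * int p) = N" unfolding N_def by simp
  obtain Qp Qm where S: "(\<forall>j. rational_family (int p) (int p) (Qp j) (Tp j)) \<and>
    (\<forall>j. rational_family (int p) (int p - 1) (Qm j) (Tm j)) \<and>
    (\<forall>lam. (\<forall>j. poly (Qp j) lam \<noteq> 0 \<and> poly (Qm j) lam \<noteq> 0) \<longrightarrow>
      (\<forall>\<phi>\<in>Omega UNIV (int p). Tp 0 lam \<phi> = \<phi> \<and> Tm 0 lam \<phi> = (\<lambda>y vs. 0) \<and>
        formal_eigenform (int p) lam (lam * (of_nat CARD('n) - 2 * of_nat p - lam))
          (\<lambda>i. if even i then Tp (i div 2) lam \<phi> else (\<lambda>y vs. 0))
          (\<lambda>i. if even i then Tm (i div 2) lam \<phi> else (\<lambda>y vs. 0))))"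
    using sol unfolding solution_operators_def by (elim exE) (rule that)
  note p = S[THEN conjunct1, rule_format] and m = S[THEN conjunct2, THEN conjunct1, rule_format]
    and eig = S[THEN conjunct2, THEN conjunct2, THEN spec, THEN mp, THEN bspec]
  define r where "r j lam = 2 * of_nat j * (N - 2 * lam - 2 * of_nat j) + 2 * (lam + 2 * of_nat j)" for j :: nat and lam
  \<comment> \<open>The generic parameters: all families are regular, and no leading coefficient of the recursion vanishes.\<close>
  define P where "P lam \<longleftrightarrow> (\<forall>j. poly (Qp j) lam \<noteq> 0 \<and> poly (Qm j) lam \<noteq> 0 \<and> recursion_denominator N j lam \<noteq> 0 \<and> (j \<ge> 1 \<longrightarrow> r j lam \<noteq> 0))" for lam
  have "countable {lam. poly (Qp j) lam = 0}" "countable {lam. poly (Qm j) lam = 0}" for j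
    using rational_family_nonzero[OF p] rational_family_nonzero[OF m]
    by (simp_all add: poly_roots_finite countable_finite)
  moreover have "countable {lam. r j lam = 0}" if "j \<ge> 1" for j
  proof -
    have "{lam. r j lam = 0} \<subseteq> {(of_nat j * (N - 2 * of_nat j) + 2 * of_nat j) / (2 * of_nat j - 1)}"
    proof
      fix lam assume "lam \<in> {lam. r j lam = 0}"
      then have "r j lam = 0" by simp
      define Z where "Z = of_nat j * (N - 2 * of_nat j) + 2 * of_nat j - lam * (2 * of_nat j - 1)"
      have "r j lam = 2 * Z"
        unfolding r_def Z_def by (simp add: algebra_simps)
      then have "Z = 0" using \<open>r j lam = 0\<close> by simp
      then have "lam * (2 * of_nat j - 1) = of_nat j * (N - 2 * of_nat j) + 2 * of_nat j"
        unfolding Z_def by simp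
      moreover have "2 * of_nat j - 1 \<noteq> (0::complex)"
      proof -
        have "2 * of_nat j - 1 = (of_int (2 * int j - 1) :: complex)" by simp
        moreover have "2 * int j - 1 \<noteq> 0" by presburger
        ultimately show ?thesis by (simp only: of_int_eq_0_iff) simp
      qed
      ultimately show "lam \<in> {(of_nat j * (N - 2 * of_nat j) + 2 * of_nat j) / (2 * of_nat j - 1)}"
        by (simp add: field_simps)
    qed
    then show ?thesis using countable_subset by blast
  qed
  ultimately have "countable (\<Union>j. {lam. poly (Qp j) lam = 0} \<union> {lam. poly (Qm j) lam = 0}
      \<union> {lam. recursion_denominator N j lam = 0} \<union> (if j \<ge> 1 then {lam. r j lam = 0} else {}))"
    by (intro countable_UN countable_Un) (auto simp: countable_recursion_denominator)
  then have cP: "countable {lam. \<not> P lam}"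
    by (rule countable_subset[rotated]) (auto simp: P_def)
  have gen: "Tp j lam \<phi> = tangential_solution N lam \<phi> j \<and> Tm j lam \<phi> = normal_solution N lam \<phi> j"
    if Pl: "P lam" and \<phi>: "\<phi> \<in> Omega UNIV (int p)" for lam \<phi> j
  proof -
    have reg: "\<forall>j. poly (Qp j) lam \<noteq> 0 \<and> poly (Qm j) lam \<noteq> 0" using Pl unfolding P_def by blast
    note E = eig[OF reg \<phi>]
    have "Tp j lam \<phi> \<in> Omega UNIV (int p)" "Tm j lam \<phi> \<in> Omega UNIV (int p - 1)" for j
      using rational_family_Omega[OF p _ \<phi>] rational_family_Omega[OF m _ \<phi>] reg by auto
    then have rec: "solves_recursion N lam (\<lambda>j. Tp j lam \<phi>) (\<lambda>j. Tm j lam \<phi>) j" for j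
      using formal_eigenform_even_iff[of "\<lambda>j. Tp j lam \<phi>" "int p" "\<lambda>j. Tm j lam \<phi>" lam] E
      unfolding N unfolding N_def by blast
    show ?thesis
      by (rule recursion_unique[OF \<phi> rec]) (use E Pl in \<open>auto simp: P_def r_def\<close>)
  qed
  show "Tp j lam \<phi> = tangential_solution N lam \<phi> j" if nz: "j = 0 \<or> recursion_denominator N j lam \<noteq> 0"
  proof (cases "j = 0")
    case True
    have "Tp j lam \<phi> = (\<lambda>y vs. \<phi> y vs / 1)"
      by (rule rational_family_regular(2)[OF p cP, where q = "\<lambda>_. 1" and G = "\<lambda>lam \<phi>. \<phi>", OF _ _ _ _ \<phi>])
        (use gen True in \<open>auto simp: P_def tangential_solution_def\<close>)
    then show ?thesis using True by (simp add: tangential_solution_def)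
  next
    case False
    have "Tp j lam \<phi> = (\<lambda>y vs. ((lam - N) * delta_d_power j \<phi> y vs + (lam - N + 2 * of_nat j) * d_delta_power j \<phi> y vs)
        / recursion_denominator N j lam)"
      by (rule rational_family_regular(2)[OF p cP, where q = "recursion_denominator N j" and
            G = "\<lambda>lam \<phi> y vs. (lam - N) * delta_d_power j \<phi> y vs + (lam - N + 2 * of_nat j) * d_delta_power j \<phi> y vs",
            OF _ _ _ _ \<phi>])
        (use gen False nz in \<open>auto simp: P_def tangential_solution_def intro!: continuous_intros continuous_on_recursion_denominator\<close>)
    then show ?thesis using False by (simp add: tangential_solution_def)
  qed
  show "Tm j lam \<phi> = normal_solution N lam \<phi> j" if nz: "j = 0 \<or> recursion_denominator N (j - 1) lam \<noteq> 0"
  proof (cases "j = 0")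
    case True
    have "Tm j lam \<phi> = (\<lambda>y vs. 0 / 1)"
      by (rule rational_family_regular(2)[OF m cP, where q = "\<lambda>_. 1" and G = "\<lambda>lam \<phi> y vs. 0", OF _ _ _ _ \<phi>])
        (use gen True in \<open>auto simp: P_def normal_solution_def\<close>)
    then show ?thesis using True by (simp add: normal_solution_def)
  next
    case False
    have "Tm j lam \<phi> = (\<lambda>y vs. flat_codiff UNIV (d_delta_power (j - 1) \<phi>) y vs / recursion_denominator N (j - 1) lam)"
      by (rule rational_family_regular(2)[OF m cP, where q = "recursion_denominator N (j - 1)" and
            G = "\<lambda>lam \<phi>. flat_codiff UNIV (d_delta_power (j - 1) \<phi>)", OF _ _ _ _ \<phi>])
        (use gen False nz in \<open>auto simp: P_def normal_solution_def intro!: continuous_on_recursion_denominator\<close>)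
    then show ?thesis using False by (simp add: normal_solution_def)
  qed
qed

lemma recursion_denominator_nonzero:
  assumes "\<forall>i\<in>{1..j}. lam \<noteq> N / 2 - of_nat i" "lam \<noteq> N" "i \<le> j"
  shows "recursion_denominator N i lam \<noteq> 0"
proof
  assume "recursion_denominator N i lam = 0"
  then have "pochhammer (lam - N / 2 + 1) i = 0"
    using assms(2) by (simp add: recursion_denominator_def)
  then obtain k where "k < i" "lam - N / 2 + 1 = - of_nat k"
    unfolding pochhammer_eq_0_iff by blast
  then have "Suc k \<in> {1..j}" "lam = N / 2 - of_nat (Suc k)"
    using assms(3) by (auto simp: algebra_simps)
  then show False using assms(1) by blast
qed

theorem theorem3p2:
  fixes p :: nat
  assumes "CARD('n::finite) \<ge> 3" and "p \<le> CARD('n)"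
  shows "(\<exists>Tp Tm :: nat \<Rightarrow> complex \<Rightarrow> (real^'n) form \<Rightarrow> (real^'n) form.
            solution_operators p Tp Tm) \<and>
    (\<forall>(Tp :: nat \<Rightarrow> complex \<Rightarrow> (real^'n) form \<Rightarrow> (real^'n) form) Tm.
      solution_operators p Tp Tm \<longrightarrow>
      (\<forall>(j::nat) (lam::complex).
        j \<ge> 1 \<longrightarrow>
        (\<forall>N\<in>{1..j}. lam \<noteq> of_nat CARD('n) / 2 - of_nat p - of_nat N) \<longrightarrow>
        lam \<noteq> of_nat CARD('n) - 2 * of_nat p \<longrightarrow>
        (\<forall>\<phi>\<in>Omega UNIV (int p).
          Tm j lam \<phi> = (\<lambda>y vs.
            1 / (4 ^ (j - 1) * fact (j - 1)
                 * pochhammer (lam - (of_nat CARD('n) - 2 * of_nat p) / 2 + 1) (j - 1)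
                 * (lam - of_nat CARD('n) + 2 * of_nat p))
            * delta_flat (int p) (((d_flat \<circ> delta_flat (int p)) ^^ (j - 1)) \<phi>) y vs) \<and>
          Tp j lam \<phi> = (\<lambda>y vs.
            1 / (4 ^ j * fact j
                 * pochhammer (lam - (of_nat CARD('n) - 2 * of_nat p) / 2 + 1) j
                 * (lam - of_nat CARD('n) + 2 * of_nat p))
            * ((lam - of_nat CARD('n) + 2 * of_nat p)
                 * ((delta_flat (int p + 1) \<circ> d_flat) ^^ j) \<phi> y vs
               + (lam - of_nat CARD('n) + 2 * of_nat p + 2 * of_nat j)
                 * ((d_flat \<circ> delta_flat (int p)) ^^ j) \<phi> y vs)) \<and>
          Tm 0 lam \<phi> = (\<lambda>y vs. 0) \<and>
          Tp 0 lam \<phi> = \<phi>)))"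
proof (intro conjI allI impI ballI solution_operators_exist)
  fix Tp Tm :: "nat \<Rightarrow> complex \<Rightarrow> (real^'n) form \<Rightarrow> (real^'n) form"
    and j :: nat and lam :: complex and \<phi> :: "(real^'n) form"
  assume sol: "solution_operators p Tp Tm" and j: "j \<ge> 1"
    and l1: "\<forall>N\<in>{1..j}. lam \<noteq> of_nat CARD('n) / 2 - of_nat p - of_nat N"
    and l2: "lam \<noteq> of_nat CARD('n) - 2 * of_nat p" and \<phi>: "\<phi> \<in> Omega UNIV (int p)"
  define N where "N = complex_of_nat CARD('n) - 2 * of_nat p"
  have lN: "lam - of_nat CARD('n) + 2 * of_nat p = lam - N" unfolding N_def by simp
  have "N / 2 = of_nat CARD('n) / 2 - of_nat p" unfolding N_def by (simp add: field_simps)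
  then have nz: "recursion_denominator N i lam \<noteq> 0" if "i \<le> j" for i
    using l1 l2 that unfolding N_def by (intro recursion_denominator_nonzero[of j]) auto
  note U = solution_operators_unique[OF sol \<phi>, folded N_def]
  note A = d_delta_power_codiff[OF \<phi>] and B = delta_d_power_codiff[OF \<phi>]
  show "Tp 0 lam \<phi> = \<phi>" using U(1)[of 0 lam] by (simp add: tangential_solution_def)
  show "Tm 0 lam \<phi> = (\<lambda>y vs. 0)" using U(2)[of 0 lam] by (simp add: normal_solution_def)
  show "Tp j lam \<phi> = (\<lambda>y vs.
            1 / (4 ^ j * fact j
                 * pochhammer (lam - (of_nat CARD('n) - 2 * of_nat p) / 2 + 1) j
                 * (lam - of_nat CARD('n) + 2 * of_nat p))
            * ((lam - of_nat CARD('n) + 2 * of_nat p)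
                 * ((delta_flat (int p + 1) \<circ> d_flat) ^^ j) \<phi> y vs
               + (lam - of_nat CARD('n) + 2 * of_nat p + 2 * of_nat j)
                 * ((d_flat \<circ> delta_flat (int p)) ^^ j) \<phi> y vs))"
    unfolding A B lN N_def[symmetric]
    using U(1)[of j lam] nz[of j] j by (simp add: tangential_solution_def recursion_denominator_def)
  show "Tm j lam \<phi> = (\<lambda>y vs.
            1 / (4 ^ (j - 1) * fact (j - 1)
                 * pochhammer (lam - (of_nat CARD('n) - 2 * of_nat p) / 2 + 1) (j - 1)
                 * (lam - of_nat CARD('n) + 2 * of_nat p))
            * delta_flat (int p) (((d_flat \<circ> delta_flat (int p)) ^^ (j - 1)) \<phi>) y vs)"
    unfolding A lN N_def[symmetric] codiff_euclidean[OF d_delta_power_Omega[OF \<phi>]]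
    using U(2)[of j lam] nz[of "j - 1"] j by (simp add: normal_solution_def recursion_denominator_def)
qed

end
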